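(* Let $k, \ell \geq 1$ be integers. Then: (a) $\mathcal{H}(k^\ell)$, for even $k, \ell$, contains regular origamis; (b) $\mathcal{H}(2^\ell)$, for odd $\ell$, contains regular origamis if and only if $\ell$ is divisible by $9$; (c) $\mathcal{H}(k^2)$, for odd $k$, contains no regular origamis; (d) $\mathcal{H}(k^4)$ contains regular origamis; (e) $\mathcal{H}(k^6)$, when $k \equiv 1 \pmod 4$, contains regular origamis if and only if every prime factor of $(k+1)/2$ is congruent to $1$ modulo $3$; (f) $\mathcal{H}(k^6)$, when $k \equiv 3 \pmod 4$, contains regular origamis if and only if every prime factor of $(k+1)/4$ is congruent to $1$ modulo $3$. Furthermore, if $q$ is an odd prime, then: (g) $\mathcal{H}(k^{2q})$, for odd $k$ and $q > 3$, contains no regular origamis; (h) $\mathcal{H}(2k^q)$ contains regular origamis if and only if every prime factor of $2k+1$ is congruent to $1$ modulo $q$.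
   Context: A translation surface $(X,\omega)$ is a compact connected Riemann surface $X$ together with a nonzero abelian differential (holomorphic $1$-form) $\omega$. For integers $k, \ell \geq 1$, the stratum $\mathcal{H}(k^\ell)$ is the set of translation surfaces whose differential has exactly $\ell$ zeros, all of order $k$ (superscripts denote multiplicities, not powers; e.g. $\mathcal{H}(2k^q)$ means $q$ zeros of order $2k$). The genus $g$ of such a surface satisfies $2g-2 = k\ell$. An origami is a translation surface obtained as a finite connected cover of the unit square torus $\mathbb{R}^2/\mathbb{Z}^2$ (with the form $dz$), branched over at most the single point $0$, with the pulled-back differential. It is regular if the covering is normal. Equivalently, a regular origami is built from a finite group $G$ generated by two elements $x,y$: take unit squares labelled by the elements of $G$, with rightward gluings given by multiplication by $x$ and upward gluings given by multiplication by $y$. The resulting origami lies in $\mathcal{H}(k^\ell)$ if and only if the commutator $[x,y] = xyx^{-1}y^{-1}$ has order $k+1$ and $\langle [x,y]\rangle$ has index $\ell$ in $G$. *)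

theory Defs
  imports Complex_Main "HOL-Number_Theory.Number_Theory"
begin

text \<open>
  A finite cover of the unit square torus, branched over at most the point 0, is cut by the
  preimages of the sides of the unit square into finitely many unit squares. The square \<open>a\<close> is
  glued along its right side to the left side of \<open>right Or a\<close>, and along its top side to the
  bottom side of \<open>up Or a\<close>. The covering map sends the point \<open>(s, t)\<close> of every square to
  \<open>(s, t)\<close> modulo \<open>\<int>\<^sup>2\<close>, and the differential is the pullback of \<open>dz\<close> (the form \<open>dz\<close> on each
  square).
\<close>

record 'a origami =
  squares :: "'a set"
  right :: "'a \<Rightarrow> 'a"
  up :: "'a \<Rightarrow> 'a"

definition adjacent :: "'a origami \<Rightarrow> 'a rel" where
  "adjacent Or = {(a, right Or a) |a. a \<in> squares Or} \<union> {(a, up Or a) |a. a \<in> squares Or}"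

definition is_origami :: "'a origami \<Rightarrow> bool" where
  "is_origami Or \<longleftrightarrow>
     finite (squares Or) \<and> squares Or \<noteq> {} \<and>
     bij_betw (right Or) (squares Or) (squares Or) \<and>
     bij_betw (up Or) (squares Or) (squares Or) \<and>
     (\<forall>a\<in>squares Or. \<forall>b\<in>squares Or. (a, b) \<in> (adjacent Or \<union> (adjacent Or)\<inverse>)\<^sup>*)"

text \<open>
  A deck transformation preserves the covering map, so it keeps the coordinates \<open>(s, t)\<close> and is
  a permutation of the squares that respects the gluings. A connected covering is normal iff its
  deck transformations act transitively on a fibre over an unbranched point, and the squares
  correspond to such a fibre.
\<close>

definition deck_transformation :: "'a origami \<Rightarrow> ('a \<Rightarrow> 'a) \<Rightarrow> bool" where
  "deck_transformation Or f \<longleftrightarrow>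
     bij_betw f (squares Or) (squares Or) \<and>
     (\<forall>a\<in>squares Or. f (right Or a) = right Or (f a) \<and> f (up Or a) = up Or (f a))"

definition regular_origami :: "'a origami \<Rightarrow> bool" where
  "regular_origami Or \<longleftrightarrow>
     is_origami Or \<and>
     (\<forall>a\<in>squares Or. \<forall>b\<in>squares Or. \<exists>f. deck_transformation Or f \<and> f a = b)"

text \<open>The point set of the surface: closed unit squares modulo the gluings of their sides.\<close>

definition tile_points :: "'a origami \<Rightarrow> ('a \<times> real \<times> real) set" where
  "tile_points Or = squares Or \<times> {0..1} \<times> {0..1}"

definition side_gluing :: "'a origami \<Rightarrow> ('a \<times> real \<times> real) rel" where
  "side_gluing Or =
     {((a, 1, t), (right Or a, 0, t)) |a t. a \<in> squares Or \<and> t \<in> {0..1}} \<union>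
     {((a, s, 1), (up Or a, s, 0)) |a s. a \<in> squares Or \<and> s \<in> {0..1}}"

definition glued :: "'a origami \<Rightarrow> ('a \<times> real \<times> real) rel" where
  "glued Or = (side_gluing Or \<union> (side_gluing Or)\<inverse>)\<^sup>* \<inter> (tile_points Or \<times> tile_points Or)"

definition surface :: "'a origami \<Rightarrow> ('a \<times> real \<times> real) set set" where
  "surface Or = tile_points Or // glued Or"

text \<open>
  The angle of a closed unit square at its point \<open>(s, t)\<close> is \<open>2\<pi>\<close> in the interior, \<open>\<pi>\<close> on an open
  side and \<open>\<pi>/2\<close> at a corner. The total angle of the flat metric around a point of the surface is
  \<open>2\<pi>(m + 1)\<close>, where \<open>m\<close> is the order of vanishing of the differential: in a local coordinate \<open>w\<close>
  there the covering map is \<open>c + w\<^bsup>m + 1\<^esup>\<close>, and the differential is its derivative.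
\<close>

definition tile_angle :: "real \<Rightarrow> real \<Rightarrow> real" where
  "tile_angle s t =
     2 * pi * (if 0 < s \<and> s < 1 then 1 else 1 / 2) * (if 0 < t \<and> t < 1 then 1 else 1 / 2)"

definition cone_angle :: "('a \<times> real \<times> real) set \<Rightarrow> real" where
  "cone_angle P = (\<Sum>(a, s, t)\<in>P. tile_angle s t)"

definition vanishing_order :: "('a \<times> real \<times> real) set \<Rightarrow> real" where
  "vanishing_order P = cone_angle P / (2 * pi) - 1"

definition zeros :: "'a origami \<Rightarrow> ('a \<times> real \<times> real) set set" where
  "zeros Or = {P \<in> surface Or. vanishing_order P > 0}"

text \<open>The origamis in \<open>\<H>(k\<^sup>l)\<close>: exactly \<open>l\<close> zeros, each of order \<open>k\<close> (intended for \<open>k, l \<ge> 1\<close>).\<close>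

definition stratum :: "nat \<Rightarrow> nat \<Rightarrow> 'a origami set" where
  "stratum k l =
     {Or. is_origami Or \<and> finite (zeros Or) \<and> card (zeros Or) = l \<and>
          (\<forall>P\<in>zeros Or. vanishing_order P = real k)}"

text \<open>The squares form a finite set, so natural numbers suffice as labels.\<close>

definition contains_regular_origamis :: "nat \<Rightarrow> nat \<Rightarrow> bool" where
  "contains_regular_origamis k l \<longleftrightarrow> (\<exists>Or :: nat origami. regular_origami Or \<and> Or \<in> stratum k l)"

end

theory Submission
  imports Defs "HOL-Algebra.Multiplicative_Group" "HOL-Algebra.Sylow" "HOL-Algebra.Bij"
begin

text \<open>
  A regular origami is its monodromy group, a finite group \<open>G\<close> generated by \<open>x\<close> and \<open>y\<close>. Its vertices
  are the orbits of the commutator \<open>c\<close>, so it lies in \<open>\<H>(k\<^sup>l)\<close> iff \<open>c\<close> has order \<open>k + 1\<close> and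
  \<open>C = \<langle>c\<rangle>\<close> has index \<open>l\<close>.

  The transfer to an abelian subgroup kills \<open>c\<close>. Hence a central \<open>c\<close> cannot have prime order \<open>p\<close>
  unless \<open>p\<^sup>3\<close> divides \<open>|G|\<close>. If the index is a prime \<open>q\<close>, then \<open>C\<close> is normal, and an element outside
  \<open>C\<close> acts on each factor of prime order \<open>p\<close> of \<open>C\<close> by some \<open>u \<noteq> 1\<close> with \<open>u\<^sup>q = 1\<close>, whence
  \<open>p \<equiv> 1 (mod q)\<close>. If \<open>|C|\<close> is even and the index is \<open>2q\<close>, then modulo the core of \<open>C\<close>, counting
  conjugates and transfer leave only a Klein four-group extended by an element of order 3, so
  \<open>q = 3\<close>, and the core behaves as in the case of prime index except for its 2-part. If \<open>|G|\<close> is odd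
  and not divisible by 27 and \<open>c\<close> has order 3, then the Sylow 3-subgroup \<open>P\<close> is abelian and the
  transfer of \<open>c\<close> to \<open>P\<close> is a product of conjugates of \<open>c\<close>, no two of them inverse to each other,
  which cannot be trivial.

  All existence claims are realized by split extensions by cyclic groups.
\<close>

text \<open>Every hypothesis on \<open>C\<close> is about its index, so it survives division by a
  normal subgroup inside \<open>C\<close>. This lets the transfer be used modulo a subgroup of index
  \<open>p\<close> in a cyclic normal subgroup, where the order left is \<open>q * p\<close>,
  \<open>4 * q\<close> or \<open>12 * p\<close> and hence too small for a third power of the prime
  concerned. At index \<open>2 * q\<close> the obstacle is to find any proper normal subgroup:
  simple groups are excluded by counting the elements of conjugate subgroups, and only then does
  division by a normal subgroup lead back to prime index. The dependence of index 6 on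
  \<open>k\<close> modulo 4 comes from comparing squares. Modulo the core, generated by the square
  of \<open>c\<close>, three conjugates of \<open>c\<close> are the involutions of the Klein
  four-group, so one of them is the product of the other two up to an element of the core. Squaring
  this relation leaves a commutator of order at most 2 as the only possible correction, and when 4
  divides the order of the core this correction is itself a square there. Hence the 2-part of the
  order of \<open>c\<close> is at most 4; the values 2 and 4 are realized by the Klein four-group
  and the quaternion group.\<close>

lemma funpow_fixed_if_coprime:
  assumes "(f ^^ d) y = y" "(f ^^ p) y = y" "coprime d p" "d \<noteq> 0"
  shows "f y = y"
proof -
  have mult: "(f ^^ (k * e)) y = y" if "(f ^^ e) y = y" for k e
    by (induction k) (simp_all add: funpow_add that)
  obtain a b where ab: "d * a = p * b + 1"
    using bezout_nat[OF assms(4), of p] assms(3) by auto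
  have "y = (f ^^ (d * a)) y" using mult[OF assms(1), of a] by (simp add: mult.commute)
  also have "\<dots> = f ((f ^^ (p * b)) y)" by (simp add: ab)
  also have "\<dots> = f y" using mult[OF assms(2), of b] by (simp add: mult.commute)
  finally show ?thesis by simp
qed

text \<open>A point whose period divides the prime \<open>p\<close> and which is not fixed has an
  orbit of exactly \<open>p\<close> points, so a set without fixed points splits into such orbits.
  As an induction rule, this decomposition serves both for counting and for products over
  cosets.\<close>

lemma prime_period_orbit_induct [consumes 4, case_names empty orbit]:
  fixes f :: "'a \<Rightarrow> 'a"
  assumes p: "prime (p::nat)" and fin: "finite X"
    and f: "\<And>x. x \<in> X \<Longrightarrow> f x \<in> X \<and> (f ^^ p) x = x"
    and nf: "\<And>x. x \<in> X \<Longrightarrow> f x \<noteq> x"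
    and Q0: "Q {}"
    and step: "\<And>x Y. \<lbrakk>x \<in> X; Y \<subseteq> X; (\<lambda>i. (f ^^ i) x) ` {..<p} \<subseteq> X; Q Y;
          inj_on (\<lambda>i. (f ^^ i) x) {..<p}; (\<lambda>i. (f ^^ i) x) ` {..<p} \<inter> Y = {}\<rbrakk>
        \<Longrightarrow> Q ((\<lambda>i. (f ^^ i) x) ` {..<p} \<union> Y)"
  shows "Q X"
proof -
  have "Q Y" if "Y \<subseteq> X" "\<And>x. x \<in> Y \<Longrightarrow> f x \<in> Y" for Y
    using finite_subset[OF that(1) fin] that
  proof (induction Y rule: finite_psubset_induct)
    case (psubset Y)
    show ?case
    proof (cases "Y = {}")
      case True then show ?thesis using Q0 by simp
    next
      case False
      then obtain x where x: "x \<in> Y" by blast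
      then have xX: "x \<in> X" using psubset by blast
      let ?O = "(\<lambda>i. (f ^^ i) x) ` {..<p}"
      have itY: "(f ^^ i) x \<in> Y" for i
        by (induction i) (use x psubset.prems in auto)
      have p0: "p > 0" using p prime_gt_0_nat by blast
      have per: "(f ^^ p) ((f ^^ i) x) = (f ^^ i) x" for i
        using f[of "(f ^^ i) x"] itY psubset.prems by blast
      have xO: "x \<in> ?O" using p0 by (auto intro!: image_eqI[of _ _ 0])
      have inj: "inj_on (\<lambda>i. (f ^^ i) x) {..<p}"
      proof (rule linorder_inj_onI)
        fix i j assume ij: "i < j" "i \<in> {..<p}" "j \<in> {..<p}"
        show "(f ^^ i) x \<noteq> (f ^^ j) x"
        proof
          assume eq: "(f ^^ i) x = (f ^^ j) x"
          have "(f ^^ (j - i)) ((f ^^ i) x) = (f ^^ i) x"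
            using eq ij by (metis add_diff_inverse_nat add.commute comp_apply funpow_add less_asym)
          moreover have "coprime (j - i) p"
            using ij p by (metis coprime_commute diff_is_0_eq gr_zeroI lessThan_iff less_imp_diff_less
                linorder_not_le nat_dvd_not_less prime_imp_coprime)
          ultimately have "f ((f ^^ i) x) = (f ^^ i) x"
            using funpow_fixed_if_coprime[of "j - i" f "(f ^^ i) x" p] per ij by auto
          then show False using nf itY psubset.prems by blast
        qed
      qed auto
      have "Q (Y - ?O)"
      proof (rule psubset.IH)
        show "Y - ?O \<subset> Y" using x xO by blast
        show "Y - ?O \<subseteq> X" using psubset by blast
        fix y assume y: "y \<in> Y - ?O"
        \<comment> \<open>Periodicity replaces an inverse of \<open>f\<close>: \<open>y\<close> is
          \<open>f ^^ (p - 1)\<close> applied to \<open>f y\<close>, so it would lie on the orbit as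
          well.\<close>
        have "f y \<notin> ?O"
        proof
          assume "f y \<in> ?O"
          then obtain i where i: "f y = (f ^^ i) x" by blast
          have "y = (f ^^ p) y" using f y psubset by auto
          also have "\<dots> = (f ^^ (p - 1)) (f y)"
            using p0 by (metis Suc_pred' comp_apply funpow_Suc_right)
          also have "\<dots> = (f ^^ (p - 1 + i)) x" by (simp add: i funpow_add)
          also have "\<dots> = (f ^^ ((p - 1 + i) mod p)) x"
            using per[of 0] by (simp add: funpow_mod_eq)
          finally have "y \<in> ?O" using p0 by auto
          then show False using y by blast
        qed
        then show "f y \<in> Y - ?O" using y psubset.prems by blast
      qed
      then have "Q (?O \<union> (Y - ?O))"
        using step[OF xX, of "Y - ?O"] inj itY psubset.prems by auto
      moreover have "?O \<union> (Y - ?O) = Y" using itY by blast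
      ultimately show ?thesis by simp
    qed
  qed
  then show ?thesis using f by blast
qed

lemma card_fixed_cong:
  fixes f :: "'a \<Rightarrow> 'a"
  assumes p: "prime (p::nat)" and fin: "finite X"
    and f: "\<And>x. x \<in> X \<Longrightarrow> f x \<in> X \<and> (f ^^ p) x = x"
  shows "[card X = card {x \<in> X. f x = x}] (mod p)"
proof -
  let ?N = "{x \<in> X. f x \<noteq> x}"
  have "finite ?N \<and> p dvd card ?N"
  proof (rule prime_period_orbit_induct[of p ?N f])
    fix x assume x: "x \<in> ?N"
    have "f (f x) \<noteq> f x"
    proof
      assume a: "f (f x) = f x"
      then have "(f ^^ Suc i) x = f x" for i by (induction i) auto
      then have "(f ^^ p) x = f x" by (metis Suc_pred' p prime_gt_0_nat)
      then show False using x f by auto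
    qed
    then show "f x \<in> ?N \<and> (f ^^ p) x = x" using x f by auto
  next
    fix x Y assume "finite Y \<and> p dvd card Y" "inj_on (\<lambda>i. (f ^^ i) x) {..<p}"
      "(\<lambda>i. (f ^^ i) x) ` {..<p} \<inter> Y = {}"
    then show "finite ((\<lambda>i. (f ^^ i) x) ` {..<p} \<union> Y)
        \<and> p dvd card ((\<lambda>i. (f ^^ i) x) ` {..<p} \<union> Y)"
      by (simp add: card_Un_disjoint card_image)
  qed (use p fin in auto)
  moreover have "card X = card ?N + card {x \<in> X. f x = x}"
    using fin by (subst card_Un_disjoint[symmetric]) (auto intro!: arg_cong[of _ _ card])
  ultimately show ?thesis by (auto simp: cong_def elim!: dvdE)
qed

section \<open>Finite groups: conjugation, normalizers and subgroups of prime index\<close>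

locale finite_group = group +
  assumes fin: "finite (carrier G)"
begin

lemma cancel1: "x \<in> carrier G \<Longrightarrow> y \<in> carrier G \<Longrightarrow> x \<otimes> (inv x \<otimes> y) = y"
  by (simp add: m_assoc[symmetric])

lemma cancel2: "x \<in> carrier G \<Longrightarrow> y \<in> carrier G \<Longrightarrow> inv x \<otimes> (x \<otimes> y) = y"
  by (simp add: m_assoc[symmetric])

text \<open>As simplification rules these bring products of elements and inverses into
  right-associated form and cancel neighbours, which decides most of the conjugation identities
  below.\<close>

lemmas word = m_assoc inv_mult_group cancel1 cancel2

definition cnj where "cnj g a = g \<otimes> a \<otimes> inv g"

lemma cnj_closed [simp]: "g \<in> carrier G \<Longrightarrow> a \<in> carrier G \<Longrightarrow> cnj g a \<in> carrier G"
  by (simp add: cnj_def)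

lemma cnj_mult: "\<lbrakk>g \<in> carrier G; a \<in> carrier G; b \<in> carrier G\<rbrakk> \<Longrightarrow> cnj g (a \<otimes> b) = cnj g a \<otimes> cnj g b"
  by (simp add: cnj_def word)

lemma cnj_cnj: "\<lbrakk>g \<in> carrier G; h \<in> carrier G; a \<in> carrier G\<rbrakk> \<Longrightarrow> cnj g (cnj h a) = cnj (g \<otimes> h) a"
  by (simp add: cnj_def word)

lemma cnj_inv: "\<lbrakk>g \<in> carrier G; a \<in> carrier G\<rbrakk> \<Longrightarrow> cnj g (inv a) = inv (cnj g a)"
  by (simp add: cnj_def word)

lemma cnj_one [simp]: "g \<in> carrier G \<Longrightarrow> cnj g \<one> = \<one>"
  by (simp add: cnj_def)

lemma cnj_by_one [simp]: "a \<in> carrier G \<Longrightarrow> cnj \<one> a = a"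
  by (simp add: cnj_def)

lemma cnj_inv_cancel [simp]: "\<lbrakk>g \<in> carrier G; a \<in> carrier G\<rbrakk> \<Longrightarrow> cnj (inv g) (cnj g a) = a"
  by (simp add: cnj_cnj)

lemma cnj_inv_cancel' [simp]: "\<lbrakk>g \<in> carrier G; a \<in> carrier G\<rbrakk> \<Longrightarrow> cnj g (cnj (inv g) a) = a"
  by (simp add: cnj_cnj)

lemma cnj_pow: "\<lbrakk>g \<in> carrier G; a \<in> carrier G\<rbrakk> \<Longrightarrow> cnj g (a [^] (n::nat)) = cnj g a [^] n"
  by (induction n) (simp_all add: cnj_mult)

lemma cnj_eq_iff: "\<lbrakk>g \<in> carrier G; a \<in> carrier G\<rbrakk> \<Longrightarrow> cnj g a = a \<longleftrightarrow> g \<otimes> a = a \<otimes> g"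
  unfolding cnj_def by (metis inv_solve_right' m_closed)

lemma cnj_inj: "g \<in> carrier G \<Longrightarrow> A \<subseteq> carrier G \<Longrightarrow> inj_on (cnj g) A"
  by (rule inj_on_inverseI[of _ "cnj (inv g)"]) auto

lemma card_cnj [simp]: "g \<in> carrier G \<Longrightarrow> A \<subseteq> carrier G \<Longrightarrow> card (cnj g ` A) = card A"
  by (simp add: card_image cnj_inj)

lemma cnj_image_cnj: "\<lbrakk>g \<in> carrier G; h \<in> carrier G; A \<subseteq> carrier G\<rbrakk> \<Longrightarrow> cnj g ` cnj h ` A = cnj (g \<otimes> h) ` A"
  by (auto simp: image_image cnj_cnj subset_iff intro!: image_cong)

lemma cnj_image_one: "A \<subseteq> carrier G \<Longrightarrow> cnj \<one> ` A = A"
  by (auto simp: subset_iff image_iff)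

lemma cnj_subset: "g \<in> carrier G \<Longrightarrow> A \<subseteq> carrier G \<Longrightarrow> cnj g ` A \<subseteq> carrier G"
  by (auto simp: subset_iff)

lemma mem_cnj_image: "\<lbrakk>g \<in> carrier G; A \<subseteq> carrier G; a \<in> carrier G\<rbrakk> \<Longrightarrow> a \<in> cnj g ` A \<longleftrightarrow> cnj (inv g) a \<in> A"
  by (auto simp: image_iff subset_iff) (metis cnj_inv_cancel')

lemma cnj_Int: "\<lbrakk>g \<in> carrier G; A \<subseteq> carrier G; B \<subseteq> carrier G\<rbrakk> \<Longrightarrow> cnj g ` (A \<inter> B) = cnj g ` A \<inter> cnj g ` B"
  by (meson cnj_inj inj_on_image_Int subset_refl)

lemma subgroup_cnj [intro]: "g \<in> carrier G \<Longrightarrow> subgroup A G \<Longrightarrow> subgroup (cnj g ` A) G"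
  by (rule subgroupI)
    (auto simp: subgroup.mem_carrier cnj_inv[symmetric] cnj_mult[symmetric]
      subgroup.m_closed subgroup.m_inv_closed dest: subgroup.one_closed)

lemma subgroup_fin: "subgroup A G \<Longrightarrow> finite A"
  using fin finite_subset subgroup.subset by blast

lemma subgroup_card_pos: "subgroup A G \<Longrightarrow> card A > 0"
  using subgroup_fin subgroup.one_closed card_gt_0_iff by fastforce

lemma card_subgroup_dvd:
  assumes "subgroup A G" "subgroup B G" "A \<subseteq> B" shows "card A dvd card B"
proof -
  interpret B: group "G\<lparr>carrier := B\<rparr>" by (rule subgroup_imp_group[OF assms(2)])
  have "subgroup A (G\<lparr>carrier := B\<rparr>)" using assms subgroup_incl by blast
  from B.lagrange[OF this, symmetric] show ?thesis by (simp add: order_def)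
qed

lemma card_subgroup_dvd_order: "subgroup A G \<Longrightarrow> card A dvd card (carrier G)"
  using card_subgroup_dvd subgroup_self subgroup.subset by blast

lemma subgroup_eq_if_card:
  assumes "subgroup A G" "subgroup B G" "A \<subseteq> B" "card B \<le> card A" shows "A = B"
  using assms by (simp add: card_seteq subgroup_fin)

lemma card_set_mult_trivial_Int:
  assumes "subgroup A G" "subgroup B G" "A \<inter> B = {\<one>}"
  shows "card (A <#> B) = card A * card B"
proof -
  have AB: "A \<subseteq> carrier G" "B \<subseteq> carrier G" using assms subgroup.subset by auto
  have "inj_on (\<lambda>(a, b). a \<otimes> b) (A \<times> B)"
  proof (rule inj_onI, clarsimp)
    fix a b a' b' assume *: "a \<in> A" "b \<in> B" "a' \<in> A" "b' \<in> B" "a \<otimes> b = a' \<otimes> b'"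
    have cs: "a \<in> carrier G" "b \<in> carrier G" "a' \<in> carrier G" "b' \<in> carrier G" using * AB by auto
    have e: "inv a' \<otimes> a = b' \<otimes> inv b"
    proof -
      have "inv a' \<otimes> (a \<otimes> b) \<otimes> inv b = inv a' \<otimes> (a' \<otimes> b') \<otimes> inv b" using * by simp
      then show ?thesis using cs by (simp add: word)
    qed
    have "inv a' \<otimes> a \<in> A \<inter> B"
      using * assms by (metis Int_iff e subgroup.m_closed subgroup.m_inv_closed)
    then have "inv a' \<otimes> a = \<one>" using assms by blast
    then show "a = a' \<and> b = b'" using e cs
      by (metis inv_closed inv_equality inv_inv r_cancel_one' inv_solve_right' l_one)
  qed
  then have "card ((\<lambda>(a, b). a \<otimes> b) ` (A \<times> B)) = card (A \<times> B)" by (rule card_image)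
  moreover have "(\<lambda>(a, b). a \<otimes> b) ` (A \<times> B) = A <#> B"
    by (auto simp: set_mult_def)
  ultimately show ?thesis by (simp add: card_cartesian_product)
qed

lemma set_mult_subset_subgroup:
  assumes "subgroup H G" "A \<subseteq> H" "B \<subseteq> H" shows "A <#> B \<subseteq> H"
  using assms by (auto simp: set_mult_def subset_iff subgroup.m_closed)

lemma card_prod_le_subgroup:
  assumes "subgroup A G" "subgroup B G" "A \<inter> B = {\<one>}" "subgroup H G" "A \<subseteq> H" "B \<subseteq> H"
  shows "card A * card B \<le> card H"
  using card_mono[OF subgroup_fin[OF assms(4)] set_mult_subset_subgroup[OF assms(4-6)]]
    card_set_mult_trivial_Int[OF assms(1-3)] by simp

text \<open>By trivial intersection the product set of \<open>A\<close> and the conjugate of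
  \<open>B\<close> has full size, yet it misses \<open>inv g\<close>: if
  \<open>inv g = a \<otimes> cnj g b\<close>, then \<open>g = inv a \<otimes> inv b\<close> would
  lie in \<open>B\<close>. The strict inequality is what later bounds \<open>card C\<close> by the
  index.\<close>

lemma card_prod_less_cnj:
  assumes A: "subgroup A G" and B: "subgroup B G" and H: "subgroup H G"
    and sub: "A \<subseteq> B" "B \<subseteq> H" and g: "g \<in> H" "g \<notin> B" and triv: "A \<inter> cnj g ` B = {\<one>}"
  shows "card A * card B < card H"
proof -
  have gG: "g \<in> carrier G" using subgroup.mem_carrier[OF H g(1)] .
  have BG: "B \<subseteq> carrier G" using B subgroup.subset by blast
  have gB: "subgroup (cnj g ` B) G" by (rule subgroup_cnj[OF gG B])
  have gBH: "cnj g ` B \<subseteq> H"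
    using g sub by (auto simp: cnj_def intro!: subgroup.m_closed[OF H] subgroup.m_inv_closed[OF H])
  have "inv g \<notin> A <#> cnj g ` B"
  proof
    assume "inv g \<in> A <#> cnj g ` B"
    then obtain a b where ab: "a \<in> A" "b \<in> B" "inv g = a \<otimes> cnj g b" by (auto simp: set_mult_def)
    have cs: "a \<in> carrier G" "b \<in> carrier G" using ab BG sub by auto
    have "a \<otimes> g \<otimes> b = \<one>"
      using arg_cong[OF ab(3), of "\<lambda>z. z \<otimes> g"] cs gG by (simp add: cnj_def word)
    moreover have "g = inv a \<otimes> (a \<otimes> g \<otimes> b) \<otimes> inv b" using cs gG by (simp add: word)
    ultimately have "g = inv a \<otimes> inv b" using cs by simp
    then have "g \<in> B"
      using ab sub by (auto intro!: subgroup.m_closed[OF B] subgroup.m_inv_closed[OF B])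
    then show False using g by blast
  qed
  moreover have "inv g \<in> H" using subgroup.m_inv_closed[OF H g(1)] .
  moreover have "A <#> cnj g ` B \<subseteq> H" using set_mult_subset_subgroup[OF H] sub gBH by auto
  ultimately have "card (A <#> cnj g ` B) < card H"
    using psubset_card_mono[OF subgroup_fin[OF H]] by blast
  then show ?thesis using card_set_mult_trivial_Int[OF A gB triv] gG BG by simp
qed

lemma prime_index_between:
  assumes "subgroup C G" "subgroup M G" "subgroup H G" "C \<subseteq> M" "M \<subseteq> H"
    "card H = p * card C" "prime p"
  shows "M = C \<or> M = H"
proof -
  obtain i where i: "card M = card C * i" using card_subgroup_dvd[OF assms(1,2,4)] by blast
  obtain j where j: "card H = card M * j" using card_subgroup_dvd[OF assms(2,3,5)] by blast
  have "p = i * j" using i j assms(6) subgroup_card_pos[OF assms(1)] by simp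
  then have "i = 1 \<or> j = 1" using assms(7) prime_product by blast
  then show ?thesis
    using i j subgroup_eq_if_card[OF assms(1,2,4)] subgroup_eq_if_card[OF assms(2,3,5)] by auto
qed

text \<open>Inclusion is enough for a normalizer because the group is finite
  (\<open>Nrm_image\<close>). The argument may be any set; the definition is also used for a
  coset.\<close>

definition Nrm where "Nrm A = {g \<in> carrier G. cnj g ` A \<subseteq> A}"

lemma NrmI: "\<lbrakk>g \<in> carrier G; \<And>a. a \<in> A \<Longrightarrow> cnj g a \<in> A\<rbrakk> \<Longrightarrow> g \<in> Nrm A"
  by (auto simp: Nrm_def)

lemma NrmD: "g \<in> Nrm A \<Longrightarrow> a \<in> A \<Longrightarrow> cnj g a \<in> A"
  by (auto simp: Nrm_def)

lemma Nrm_image: "g \<in> Nrm A \<Longrightarrow> A \<subseteq> carrier G \<Longrightarrow> cnj g ` A = A"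
  by (intro card_subset_eq) (auto simp: Nrm_def intro: finite_subset[OF _ fin])

lemma Nrm_subgroup:
  assumes "A \<subseteq> carrier G" shows "subgroup (Nrm A) G"
proof (rule subgroupI)
  show "Nrm A \<noteq> {}" using assms by (auto simp: Nrm_def subset_iff intro!: exI[of _ \<one>])
  fix g h assume g: "g \<in> Nrm A"
  then have gG: "g \<in> carrier G" by (simp add: Nrm_def)
  have "cnj (inv g) ` A = cnj (inv g) ` cnj g ` A" using Nrm_image[OF g assms] by simp
  also have "\<dots> = A" using gG assms by (simp add: cnj_image_cnj cnj_image_one)
  finally show "inv g \<in> Nrm A" using gG by (simp add: Nrm_def)
  assume h: "h \<in> Nrm A"
  then show "g \<otimes> h \<in> Nrm A" using g assms Nrm_image[OF g] Nrm_image[OF h]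
    by (simp add: Nrm_def cnj_image_cnj[symmetric])
qed (auto simp: Nrm_def)

lemma normal_iff_Nrm: "subgroup A G \<Longrightarrow> A \<lhd> G \<longleftrightarrow> carrier G \<subseteq> Nrm A"
  unfolding normal_inv_iff by (auto simp: Nrm_def cnj_def)

lemma normal_cnj: "A \<lhd> G \<Longrightarrow> g \<in> carrier G \<Longrightarrow> a \<in> A \<Longrightarrow> cnj g a \<in> A"
  unfolding normal_inv_iff by (auto simp: cnj_def)

lemma subgroup_subset_Nrm: "subgroup A G \<Longrightarrow> A \<subseteq> Nrm A"
  by (auto simp: Nrm_def cnj_def subgroup.mem_carrier subgroup.m_closed subgroup.m_inv_closed)

lemma Nrm_Int: "Nrm A \<inter> Nrm B \<subseteq> Nrm (A \<inter> B)"
  by (auto simp: Nrm_def)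

lemma Nrm_cnj:
  assumes "g \<in> carrier G" "A \<subseteq> carrier G" shows "Nrm (cnj g ` A) = cnj g ` Nrm A"
proof -
  have *: "cnj g ` Nrm A \<subseteq> Nrm (cnj g ` A)" if "g \<in> carrier G" "A \<subseteq> carrier G" for g A
  proof (clarsimp simp: Nrm_def that)
    fix h a assume h: "h \<in> carrier G" "cnj h ` A \<subseteq> A" and a: "a \<in> A"
    have "cnj (cnj g h) (cnj g a) = cnj g (cnj h a)"
      using that h a by (auto simp: cnj_def word subset_iff)
    then show "cnj (cnj g h) (cnj g a) \<in> cnj g ` A" using h a by auto
  qed
  have N: "Nrm B \<subseteq> carrier G" for B by (auto simp: Nrm_def)
  have "Nrm (cnj g ` A) = cnj g ` cnj (inv g) ` Nrm (cnj g ` A)"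
    using assms by (simp add: cnj_image_cnj cnj_image_one N)
  also have "\<dots> \<subseteq> cnj g ` Nrm (cnj (inv g) ` cnj g ` A)"
    using *[of "inv g" "cnj g ` A"] assms cnj_subset by blast
  also have "\<dots> = cnj g ` Nrm A" using assms by (simp add: cnj_image_cnj cnj_image_one)
  finally show ?thesis using *[OF assms] by blast
qed

text \<open>The normalizer of \<open>K\<close> meets \<open>H\<close> in a subgroup that contains
  \<open>C\<close> and also an element outside \<open>C\<close>, and a subgroup of prime index is
  maximal.\<close>

lemma Nrm_prime_index:
  assumes C: "subgroup C G" and H: "subgroup H G" and p: "card H = p * card C" "prime p"
    and "C \<subseteq> H" "K \<subseteq> carrier G" "C \<subseteq> Nrm K" "B \<subseteq> Nrm K" "B \<subseteq> H" "\<not> B \<subseteq> C"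
  shows "H \<subseteq> Nrm K"
proof -
  have "subgroup (Nrm K \<inter> H) G" using Nrm_subgroup[OF assms(6)] H subgroups_Inter_pair by blast
  then have "Nrm K \<inter> H = C \<or> Nrm K \<inter> H = H"
    using prime_index_between[OF C _ H _ _ p] assms by blast
  then show ?thesis using assms by blast
qed

lemma pow_in_subgroup: "subgroup A G \<Longrightarrow> a \<in> A \<Longrightarrow> a [^] (n::nat) \<in> A"
  by (induction n) (auto simp: subgroup.one_closed subgroup.m_closed)

lemma ord_dvd_card_subgroup:
  assumes "subgroup A G" "a \<in> A" shows "ord a dvd card A"
  using card_subgroup_dvd[OF generate_is_subgroup assms(1), of "{a}"] assms
    generate_subgroup_incl[of "{a}" A] generate_pow_card[of a] by (simp add: subgroup.mem_carrier)

lemma pow_card_subgroup: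
  assumes "subgroup A G" "a \<in> A" shows "a [^] card A = \<one>"
  using ord_dvd_card_subgroup[OF assms] pow_eq_id[OF subgroup.mem_carrier[OF assms]] by simp

lemma generate_eq_powers:
  assumes "a \<in> carrier G" shows "generate G {a} = {a [^] i | i::nat. True}"
  using generate_pow_nat[OF assms] ord_ge_1[OF fin assms] by auto

lemma ord_pos: "a \<in> carrier G \<Longrightarrow> ord a > 0"
  using ord_ge_1[OF fin] by fastforce

lemma prime_subgroup_generated:
  assumes "subgroup Q G" "prime (card Q)" "z \<in> Q" "z \<noteq> \<one>"
  shows "Q = generate G {z}" "ord z = card Q"
proof -
  have zG: "z \<in> carrier G" using subgroup.mem_carrier[OF assms(1,3)] .
  have "ord z dvd card Q" using ord_dvd_card_subgroup assms by blast
  moreover have "ord z \<noteq> 1" using assms zG ord_eq_1 by blast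
  ultimately show o: "ord z = card Q" using assms(2) prime_nat_iff by blast
  have "generate G {z} \<subseteq> Q" using assms generate_subgroup_incl by simp
  moreover have "card (generate G {z}) = card Q" using o generate_pow_card[OF zG] by simp
  ultimately show "Q = generate G {z}" using card_subset_eq[OF subgroup_fin[OF assms(1)]] by auto
qed

lemma prime_subgroups_Int:
  assumes "subgroup Q G" "subgroup R G" "prime (card Q)" "card R = card Q" "Q \<noteq> R"
  shows "Q \<inter> R = {\<one>}"
proof -
  have "z = \<one>" if "z \<in> Q" "z \<in> R" for z
    using prime_subgroup_generated(1)[of Q z] prime_subgroup_generated(1)[of R z] assms that by metis
  then show ?thesis using assms subgroup.one_closed by blast
qed

lemma cauchy_subgroup:
  assumes H: "subgroup H G" and p: "prime p" "p dvd card H"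
  obtains Q where "subgroup Q G" "Q \<subseteq> H" "card Q = p"
proof -
  interpret H: group "G\<lparr>carrier := H\<rparr>" by (rule subgroup_imp_group[OF H])
  obtain m where "card H = p * m" using p by blast
  then obtain Q where Q: "subgroup Q (G\<lparr>carrier := H\<rparr>)" "card Q = p"
    using sylow_thm[of p "G\<lparr>carrier := H\<rparr>" 1 m] p H.is_group subgroup_fin[OF H]
    by (auto simp: order_def)
  then show ?thesis using that incl_subgroup[OF H] subgroup.subset by fastforce
qed

end

subsection \<open>Commutators and the transfer\<close>

definition comtr :: "('a, 'b) monoid_scheme \<Rightarrow> 'a \<Rightarrow> 'a \<Rightarrow> 'a" where
  "comtr G x y = x \<otimes>\<^bsub>G\<^esub> y \<otimes>\<^bsub>G\<^esub> inv\<^bsub>G\<^esub> x \<otimes>\<^bsub>G\<^esub> inv\<^bsub>G\<^esub> y"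

lemma (in group) comtr_closed [simp]: "x \<in> carrier G \<Longrightarrow> y \<in> carrier G \<Longrightarrow> comtr G x y \<in> carrier G"
  by (simp add: comtr_def)

lemma (in group_hom) hom_comtr:
  "x \<in> carrier G \<Longrightarrow> y \<in> carrier G \<Longrightarrow> h (comtr G x y) = comtr H (h x) (h y)"
  by (simp add: comtr_def)

lemma (in comm_group) comtr_eq_one: "x \<in> carrier G \<Longrightarrow> y \<in> carrier G \<Longrightarrow> comtr G x y = \<one>"
  unfolding comtr_def
  by (metis inv_closed m_closed m_comm r_inv inv_mult m_assoc)

locale transversal = finite_group +
  fixes P
  assumes P: "subgroup P G"
begin

text \<open>The choice depends on \<open>h\<close> only through its left coset as a set, so all
  elements of a coset share one representative and \<open>T\<close> is a left transversal.\<close>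

definition "rep h = (SOME r. r \<in> (\<lambda>p. h \<otimes> p) ` P)"

definition "T = rep ` carrier G"

lemmas PsubG = subgroup.mem_carrier[OF P]

lemma rep_ex:
  assumes "h \<in> carrier G" shows "\<exists>p\<in>P. rep h = h \<otimes> p"
proof -
  have "h \<otimes> \<one> \<in> (\<lambda>p. h \<otimes> p) ` P" using subgroup.one_closed[OF P] by blast
  then have "rep h \<in> (\<lambda>p. h \<otimes> p) ` P" unfolding rep_def by (rule someI)
  then show ?thesis by blast
qed

lemma rep_closed [simp]: "h \<in> carrier G \<Longrightarrow> rep h \<in> carrier G"
  using rep_ex PsubG by force

lemma rep_mult: "h \<in> carrier G \<Longrightarrow> p \<in> P \<Longrightarrow> rep (h \<otimes> p) = rep h"
proof -
  assume h: "h \<in> carrier G" "p \<in> P"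
  have "(\<lambda>q. h \<otimes> p \<otimes> q) ` P = (\<lambda>p. h \<otimes> p) ` P"
  proof (intro equalityI subsetI; clarify)
    fix q assume q: "q \<in> P"
    show "h \<otimes> p \<otimes> q \<in> (\<lambda>p. h \<otimes> p) ` P"
      using h q PsubG subgroup.m_closed[OF P, of p q] by (auto simp: m_assoc)
    have "h \<otimes> q = h \<otimes> p \<otimes> (inv p \<otimes> q)" using h q PsubG by (simp add: word)
    then show "h \<otimes> q \<in> (\<lambda>q. h \<otimes> p \<otimes> q) ` P"
      using h q subgroup.m_closed[OF P] subgroup.m_inv_closed[OF P] by blast
  qed
  then show ?thesis by (simp add: rep_def)
qed

lemma rep_rep_mult: "g \<in> carrier G \<Longrightarrow> h \<in> carrier G \<Longrightarrow> rep (g \<otimes> rep h) = rep (g \<otimes> h)"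
  using rep_ex[of h] rep_mult[of "g \<otimes> h"] PsubG by (auto simp: m_assoc)

lemma rep_rep: "h \<in> carrier G \<Longrightarrow> rep (rep h) = rep h"
  using rep_ex[of h] rep_mult[of h] by auto

lemma rep_T: "t \<in> T \<Longrightarrow> rep t = t"
  by (auto simp: T_def rep_rep)

lemma T_carrier: "t \<in> T \<Longrightarrow> t \<in> carrier G"
  by (auto simp: T_def)

lemma rep_in_T: "h \<in> carrier G \<Longrightarrow> rep h \<in> T"
  by (simp add: T_def)

lemma fin_T: "finite T"
  using fin by (simp add: T_def)

lemma inv_rep_mult: "h \<in> carrier G \<Longrightarrow> inv (rep h) \<otimes> h \<in> P"
proof -
  assume h: "h \<in> carrier G"
  then obtain p where p: "p \<in> P" "rep h = h \<otimes> p" using rep_ex by blast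
  then have "inv (rep h) \<otimes> h = inv p" using h PsubG by (simp add: word)
  then show ?thesis using p subgroup.m_inv_closed[OF P] by simp
qed

lemma rep_eq_iff:
  assumes "g \<in> carrier G" "t \<in> T"
  shows "rep g = t \<longleftrightarrow> inv t \<otimes> g \<in> P"
proof
  assume "rep g = t" then show "inv t \<otimes> g \<in> P" using assms inv_rep_mult by blast
next
  assume "inv t \<otimes> g \<in> P"
  then have "rep (t \<otimes> (inv t \<otimes> g)) = rep t" using rep_mult T_carrier assms by blast
  then show "rep g = t" using assms T_carrier rep_T by (simp add: cancel1)
qed

lemma bij_T: "h \<in> carrier G \<Longrightarrow> bij_betw (\<lambda>t. rep (h \<otimes> t)) T T"
proof (rule bij_betwI[where g = "\<lambda>t. rep (inv h \<otimes> t)"])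
  assume h: "h \<in> carrier G"
  show "(\<lambda>t. rep (h \<otimes> t)) \<in> T \<rightarrow> T" "(\<lambda>t. rep (inv h \<otimes> t)) \<in> T \<rightarrow> T"
    using h by (auto simp: T_carrier rep_in_T)
  show "rep (inv h \<otimes> rep (h \<otimes> t)) = t" "rep (h \<otimes> rep (inv h \<otimes> t)) = t" if "t \<in> T" for t
    using h that by (auto simp: T_carrier rep_rep_mult rep_T cancel1 cancel2)
qed

lemma card_T: "card T * card P = card (carrier G)"
proof -
  have "bij_betw (\<lambda>(t, p). t \<otimes> p) (T \<times> P) (carrier G)"
  proof (rule bij_betwI[where g = "\<lambda>g. (rep g, inv (rep g) \<otimes> g)"])
    show "(\<lambda>g. (rep g, inv (rep g) \<otimes> g)) \<in> carrier G \<rightarrow> T \<times> P" by (auto simp: rep_in_T inv_rep_mult)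
  qed (auto simp: T_carrier PsubG rep_mult rep_T cancel1 cancel2)
  from bij_betw_same_card[OF this] show ?thesis by (simp add: card_cartesian_product)
qed

lemma iterate_rep:
  assumes c: "c \<in> carrier G" and "t \<in> T"
  shows "((\<lambda>t. rep (c \<otimes> t)) ^^ i) t = rep (c [^] i \<otimes> t)"
proof (induction i)
  case 0 then show ?case using assms by (simp add: T_carrier rep_T)
next
  case (Suc i)
  then show ?case using assms
    by (simp add: T_carrier rep_rep_mult m_assoc[symmetric] nat_pow_Suc2[symmetric] del: nat_pow_Suc)
qed

text \<open>Left multiplication by \<open>c\<close> permutes the left cosets of \<open>P\<close>
  with period \<open>p\<close>. Their number is prime to \<open>p\<close>, so some coset of a
  \<open>t\<close> is fixed, which means that \<open>c\<close> lies in the conjugate of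
  \<open>P\<close> by \<open>t\<close>.\<close>

lemma conj_into_subgroup:
  assumes c: "c \<in> carrier G" and p: "prime (p::nat)" "c [^] p = \<one>" "\<not> p dvd card T"
  obtains t where "t \<in> carrier G" "inv t \<otimes> c \<otimes> t \<in> P"
proof -
  let ?f = "\<lambda>t. rep (c \<otimes> t)"
  have it: "(?f ^^ i) t = rep (c [^] i \<otimes> t)" if "t \<in> T" for i t
    by (rule iterate_rep[OF c that])
  have "[card T = card {t \<in> T. ?f t = t}] (mod p)"
    by (rule card_fixed_cong[OF p(1) fin_T]) (auto simp: it T_carrier c p rep_T rep_in_T)
  then have "card {t \<in> T. ?f t = t} \<noteq> 0" using p by (metis cong_0_iff)
  then have "{t \<in> T. ?f t = t} \<noteq> {}" by (metis card.empty)
  then obtain t where t: "t \<in> T" "?f t = t" by blast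
  then have "inv t \<otimes> c \<otimes> t \<in> P"
    using rep_eq_iff[of "c \<otimes> t" t] c T_carrier[OF t(1)] by (simp add: m_assoc)
  then show ?thesis using that T_carrier[OF t(1)] by blast
qed

end

locale transfer = transversal +
  assumes P_comm: "\<And>a b. a \<in> P \<Longrightarrow> b \<in> P \<Longrightarrow> a \<otimes> b = b \<otimes> a"
begin

abbreviation "PG \<equiv> G\<lparr>carrier := P\<rparr>"

lemma PG_comm: "comm_group PG"
proof -
  interpret PG: group PG by (rule subgroup_imp_group[OF P])
  show "comm_group PG" using P_comm by unfold_locales auto
qed

text \<open>The cocycle of the action on the transversal: \<open>g \<otimes> t\<close> is its
  representative times \<open>phi g t\<close>. The product \<open>V\<close> of these factors is the
  transfer from \<open>G\<close> to \<open>P\<close>.\<close>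

definition "phi g t = inv (rep (g \<otimes> t)) \<otimes> (g \<otimes> t)"

definition "V g = finprod PG (phi g) T"

lemma phi_closed: "g \<in> carrier G \<Longrightarrow> t \<in> carrier G \<Longrightarrow> phi g t \<in> P"
  unfolding phi_def by (intro inv_rep_mult) simp

lemma phi_mult:
  assumes "g \<in> carrier G" "h \<in> carrier G" "t \<in> carrier G"
  shows "phi (g \<otimes> h) t = phi g (rep (h \<otimes> t)) \<otimes> phi h t"
  using assms by (simp add: phi_def rep_rep_mult word)

lemma V_closed: "g \<in> carrier G \<Longrightarrow> V g \<in> P"
  unfolding V_def
  using comm_monoid.finprod_closed[of PG "phi g" T] PG_comm phi_closed T_carrier
  by (auto simp: comm_group_def)

text \<open>Reindexing by the permutation that \<open>h\<close> induces on \<open>T\<close> turns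
  the first factor of the cocycle identity \<open>phi_mult\<close> back into
  \<open>V g\<close>.\<close>

lemma V_mult:
  assumes g: "g \<in> carrier G" and h: "h \<in> carrier G"
  shows "V (g \<otimes> h) = V g \<otimes> V h"
proof -
  interpret PG: comm_group PG by (rule PG_comm)
  have "V (g \<otimes> h) = finprod PG (\<lambda>t. phi g (rep (h \<otimes> t)) \<otimes> phi h t) T"
    unfolding V_def
    by (rule PG.finprod_cong') (auto simp: phi_mult g h T_carrier phi_closed intro!: subgroup.m_closed[OF P])
  also have "\<dots> = finprod PG (\<lambda>t. phi g (rep (h \<otimes> t))) T \<otimes> V h"
    unfolding V_def by (rule PG.finprod_multf[simplified]) (auto simp: g h T_carrier phi_closed)
  also have "finprod PG (\<lambda>t. phi g (rep (h \<otimes> t))) T = V g"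
  proof -
    have "V g = finprod PG (phi g) ((\<lambda>t. rep (h \<otimes> t)) ` T)"
      using bij_T[OF h] by (simp add: V_def bij_betw_def)
    also have "\<dots> = finprod PG (\<lambda>t. phi g (rep (h \<otimes> t))) T"
      by (rule PG.finprod_reindex) (use bij_T[OF h] g in \<open>auto simp: bij_betw_def phi_closed T_carrier\<close>)
    finally show ?thesis by simp
  qed
  finally show ?thesis .
qed

lemma V_hom: "group_hom G PG V"
proof -
  interpret PG: comm_group PG by (rule PG_comm)
  have "V \<in> hom G PG" using V_closed V_mult by (auto simp: hom_def)
  then show ?thesis by (intro group_hom.intro group_hom_axioms.intro is_group PG.is_group)
qed

lemma V_comtr: "x \<in> carrier G \<Longrightarrow> y \<in> carrier G \<Longrightarrow> V (comtr G x y) = \<one>"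
proof -
  interpret PG: comm_group PG by (rule PG_comm)
  interpret h: group_hom G PG V by (rule V_hom)
  show "x \<in> carrier G \<Longrightarrow> y \<in> carrier G \<Longrightarrow> V (comtr G x y) = \<one>"
    using h.hom_comtr PG.comtr_eq_one V_closed by simp
qed

lemma V_pow: "x \<in> carrier G \<Longrightarrow> V (x [^] (n::nat)) = V x [^] n"
proof -
  interpret h: group_hom G PG V by (rule V_hom)
  show "x \<in> carrier G \<Longrightarrow> V (x [^] n) = V x [^] n"
    by (induction n) (simp_all add: V_mult)
qed

text \<open>A central element of \<open>P\<close> fixes every left coset and contributes itself as
  the factor at each of them.\<close>

lemma V_central:
  assumes "c \<in> P" and "\<And>g. g \<in> carrier G \<Longrightarrow> g \<otimes> c = c \<otimes> g"
  shows "V c = c [^] card T"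
proof -
  interpret PG: comm_group PG by (rule PG_comm)
  have "phi c t = c" if t: "t \<in> T" for t
  proof -
    have "rep (c \<otimes> t) = t"
      using rep_mult[OF T_carrier[OF t] assms(1)] assms(2)[OF T_carrier[OF t]] rep_T[OF t] by simp
    then show ?thesis using assms(2)[OF T_carrier[OF t], symmetric] T_carrier[OF t] PsubG[OF assms(1)]
      by (simp add: phi_def cancel2)
  qed
  then have "V c = finprod PG (\<lambda>_. c) T" unfolding V_def using assms by (intro PG.finprod_cong') auto
  also have "\<dots> = c [^]\<^bsub>PG\<^esub> card T" using assms by (intro PG.finprod_const) auto
  also have "\<dots> = c [^] card T" by (rule nat_pow_consistent[symmetric])
  finally show ?thesis .
qed

text \<open>The transversal need not be adapted to \<open>c\<close>: along an orbit of length \<open>p\<close> of \<open>c\<close> on the cosets,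
  the factors telescope to a conjugate of \<open>c\<^sup>p\<close>.\<close>

lemma V_eval:
  assumes c: "c \<in> carrier G" and p: "prime (p::nat)" "c [^] p = \<one>"
  shows "V c = finprod PG (\<lambda>t. inv t \<otimes> c \<otimes> t) {t \<in> T. inv t \<otimes> c \<otimes> t \<in> P}"
proof -
  interpret PG: comm_group PG by (rule PG_comm)
  let ?F = "{t \<in> T. inv t \<otimes> c \<otimes> t \<in> P}"
  let ?N = "T - ?F"
  let ?f = "\<lambda>t. rep (c \<otimes> t)"
  have ph: "phi c \<in> A \<rightarrow> P" if "A \<subseteq> T" for A using that by (auto simp: phi_closed c T_carrier)
  have fT: "?f t = t \<longleftrightarrow> t \<in> ?F" if "t \<in> T" for t
    using rep_eq_iff[of "c \<otimes> t" t] that c T_carrier by (auto simp: m_assoc)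
  have it: "(?f ^^ i) t = rep (c [^] i \<otimes> t)" if "t \<in> T" for i t
    by (rule iterate_rep[OF c that])
  have fN: "?f t \<in> ?N \<and> (?f ^^ p) t = t" if "t \<in> ?N" for t
  proof -
    have tT: "t \<in> T" using that by blast
    have per: "(?f ^^ p) t = t" using it[OF tT] tT p by (simp add: T_carrier rep_T)
    have ft: "?f t \<in> T" using tT c by (simp add: T_carrier rep_in_T)
    have "?f (?f t) \<noteq> ?f t"
      using bij_T[OF c] ft tT fT[OF tT] that by (auto simp: bij_betw_def inj_on_def)
    then have "?f t \<in> ?N" using fT[OF ft] ft by blast
    then show ?thesis using per by blast
  qed
  have "?N \<subseteq> T \<and> finprod PG (phi c) ?N = \<one>"
  proof (rule prime_period_orbit_induct[OF p(1), of ?N ?f])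
    show "finite ?N" using fin_T by blast
    show "?f t \<in> ?N \<and> (?f ^^ p) t = t" if "t \<in> ?N" for t using fN that by blast
    show "?f t \<noteq> t" if "t \<in> ?N" for t using fT that by blast
    show "{} \<subseteq> T \<and> finprod PG (phi c) {} = \<one>" by simp
    fix x Y
    let ?O = "(\<lambda>i. (?f ^^ i) x) ` {..<p}"
    assume xN: "x \<in> ?N" and YN: "Y \<subseteq> ?N" and O: "?O \<subseteq> ?N" and Y: "Y \<subseteq> T \<and> finprod PG (phi c) Y = \<one>"
      and inj: "inj_on (\<lambda>i. (?f ^^ i) x) {..<p}" and disj: "?O \<inter> Y = {}"
    have xT: "x \<in> T" using xN by blast
    have xG: "x \<in> carrier G" by (rule T_carrier[OF xT])
    have fY: "finite Y" using Y fin_T finite_subset by blast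
    have OT: "?O \<subseteq> T" using O by blast
    have "finprod PG (\<lambda>i. phi c ((?f ^^ i) x)) {..<k} = inv (rep (c [^] k \<otimes> x)) \<otimes> c [^] k \<otimes> x" for k
    proof (induction k)
      case 0 then show ?case using xG rep_T[OF xT] by simp
    next
      case (Suc k)
      have mem: "(?f ^^ i) x \<in> carrier G" for i using it[OF xT] xG c by simp
      have "finprod PG (\<lambda>i. phi c ((?f ^^ i) x)) {..<Suc k}
          = phi c ((?f ^^ k) x) \<otimes> finprod PG (\<lambda>i. phi c ((?f ^^ i) x)) {..<k}"
        unfolding lessThan_Suc by (rule PG.finprod_insert[simplified]) (auto intro!: phi_closed c mem)
      also have "phi c ((?f ^^ k) x) = inv (rep (c [^] Suc k \<otimes> x)) \<otimes> c \<otimes> rep (c [^] k \<otimes> x)"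
        using c xG by (simp add: phi_def it[OF xT] rep_rep_mult m_assoc[symmetric]
            nat_pow_Suc2[symmetric] del: nat_pow_Suc)
      also have "\<dots> \<otimes> finprod PG (\<lambda>i. phi c ((?f ^^ i) x)) {..<k}
          = inv (rep (c [^] Suc k \<otimes> x)) \<otimes> (c \<otimes> c [^] k) \<otimes> x"
        unfolding Suc using c xG by (simp add: word del: nat_pow_Suc)
      also have "c \<otimes> c [^] k = c [^] Suc k" using nat_pow_Suc2[OF c, of k] by simp
      finally show ?case .
    qed
    from this[of p] have "finprod PG (\<lambda>i. phi c ((?f ^^ i) x)) {..<p} = \<one>"
      using p xG rep_T[OF xT] by simp
    moreover have "finprod PG (phi c) ?O = finprod PG (\<lambda>i. phi c ((?f ^^ i) x)) {..<p}"
      by (rule PG.finprod_reindex[OF _ inj]) (use ph[OF OT] in auto)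
    ultimately have "finprod PG (phi c) ?O = \<one>" by simp
    moreover have "finprod PG (phi c) (?O \<union> Y) = finprod PG (phi c) ?O \<otimes> finprod PG (phi c) Y"
      by (rule PG.finprod_Un_disjoint[simplified]) (use fY disj ph[OF OT] ph[of Y] Y in auto)
    ultimately show "?O \<union> Y \<subseteq> T \<and> finprod PG (phi c) (?O \<union> Y) = \<one>" using Y OT by simp
  qed
  then have N1: "finprod PG (phi c) ?N = \<one>" by blast
  have FN: "T = ?F \<union> ?N" by blast
  have "V c = finprod PG (phi c) (?F \<union> ?N)" unfolding V_def using FN by simp
  also have "\<dots> = finprod PG (phi c) ?F \<otimes> finprod PG (phi c) ?N"
    by (rule PG.finprod_Un_disjoint[simplified]) (use fin_T ph[of ?F] ph[of ?N] in auto)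
  also have "\<dots> = finprod PG (phi c) ?F" using N1 PG.finprod_closed[of "phi c" ?F] ph[of ?F] PsubG by simp
  also have "\<dots> = finprod PG (\<lambda>t. inv t \<otimes> c \<otimes> t) ?F"
  proof (rule PG.finprod_cong')
    fix t assume t: "t \<in> ?F"
    then have "rep (c \<otimes> t) = t" using fT by blast
    then show "phi c t = inv t \<otimes> c \<otimes> t" using t c by (simp add: phi_def T_carrier m_assoc)
  qed auto
  finally show ?thesis .
qed

end

section \<open>Central elements of prime order that are powers of commutators\<close>

context finite_group
begin

lemma centralizer_subgroup:
  assumes "A \<subseteq> carrier G" shows "subgroup {g \<in> carrier G. \<forall>a\<in>A. g \<otimes> a = a \<otimes> g} G"
proof (rule subgroupI)
  fix g assume g: "g \<in> {g \<in> carrier G. \<forall>a\<in>A. g \<otimes> a = a \<otimes> g}"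
  have "inv g \<otimes> a = a \<otimes> inv g" if a: "a \<in> A" for a
  proof -
    have aG: "a \<in> carrier G" "g \<in> carrier G" using a assms g by auto
    have "inv g \<otimes> (a \<otimes> g) \<otimes> inv g = inv g \<otimes> (g \<otimes> a) \<otimes> inv g" using g a by simp
    then show ?thesis using aG by (simp add: word)
  qed
  then show "inv g \<in> {g \<in> carrier G. \<forall>a\<in>A. g \<otimes> a = a \<otimes> g}" using g by simp
next
  fix g h assume gh: "g \<in> {g \<in> carrier G. \<forall>a\<in>A. g \<otimes> a = a \<otimes> g}" "h \<in> {g \<in> carrier G. \<forall>a\<in>A. g \<otimes> a = a \<otimes> g}"
  have "g \<otimes> h \<otimes> a = a \<otimes> (g \<otimes> h)" if a: "a \<in> A" for a
  proof -
    have aG: "a \<in> carrier G" using a assms by auto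
    have "g \<otimes> h \<otimes> a = g \<otimes> (a \<otimes> h)" using gh a aG by (simp add: m_assoc)
    also have "\<dots> = a \<otimes> g \<otimes> h" using gh a aG by (simp add: m_assoc[symmetric])
    finally show ?thesis using gh aG by (simp add: m_assoc)
  qed
  then show "g \<otimes> h \<in> {g \<in> carrier G. \<forall>a\<in>A. g \<otimes> a = a \<otimes> g}" using gh by simp
qed (use assms in \<open>auto simp: subset_iff intro!: exI[of _ \<one>]\<close>)

text \<open>For \<open>a\<close> outside the group generated by the central \<open>z\<close>, the
  centralizer of \<open>a\<close> in \<open>P\<close> contains that group strictly. All orders are
  powers of \<open>p\<close> up to \<open>p ^ 2\<close>, so the centralizer is all of
  \<open>P\<close>.\<close>

lemma p_squared_subgroup_comm:
  assumes P: "subgroup P G" and p: "prime p" "card P dvd p ^ 2"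
    and z: "z \<in> P" "z \<noteq> \<one>" "\<And>g. g \<in> P \<Longrightarrow> g \<otimes> z = z \<otimes> g"
    and ab: "a \<in> P" "b \<in> P"
  shows "a \<otimes> b = b \<otimes> a"
proof -
  note PG = subgroup.mem_carrier[OF P]
  let ?C = "\<lambda>a. {g \<in> carrier G. \<forall>a\<in>{a}. g \<otimes> a = a \<otimes> g}"
  have sC: "subgroup (?C a) G" if "a \<in> P" for a using centralizer_subgroup[of "{a}"] that PG by auto
  have sPC: "subgroup (P \<inter> ?C a) G" if "a \<in> P" for a using sC[OF that] P subgroups_Inter_pair by blast
  have z0: "subgroup (generate G {z}) G" using generate_is_subgroup z PG by auto
  have zP: "generate G {z} \<subseteq> P" using generate_subgroup_incl[OF _ P] z by simp
  show ?thesis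
  proof (cases "a \<in> generate G {z}")
    case True
    have "generate G {z} \<subseteq> ?C b"
      by (rule generate_subgroup_incl[OF _ sC[OF ab(2)]]) (use z ab PG in auto)
    then show ?thesis using True by auto
  next
    case False
    have sub: "generate G {z} \<subset> P \<inter> ?C a"
    proof -
      have "generate G {z} \<subseteq> ?C a"
        by (rule generate_subgroup_incl[OF _ sC[OF ab(1)]]) (use z ab PG in auto)
      moreover have "a \<in> P \<inter> ?C a" using ab PG by auto
      ultimately show ?thesis using False zP by blast
    qed
    have lt: "card (generate G {z}) < card (P \<inter> ?C a)"
      using psubset_card_mono[OF _ sub] subgroup_fin[OF sPC[OF ab(1)]] by blast
    have d1: "card (generate G {z}) dvd p ^ 2" "card (P \<inter> ?C a) dvd card P"
      using card_subgroup_dvd[OF z0 P zP] card_subgroup_dvd[OF sPC[OF ab(1)] P] p(2) by (auto intro: dvd_trans)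
    obtain i where i: "i \<le> 2" "card (generate G {z}) = p ^ i" using d1 p divides_primepow_nat by blast
    obtain j where j: "j \<le> 2" "card (P \<inter> ?C a) = p ^ j" using d1 p divides_primepow_nat dvd_trans by meson
    have "i \<noteq> 0" using i z generate_pow_card[of z] ord_eq_1[of z] PG by auto
    moreover have "i < j" using lt i j p power_less_imp_less_exp prime_gt_1_nat by metis
    ultimately have "j = 2" using j i by linarith
    then have "card P \<le> card (P \<inter> ?C a)" using p j by (simp add: dvd_imp_le prime_gt_0_nat)
    then have "P \<inter> ?C a = P" using subgroup_eq_if_card[OF sPC[OF ab(1)] P] by blast
    then have "b \<in> P \<inter> ?C a" using ab by blast
    then show ?thesis by auto
  qed
qed

lemma sylow_transversal:
  assumes p: "prime (p::nat)"
  obtains P a where "transversal G P" "card P = p ^ a" "\<not> p dvd card (transversal.T G P)" "p ^ a dvd card (carrier G)"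
proof -
  have n0: "card (carrier G) \<noteq> 0" using fin by auto
  define a where "a = multiplicity p (card (carrier G))"
  obtain m where m: "card (carrier G) = p ^ a * m" "\<not> p dvd m"
    using multiplicity_decompose'[OF n0, of p] p unfolding a_def
    by (metis not_prime_unit)
  obtain P where sP: "subgroup P G" "card P = p ^ a"
    using sylow_thm[OF p is_group, of a m] m fin by (auto simp: order_def)
  interpret Tr: transversal G P by (intro transversal.intro transversal_axioms.intro finite_group_axioms sP)
  have "card Tr.T = m" using Tr.card_T m sP p by (simp add: mult.commute prime_gt_0_nat)
  then show ?thesis using that[OF Tr.transversal_axioms sP(2)] m by simp
qed

text \<open>The Sylow \<open>p\<close>-subgroup contains the central element \<open>z\<close> and
  has order at most \<open>p ^ 2\<close>, hence is abelian. The transfer to it raises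
  \<open>z\<close> to the index of that subgroup, which is prime to \<open>p\<close>, although a
  power of a commutator must be sent to the identity.\<close>

lemma central_commutator_contra:
  assumes xy: "x \<in> carrier G" "y \<in> carrier G" and p: "prime (p::nat)"
    and z: "z = comtr G x y [^] (j::nat)" "z \<noteq> \<one>" "z [^] p = \<one>"
    and central: "\<And>g. g \<in> carrier G \<Longrightarrow> g \<otimes> z = z \<otimes> g"
    and p3: "\<not> p ^ 3 dvd card (carrier G)"
  shows False
proof -
  have zG: "z \<in> carrier G" using xy z by simp
  obtain P a where trP: "transversal G P" "card P = p ^ a" "\<not> p dvd card (transversal.T G P)"
      "p ^ a dvd card (carrier G)"
    using sylow_transversal[OF p] by blast
  interpret Tr: transversal G P by (rule trP)
  obtain t where t: "t \<in> carrier G" "inv t \<otimes> z \<otimes> t \<in> P"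
    using Tr.conj_into_subgroup[OF zG p z(3) trP(3)] by blast
  have "inv t \<otimes> z \<otimes> t = inv t \<otimes> (t \<otimes> z)" using central[OF t(1)] t zG by (simp add: m_assoc)
  then have zP: "z \<in> P" using t zG by (simp add: cancel2)
  have "a \<le> 2" using p3 trP(4) by (metis power_le_dvd not_less_eq_eq numeral_2_eq_2 numeral_3_eq_3)
  then have "card P dvd p ^ 2" using trP(2) le_imp_power_dvd by metis
  then have comm: "a \<otimes> b = b \<otimes> a" if "a \<in> P" "b \<in> P" for a b
    using p_squared_subgroup_comm[OF Tr.P p _ zP z(2) _ that] central Tr.PsubG by blast
  interpret Tr: transfer G P
    by (intro transfer.intro transfer_axioms.intro trP(1)) (rule comm)
  have "Tr.V z = \<one>" using Tr.V_pow Tr.V_comtr xy z by simp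
  moreover have "Tr.V z = z [^] card Tr.T" using Tr.V_central zP central by blast
  ultimately have "ord z dvd card Tr.T" using pow_eq_id zG by simp
  moreover have "ord z = p"
    using z zG p pow_eq_id ord_eq_1 by (metis prime_nat_iff)
  ultimately show False using trP(3) by simp
qed

subsection \<open>Quotients\<close>

context
  fixes N assumes N: "N \<lhd> G"
begin

lemma quot_sub: "subgroup N G" using N by (rule normal_imp_subgroup)

lemma quot_finite_group: "finite_group (G Mod N)"
proof -
  interpret Q: group "G Mod N" by (rule normal.factorgroup_is_group[OF N])
  show ?thesis by unfold_locales (simp add: carrier_FactGroup fin)
qed

lemma quot_hom: "group_hom G (G Mod N) ((#>) N)"
proof -
  interpret Q: finite_group "G Mod N" by (rule quot_finite_group)
  show ?thesis using normal.r_coset_hom_Mod[OF N]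
    by (intro group_hom.intro group_hom_axioms.intro is_group Q.is_group)
qed

lemma quot_eq: "a \<in> carrier G \<Longrightarrow> b \<in> carrier G \<Longrightarrow> N #> a = N #> b \<longleftrightarrow> a \<otimes> inv b \<in> N"
  by (metis quot_sub repr_independence rcos_self subgroup.rcos_module is_group)

lemma quot_eq_one: "a \<in> carrier G \<Longrightarrow> N #> a = N \<longleftrightarrow> a \<in> N"
  by (metis coset_join1 coset_join2 quot_sub subgroup.subset)

lemma quot_mem:
  assumes "subgroup A G" "N \<subseteq> A" "a \<in> carrier G"
  shows "N #> a \<in> (#>) N ` A \<longleftrightarrow> a \<in> A"
proof
  assume "N #> a \<in> (#>) N ` A"
  then obtain b where b: "b \<in> A" "N #> a = N #> b" by blast
  have bG: "b \<in> carrier G" using subgroup.mem_carrier[OF assms(1) b(1)] .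
  have "a \<otimes> inv b \<in> A" using quot_eq[OF assms(3) bG] b assms by blast
  then have "a \<otimes> inv b \<otimes> b \<in> A" using subgroup.m_closed[OF assms(1)] b by blast
  then show "a \<in> A" using assms bG by (simp add: m_assoc)
qed auto

lemma quot_card:
  assumes A: "subgroup A G" "N \<subseteq> A"
  shows "card ((#>) N ` A) * card N = card A"
proof -
  interpret A: group "G\<lparr>carrier := A\<rparr>" by (rule subgroup_imp_group[OF A(1)])
  have sN: "subgroup N (G\<lparr>carrier := A\<rparr>)" using subgroup_incl[OF quot_sub A] .
  have "rcosets\<^bsub>G\<lparr>carrier := A\<rparr>\<^esub> N = (#>) N ` A" by (auto simp: RCOSETS_def)
  then show ?thesis using A.lagrange[OF sN] by (simp add: order_def)
qed

lemma quot_order: "card (carrier (G Mod N)) * card N = card (carrier G)"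
  using quot_card[OF subgroup_self] subgroup.subset[OF quot_sub] by (simp add: carrier_FactGroup)

lemma quot_cnj:
  assumes "g \<in> carrier G" "a \<in> carrier G"
  shows "finite_group.cnj (G Mod N) (N #> g) (N #> a) = N #> cnj g a"
proof -
  interpret Q: finite_group "G Mod N" by (rule quot_finite_group)
  interpret h: group_hom G "G Mod N" "(#>) N" by (rule quot_hom)
  show ?thesis using assms by (simp only: Q.cnj_def cnj_def h.hom_mult[symmetric] h.hom_inv[symmetric]
      inv_closed m_closed)
qed

lemma quot_normal:
  assumes A: "subgroup A G" "N \<subseteq> A" and n: "(#>) N ` A \<lhd> (G Mod N)"
  shows "A \<lhd> G"
proof -
  interpret Q: finite_group "G Mod N" by (rule quot_finite_group)
  have "cnj g a \<in> A" if ga: "g \<in> carrier G" "a \<in> A" for g a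
  proof -
    have aG: "a \<in> carrier G" using subgroup.mem_carrier[OF A(1) ga(2)] .
    have "N #> cnj g a \<in> (#>) N ` A"
      using Q.normal_cnj[OF n, of "N #> g" "N #> a"] ga quot_cnj[OF ga(1) aG]
      by (simp add: carrier_FactGroup)
    then show ?thesis using quot_mem[OF A] ga aG by simp
  qed
  then show ?thesis using normal_iff_Nrm[OF A(1)] by (auto intro: NrmI)
qed

lemma quot_preimage_normal:
  assumes B: "B \<lhd> (G Mod N)"
  shows "{a \<in> carrier G. N #> a \<in> B} \<lhd> G" "(#>) N ` {a \<in> carrier G. N #> a \<in> B} = B"
    "N \<subseteq> {a \<in> carrier G. N #> a \<in> B}"
proof -
  interpret Q: finite_group "G Mod N" by (rule quot_finite_group)
  interpret h: group_hom G "G Mod N" "(#>) N" by (rule quot_hom)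
  have sB: "subgroup B (G Mod N)" using B by (rule normal_imp_subgroup)
  let ?A = "{a \<in> carrier G. N #> a \<in> B}"
  have sA: "subgroup ?A G"
  proof (rule subgroupI)
    show "?A \<noteq> {}" using subgroup.one_closed[OF sB] h.hom_one by (auto intro!: exI[of _ \<one>])
    show "inv a \<in> ?A" if "a \<in> ?A" for a using that subgroup.m_inv_closed[OF sB] by (simp del: mult_FactGroup one_FactGroup)
    show "a \<otimes> b \<in> ?A" if "a \<in> ?A" "b \<in> ?A" for a b
      using that subgroup.m_closed[OF sB] h.hom_mult by (simp del: mult_FactGroup one_FactGroup)
  qed auto
  have "cnj g a \<in> ?A" if "g \<in> carrier G" "a \<in> ?A" for g a
    using that Q.normal_cnj[OF B, of "N #> g" "N #> a"] quot_cnj[of g a]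
    by (simp add: carrier_FactGroup)
  then show "?A \<lhd> G" using normal_iff_Nrm[OF sA] by (auto intro: NrmI)
  show "(#>) N ` ?A = B" using subgroup.subset[OF sB] by (auto simp: carrier_FactGroup)
  have "N \<in> B" using subgroup.one_closed[OF sB] by simp
  moreover have "N #> a = N \<and> a \<in> carrier G" if "a \<in> N" for a
    using that quot_eq_one subgroup.mem_carrier[OF quot_sub that] by blast
  ultimately show "N \<subseteq> ?A" by auto
qed

text \<open>The same contradiction in the quotient by \<open>N\<close>, phrased without mentioning
  the quotient: \<open>r\<close> is its order, and \<open>z\<close> is central modulo
  \<open>N\<close>.\<close>

lemma central_commutator_mod_contra:
  assumes xy: "x \<in> carrier G" "y \<in> carrier G" and p: "prime (p::nat)"
    and z: "z = comtr G x y [^] (j::nat)" "z \<notin> N" "z [^] p \<in> N"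
    and central: "\<And>g. g \<in> carrier G \<Longrightarrow> cnj g z \<otimes> inv z \<in> N"
    and p3: "card (carrier G) = card N * r" "\<not> p ^ 3 dvd r"
  shows False
proof -
  interpret Q: finite_group "G Mod N" by (rule quot_finite_group)
  interpret h: group_hom G "G Mod N" "(#>) N" by (rule quot_hom)
  have zG: "z \<in> carrier G" using xy z by simp
  show False
  proof (rule Q.central_commutator_contra[OF _ _ p, of "N #> x" "N #> y" "N #> z" j])
    show "N #> x \<in> carrier (G Mod N)" "N #> y \<in> carrier (G Mod N)" using xy by (auto simp: carrier_FactGroup)
    show "N #> z = comtr (G Mod N) (N #> x) (N #> y) [^]\<^bsub>G Mod N\<^esub> j"
      unfolding z h.hom_comtr[OF xy, symmetric] using xy by (simp add: normal.FactGroup_pow[OF N])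
    show "N #> z \<noteq> \<one>\<^bsub>G Mod N\<^esub>" using z quot_eq_one zG by simp
    show "(N #> z) [^]\<^bsub>G Mod N\<^esub> p = \<one>\<^bsub>G Mod N\<^esub>"
      using z quot_eq_one zG by (simp add: normal.FactGroup_pow[OF N])
    show "g \<otimes>\<^bsub>G Mod N\<^esub> (N #> z) = (N #> z) \<otimes>\<^bsub>G Mod N\<^esub> g" if g: "g \<in> carrier (G Mod N)" for g
    proof -
      obtain k where k: "k \<in> carrier G" "g = N #> k" using g by (auto simp: carrier_FactGroup)
      have "k \<otimes> z \<otimes> inv (z \<otimes> k) \<in> N" using central[OF k(1)] k zG by (simp add: cnj_def word)
      then have "N #> (k \<otimes> z) = N #> (z \<otimes> k)" using quot_eq[of "k \<otimes> z" "z \<otimes> k"] k zG by simp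
      then show ?thesis unfolding k using k zG h.hom_mult by (simp del: mult_FactGroup)
    qed
    have "card (carrier (G Mod N)) = r"
      using quot_order p3 subgroup_card_pos[OF quot_sub] by simp
    then show "\<not> p ^ 3 dvd card (carrier (G Mod N))" using p3 by simp
  qed
qed

end

subsection \<open>Cyclic subgroups\<close>

lemma generate_sub [simp]: "a \<in> carrier G \<Longrightarrow> subgroup (generate G {a}) G"
  by (rule generate_is_subgroup) simp

lemma generate_self: "a \<in> generate G {a}"
  by (rule generate.incl) simp

lemma generateE:
  assumes "a \<in> carrier G" "b \<in> generate G {a}" obtains i where "b = a [^] (i::nat)"
  using assms generate_eq_powers by auto

lemma generateE_pos:
  assumes "a \<in> carrier G" "b \<in> generate G {a}" obtains i where "b = a [^] (i::nat)" "i > 0"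
proof -
  obtain i where i: "b = a [^] (i::nat)" using generateE[OF assms] .
  have "b = a [^] (i + ord a)" using i assms by (simp add: nat_pow_mult[symmetric])
  then show ?thesis using that ord_pos[OF assms(1)] by force
qed

lemma pow_in_generate: "a \<in> carrier G \<Longrightarrow> a [^] (i::nat) \<in> generate G {a}"
  using generate_eq_powers by auto

lemma generate_subset: "subgroup A G \<Longrightarrow> a \<in> A \<Longrightarrow> generate G {a} \<subseteq> A"
  by (rule generate_subgroup_incl) auto

lemma generate_comm:
  assumes "a \<in> carrier G" "b \<in> generate G {a}" "d \<in> generate G {a}" shows "b \<otimes> d = d \<otimes> b"
proof -
  obtain i j where "b = a [^] (i::nat)" "d = a [^] (j::nat)" using generateE assms by metis
  then show ?thesis using assms by (simp add: nat_pow_mult add.commute)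
qed

lemma generate_cnj: "g \<in> carrier G \<Longrightarrow> a \<in> carrier G \<Longrightarrow> cnj g ` generate G {a} = generate G {cnj g a}"
  by (auto simp: generate_eq_powers cnj_pow) (metis (mono_tags, lifting) cnj_pow image_eqI mem_Collect_eq)

lemma comm_subset_Nrm:
  assumes "K \<subseteq> carrier G" "C \<subseteq> carrier G" "\<And>a k. a \<in> C \<Longrightarrow> k \<in> K \<Longrightarrow> a \<otimes> k = k \<otimes> a"
  shows "C \<subseteq> Nrm K"
proof
  fix a assume a: "a \<in> C"
  have "cnj a k = k" if "k \<in> K" for k using cnj_eq_iff[of a k] assms a that by blast
  then show "a \<in> Nrm K" using a assms by (auto simp: Nrm_def)
qed

text \<open>A normalizing element acts on a cyclic group as a power map, and power maps preserve
  every subgroup.\<close>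

lemma cyclic_subgroup_Nrm:
  assumes c: "c \<in> carrier G" and K: "subgroup K G" "K \<subseteq> generate G {c}"
  shows "Nrm (generate G {c}) \<subseteq> Nrm K"
proof
  fix g assume g: "g \<in> Nrm (generate G {c})"
  then have gG: "g \<in> carrier G" by (simp add: Nrm_def)
  obtain u where u: "cnj g c = c [^] (u::nat)" using generateE[OF c NrmD[OF g generate_self]] .
  show "g \<in> Nrm K"
  proof (rule NrmI[OF gG])
    fix k assume k: "k \<in> K"
    obtain i where i: "k = c [^] (i::nat)" using generateE[OF c] k K by blast
    have "cnj g k = k [^] u" using i u gG c by (simp add: cnj_pow nat_pow_pow mult.commute)
    then show "cnj g k \<in> K" using pow_in_subgroup[OF K(1) k] by simp
  qed
qed

lemma cyclic_normal_subgroup: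
  assumes "c \<in> carrier G" "generate G {c} \<lhd> G" "subgroup K G" "K \<subseteq> generate G {c}"
  shows "K \<lhd> G"
  using cyclic_subgroup_Nrm[OF assms(1,3,4)] assms normal_iff_Nrm by auto

text \<open>\<open>K\<close> is chosen maximal among the normal subgroups of \<open>G\<close> inside
  \<open>C\<close>. A normal subgroup of the quotient inside the image of \<open>C\<close> pulls
  back to another candidate containing \<open>K\<close>, hence to \<open>K\<close> itself.\<close>

lemma exists_core:
  assumes C: "subgroup C G"
  obtains K where "K \<lhd> G" "K \<subseteq> C" "\<And>N. N \<lhd> (G Mod K) \<Longrightarrow> N \<subseteq> (#>) K ` C \<Longrightarrow> N = {\<one>\<^bsub>G Mod K\<^esub>}"
proof -
  let ?S = "{K. K \<lhd> G \<and> K \<subseteq> C}"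
  have fS: "finite ?S" by (rule finite_subset[of _ "Pow C"]) (auto simp: subgroup_fin[OF C])
  have "{\<one>} \<in> ?S" using one_is_normal subgroup.one_closed[OF C] by auto
  from finite_has_maximal2[OF fS this]
  obtain K where "K \<in> ?S" "\<forall>B\<in>?S. K \<subseteq> B \<longrightarrow> K = B" by (elim bexE conjE)
  then have K: "K \<in> ?S" "\<And>B. B \<in> ?S \<Longrightarrow> K \<subseteq> B \<Longrightarrow> K = B" by simp_all
  then have KG: "K \<lhd> G" and KC: "K \<subseteq> C" by auto
  have "N = {\<one>\<^bsub>G Mod K\<^esub>}" if N: "N \<lhd> (G Mod K)" "N \<subseteq> (#>) K ` C" for N
  proof -
    let ?A = "{a \<in> carrier G. K #> a \<in> N}"
    note A = quot_preimage_normal[OF KG N(1)]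
    have "?A \<subseteq> C" using quot_mem[OF KG C KC] N by blast
    then have "K = ?A" using K(2)[of ?A] A by simp
    then have "N = (#>) K ` K" using A by simp
    also have "\<dots> = {K}" using quot_eq_one[OF KG] quot_sub[OF KG] subgroup.mem_carrier subgroup.one_closed
      by (metis (no_types, lifting) image_cong image_constant)
    finally show ?thesis by simp
  qed
  then show ?thesis using that KG KC by blast
qed

text \<open>Two distinct subgroups of order \<open>q\<close> meet trivially and would produce
  \<open>q * q\<close> elements in \<open>H\<close>, more than \<open>q * m\<close>; so all
  conjugates of the subgroup given by Cauchy's theorem coincide.\<close>

lemma exists_normal_prime_subgroup:
  assumes H: "H \<lhd> G" and card: "card H = q * m" "m < q" "prime (q::nat)"
  obtains Q where "subgroup Q G" "Q \<subseteq> H" "card Q = q" "Q \<lhd> G"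
proof -
  have sH: "subgroup H G" using H by (rule normal_imp_subgroup)
  obtain Q where Q: "subgroup Q G" "Q \<subseteq> H" "card Q = q"
    using cauchy_subgroup[OF sH card(3)] card by auto
  have QG: "Q \<subseteq> carrier G" using Q(1) by (rule subgroup.subset)
  have "g \<in> Nrm Q" if g: "g \<in> carrier G" for g
  proof (rule ccontr)
    assume "g \<notin> Nrm Q"
    then have ne: "Q \<noteq> cnj g ` Q" using g by (auto simp: Nrm_def)
    have sg: "subgroup (cnj g ` Q) G" using subgroup_cnj[OF g Q(1)] .
    have "Q \<inter> cnj g ` Q = {\<one>}"
      by (rule prime_subgroups_Int[OF Q(1) sg]) (use Q card ne g QG in auto)
    moreover have "cnj g ` Q \<subseteq> H" using normal_cnj[OF H g] Q by blast
    ultimately have "card Q * card (cnj g ` Q) \<le> card H"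
      using card_prod_le_subgroup[OF Q(1) sg _ sH Q(2)] by blast
    then show False using Q card g QG by simp
  qed
  then have "Q \<lhd> G" using normal_iff_Nrm[OF Q(1)] by blast
  then show ?thesis using that Q by blast
qed

end

subsection \<open>Commutators of prime index\<close>

locale two_gen = finite_group +
  fixes x y
  assumes x [simp]: "x \<in> carrier G" and y [simp]: "y \<in> carrier G"
    and gen: "generate G {x, y} = carrier G"
begin

abbreviation "c \<equiv> comtr G x y"
abbreviation "C \<equiv> generate G {c}"

lemma c_closed: "c \<in> carrier G" by simp

lemma C_sub: "subgroup C G" by simp

lemma C_carrier: "C \<subseteq> carrier G" using subgroup.subset[OF C_sub] .

lemma C_comm: "a \<in> C \<Longrightarrow> b \<in> C \<Longrightarrow> a \<otimes> b = b \<otimes> a"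
  by (rule generate_comm[of c]) auto

lemma card_C: "card C = ord c"
  using generate_pow_card[OF c_closed] by simp

lemma quot_two_gen:
  assumes N: "N \<lhd> G"
  shows "two_gen (G Mod N) (N #> x) (N #> y)"
    and "comtr (G Mod N) (N #> x) (N #> y) = N #> c"
    and "generate (G Mod N) {N #> c} = (#>) N ` C"
proof -
  interpret Q: finite_group "G Mod N" by (rule quot_finite_group[OF N])
  interpret h: group_hom G "G Mod N" "(#>) N" by (rule quot_hom[OF N])
  show "two_gen (G Mod N) (N #> x) (N #> y)"
  proof
    show "generate (G Mod N) {N #> x, N #> y} = carrier (G Mod N)"
      using h.generate_img[of "{x, y}"] gen by (simp add: carrier_FactGroup)
  qed (auto simp: carrier_FactGroup)
  show "comtr (G Mod N) (N #> x) (N #> y) = N #> c" using h.hom_comtr by simp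
  show "generate (G Mod N) {N #> c} = (#>) N ` C" using h.generate_img[of "{c}"] by simp
qed

text \<open>Automorphisms of a cyclic group commute, so \<open>c\<close> acts trivially on it.\<close>

lemma c_centralizes_cyclic_normal:
  assumes z: "z \<in> carrier G" and n: "generate G {z} \<lhd> G" and k: "k \<in> generate G {z}"
  shows "c \<otimes> k = k \<otimes> c"
proof -
  have zz: "cnj g z \<in> generate G {z}" if "g \<in> carrier G" for g
    using normal_cnj[OF n that generate_self] .
  obtain i where i: "cnj x z = z [^] (i::nat)" using generateE[OF z zz[OF x]] .
  obtain j where j: "cnj y z = z [^] (j::nat)" using generateE[OF z zz[OF y]] .
  have kG: "k \<in> carrier G" using subgroup.mem_carrier[OF generate_sub[OF z] k] .
  define w where "w = cnj (inv (y \<otimes> x)) k"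
  have "w \<in> generate G {z}" unfolding w_def using normal_cnj[OF n _ k] by simp
  then obtain e where e: "w = z [^] (e::nat)" using generateE[OF z] by blast
  have "cnj (x \<otimes> y) w = cnj (y \<otimes> x) w"
    using z by (simp add: e cnj_cnj[symmetric] cnj_pow i j nat_pow_pow ac_simps)
  moreover have "cnj (y \<otimes> x) w = k" using kG by (simp add: w_def del: inv_mult_group)
  moreover have "c \<otimes> (y \<otimes> x) = x \<otimes> y" by (simp add: comtr_def word)
  then have "cnj c k = cnj (x \<otimes> y) w"
    using kG cnj_cnj[of c "y \<otimes> x" w] by (simp add: w_def del: inv_mult_group)
  ultimately have "cnj c k = k" by simp
  then show ?thesis using cnj_eq_iff kG by simp
qed

text \<open>Together with \<open>c_centralizes_cyclic_normal\<close> this forces every normal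
  subgroup of prime order into the normalizer of \<open>C\<close>.\<close>

lemma c_centralizes_imp_Nrm_C:
  assumes "Q \<subseteq> carrier G" "\<And>k. k \<in> Q \<Longrightarrow> c \<otimes> k = k \<otimes> c" shows "Q \<subseteq> Nrm C"
proof -
  have "C \<subseteq> {g \<in> carrier G. \<forall>a\<in>Q. g \<otimes> a = a \<otimes> g}"
    by (rule generate_subset[OF centralizer_subgroup]) (use assms in auto)
  then show ?thesis using C_carrier assms(1) by (intro comm_subset_Nrm) force+
qed

text \<open>If \<open>C\<close> covers the quotient by \<open>N\<close>, that quotient is abelian,
  so \<open>c\<close> lies in \<open>N\<close>. Then \<open>C\<close> lies in \<open>N\<close> too,
  the quotient is trivial, and nothing is left outside \<open>N\<close>.\<close>

lemma c_in_normal_if_cover: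
  assumes N: "N \<lhd> G" and cover: "\<And>g. g \<in> carrier G \<Longrightarrow> N #> g \<in> (#>) N ` C"
  shows "N = carrier G"
proof -
  interpret h: group_hom G "G Mod N" "(#>) N" by (rule quot_hom[OF N])
  have "N #> (x \<otimes> y) = N #> (y \<otimes> x)"
  proof -
    obtain a b where ab: "a \<in> C" "N #> x = N #> a" "b \<in> C" "N #> y = N #> b"
      using cover[OF x] cover[OF y] by blast
    have abG: "a \<in> carrier G" "b \<in> carrier G" using ab C_carrier by auto
    show ?thesis using ab abG C_comm[OF ab(1,3)] h.hom_mult[of x y] h.hom_mult[of y x]
        h.hom_mult[of a b] h.hom_mult[of b a] by simp
  qed
  then have "x \<otimes> y \<otimes> inv (y \<otimes> x) \<in> N" using quot_eq[OF N m_closed[OF x y] m_closed[OF y x]] by blast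
  then have "c \<in> N" by (simp add: comtr_def word)
  then have CN: "C \<subseteq> N" using generate_subset[OF quot_sub[OF N]] by blast
  have "g \<in> N" if g: "g \<in> carrier G" for g
  proof -
    obtain a where a: "a \<in> C" "N #> g = N #> a" using cover[OF g] by blast
    then have "N #> a = N" using CN quot_eq_one[OF N] C_carrier by blast
    then show ?thesis using a quot_eq_one[OF N g] by simp
  qed
  then show ?thesis using subgroup.subset[OF quot_sub[OF N]] by blast
qed

text \<open>If \<open>C\<close> is not normal, it is maximal and self-normalizing. Its intersection
  with a different conjugate is normalized by both, hence normal and trivial, which yields
  \<open>card C < q\<close>. Then a subgroup of order \<open>q\<close> is normal and cyclic, is
  centralized by \<open>c\<close>, and so lies in the normalizer of \<open>C\<close>, which has
  fewer than \<open>q\<close> elements.\<close>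

lemma core_free_prime_index:
  assumes core: "\<And>N. N \<lhd> G \<Longrightarrow> N \<subseteq> C \<Longrightarrow> N = {\<one>}"
    and q: "prime (q::nat)" "card (carrier G) = q * card C"
  shows "C = {\<one>}"
proof (rule core[OF _ subset_refl], rule ccontr)
  assume nn: "\<not> C \<lhd> G"
  then have NC: "Nrm C = C"
    using prime_index_between[OF C_sub Nrm_subgroup[OF C_carrier] subgroup_self
        subgroup_subset_Nrm[OF C_sub] _ q(2,1)] normal_iff_Nrm[OF C_sub]
    by (auto simp: Nrm_def)
  obtain g where g: "g \<in> carrier G" "g \<notin> C" using nn NC normal_iff_Nrm[OF C_sub] by blast
  have gC: "subgroup (cnj g ` C) G" using subgroup_cnj[OF g(1) C_sub] .
  have gCG: "cnj g ` C \<subseteq> carrier G" using subgroup.subset[OF gC] .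
  have "cnj g ` C = generate G {cnj g c}" using generate_cnj[OF g(1)] by simp
  then have gcomm: "a \<otimes> b = b \<otimes> a" if "a \<in> cnj g ` C" "b \<in> cnj g ` C" for a b
    using generate_comm[of "cnj g c" a b] that g by simp
  have "carrier G \<subseteq> Nrm (C \<inter> cnj g ` C)"
  proof (rule Nrm_prime_index[OF C_sub subgroup_self q(2,1) C_carrier])
    show "C \<subseteq> Nrm (C \<inter> cnj g ` C)" using C_carrier C_comm by (intro comm_subset_Nrm) auto
    show "cnj g ` C \<subseteq> Nrm (C \<inter> cnj g ` C)" using C_carrier gCG gcomm by (intro comm_subset_Nrm) auto
    show "\<not> cnj g ` C \<subseteq> C" using g NC by (auto simp: Nrm_def)
  qed (use C_carrier gCG in auto)
  then have "C \<inter> cnj g ` C \<lhd> G"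
    using normal_iff_Nrm subgroups_Inter_pair[OF C_sub gC] by blast
  then have triv: "C \<inter> cnj g ` C = {\<one>}" using core by blast
  have "card C * card C < q * card C"
    using card_prod_less_cnj[OF C_sub C_sub subgroup_self _ C_carrier g triv] q by simp
  then have mq: "card C < q" by simp
  obtain Q where Q: "subgroup Q G" "card Q = q" "Q \<lhd> G"
    using exists_normal_prime_subgroup[of "carrier G" q "card C"] normal_self mq q by metis
  have "Q \<noteq> {\<one>}" using Q q by auto
  then obtain z where z: "z \<in> Q" "z \<noteq> \<one>" using subgroup.one_closed[OF Q(1)] by blast
  have Qz: "Q = generate G {z}" using prime_subgroup_generated[OF Q(1) _ z] Q q by simp
  have "Q \<subseteq> Nrm C"
    using c_centralizes_imp_Nrm_C c_centralizes_cyclic_normal[of z] Qz Q subgroup.mem_carrier[OF Q(1)] z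
    by (metis subgroup.subset)
  then have "q \<le> card C" using card_mono[OF subgroup_fin[OF C_sub]] NC Q by metis
  then show False using mq by simp
qed

text \<open>Dividing by the core of \<open>C\<close> preserves the index; in the quotient
  \<open>C\<close> becomes trivial and therefore normal.\<close>

lemma prime_index_normal:
  assumes q: "prime (q::nat)" "card (carrier G) = q * card C"
  shows "C \<lhd> G"
proof -
  obtain K where K: "K \<lhd> G" "K \<subseteq> C" "\<And>N. N \<lhd> (G Mod K) \<Longrightarrow> N \<subseteq> (#>) K ` C \<Longrightarrow> N = {\<one>\<^bsub>G Mod K\<^esub>}"
    using exists_core[OF C_sub] by blast
  interpret Q: two_gen "G Mod K" "K #> x" "K #> y" by (rule quot_two_gen[OF K(1)])
  have QC: "Q.C = (#>) K ` C" using quot_two_gen[OF K(1)] by simp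
  have "card (carrier (G Mod K)) * card K = q * (card Q.C * card K)"
    unfolding QC quot_card[OF K(1) C_sub K(2)] quot_order[OF K(1)] by (rule q(2))
  then have "card (carrier (G Mod K)) = q * card Q.C"
    using subgroup_card_pos[OF quot_sub[OF K(1)]] by simp
  then have "Q.C = {\<one>\<^bsub>G Mod K\<^esub>}" using Q.core_free_prime_index[OF _ q(1)] K(3) QC by metis
  then have "(#>) K ` C \<lhd> (G Mod K)" using QC Q.one_is_normal by metis
  then show ?thesis using quot_normal[OF K(1) C_sub K(2)] by blast
qed

end

text \<open>The order of \<open>u\<close> modulo \<open>p\<close> is exactly \<open>q\<close> and
  divides \<open>p - 1\<close>.\<close>

lemma cong_1_if_prime_order:
  fixes u p q :: nat
  assumes p: "prime p" and q: "prime q" and u: "[u ^ q = 1] (mod p)" "\<not> [u = 1] (mod p)"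
  shows "[p = 1] (mod q)"
proof -
  have "\<not> p dvd u"
  proof
    assume "p dvd u"
    then have "p dvd u ^ q" using q by (meson dvd_power dvd_trans prime_gt_0_nat)
    then have "p dvd 1" using u(1) cong_dvd_iff by blast
    then show False using p not_prime_unit by blast
  qed
  then have cop: "coprime p u" using p prime_imp_coprime by blast
  have "ord p u dvd q" using u(1) ord_divides[of u q p] by simp
  moreover have "ord p u \<noteq> 1" using u(2) ord_divides[of u 1 p] by simp
  ultimately have "ord p u = q" using q prime_nat_iff by blast
  then have "q dvd totient p" using order_divides_totient[OF cop] by simp
  then have "q dvd p - 1" using p by (simp add: totient_prime)
  then show ?thesis using p prime_ge_1_nat by (simp add: cong_altdef_nat)
qed

section \<open>Subgroups of index two, cores and numbers of conjugates\<close>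

context finite_group
begin

text \<open>\<open>D\<close> and the coset of \<open>g\<close> already exhaust \<open>H\<close>, so
  \<open>k\<close> has to lie in that coset.\<close>

lemma index2_quotient:
  assumes D: "subgroup D G" and H: "subgroup H G" "D \<subseteq> H" "card H = 2 * card D"
    and gk: "g \<in> H" "g \<notin> D" "k \<in> H" "k \<notin> D"
  shows "inv g \<otimes> k \<in> D"
proof (rule ccontr)
  assume n: "inv g \<otimes> k \<notin> D"
  note HG = subgroup.mem_carrier[OF H(1)]
  let ?gD = "(\<lambda>d. g \<otimes> d) ` D"
  have c1: "card ?gD = card D"
    by (rule card_image, rule inj_on_inverseI[of _ "\<lambda>k. inv g \<otimes> k"])
      (use gk H(2) HG in \<open>simp add: cancel2 subset_iff\<close>)
  have d1: "?gD \<inter> D = {}"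
  proof (rule ccontr)
    assume "?gD \<inter> D \<noteq> {}"
    then obtain d where d: "d \<in> D" "g \<otimes> d \<in> D" by blast
    then have "g \<otimes> d \<otimes> inv d \<in> D" using subgroup.m_closed[OF D] subgroup.m_inv_closed[OF D] by blast
    then show False using gk d HG H by (auto simp: word subset_iff)
  qed
  have d2: "k \<notin> ?gD"
  proof
    assume "k \<in> ?gD"
    then obtain d where d: "d \<in> D" "k = g \<otimes> d" by blast
    then have "inv g \<otimes> k = d" using gk HG H by (auto simp: word subset_iff)
    then show False using n d by simp
  qed
  have fD: "finite D" using subgroup_fin[OF D] .
  have "card (insert k (?gD \<union> D)) = Suc (2 * card D)"
    using c1 d1 d2 gk(4) fD by (simp add: card_Un_disjoint)
  moreover have "insert k (?gD \<union> D) \<subseteq> H"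
    using gk H(2) by (auto intro!: subgroup.m_closed[OF H(1)])
  ultimately show False using card_mono[OF subgroup_fin[OF H(1)], of "insert k (?gD \<union> D)"] H(3) by simp
qed

lemma index2_square:
  assumes D: "subgroup D G" and H: "subgroup H G" "D \<subseteq> H" "card H = 2 * card D" and g: "g \<in> H"
  shows "g \<otimes> g \<in> D"
proof (rule ccontr)
  assume n: "g \<otimes> g \<notin> D"
  have gG: "g \<in> carrier G" using subgroup.mem_carrier[OF H(1) g] .
  have gD: "g \<notin> D" using n subgroup.m_closed[OF D] by blast
  have "inv g \<otimes> (g \<otimes> g) \<in> D"
    by (rule index2_quotient[OF D H g gD _ n]) (rule subgroup.m_closed[OF H(1) g g])
  then show False using gD gG by (simp add: word)
qed

lemma index2_Nrm:
  assumes D: "subgroup D G" and H: "subgroup H G" "D \<subseteq> H" "card H = 2 * card D"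
  shows "H \<subseteq> Nrm D"
proof
  fix g assume g: "g \<in> H"
  have gG: "g \<in> carrier G" using subgroup.mem_carrier[OF H(1) g] .
  show "g \<in> Nrm D"
  proof (cases "g \<in> D")
    case True then show ?thesis using subgroup_subset_Nrm[OF D] by blast
  next
    case False
    show ?thesis
    proof (rule NrmI[OF gG])
      fix d assume d: "d \<in> D"
      have dG: "d \<in> carrier G" using subgroup.mem_carrier[OF D d] .
      show "cnj g d \<in> D"
      proof (rule ccontr)
        assume n: "cnj g d \<notin> D"
        have "cnj g d \<in> H" unfolding cnj_def using g d H(2)
          by (auto intro!: subgroup.m_closed[OF H(1)] subgroup.m_inv_closed[OF H(1)])
        then have "inv g \<otimes> cnj g d \<in> D" using index2_quotient[OF D H g False _ n] by blast
        then have "d \<otimes> inv g \<in> D" using gG dG by (simp add: cnj_def word)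
        then have "inv d \<otimes> (d \<otimes> inv g) \<in> D"
          using subgroup.m_closed[OF D] subgroup.m_inv_closed[OF D d] by blast
        then have "inv g \<in> D" using gG dG by (simp add: word)
        then have "inv (inv g) \<in> D" by (rule subgroup.m_inv_closed[OF D])
        then show False using False gG by simp
      qed
    qed
  qed
qed

lemma core_normal:
  assumes A: "subgroup A G"
  shows "{k \<in> carrier G. \<forall>g\<in>carrier G. cnj g k \<in> A} \<lhd> G" (is "?K \<lhd> G")
proof -
  have sK: "subgroup ?K G"
  proof (rule subgroupI)
    show "?K \<noteq> {}" using subgroup.one_closed[OF A] by (auto intro!: exI[of _ \<one>])
    show "inv a \<in> ?K" if "a \<in> ?K" for a
      using that subgroup.m_inv_closed[OF A] by (simp add: cnj_inv)
    show "a \<otimes> b \<in> ?K" if "a \<in> ?K" "b \<in> ?K" for a b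
      using that subgroup.m_closed[OF A] by (simp add: cnj_mult)
  qed auto
  have "h \<in> Nrm ?K" if h: "h \<in> carrier G" for h
    by (rule NrmI[OF h]) (use h in \<open>simp add: cnj_cnj\<close>)
  then show ?thesis using normal_iff_Nrm[OF sK] by blast
qed

lemma core_subset: "{k \<in> carrier G. \<forall>g\<in>carrier G. cnj g k \<in> A} \<subseteq> A"
proof clarify
  fix k assume "k \<in> carrier G" "\<forall>g\<in>carrier G. cnj g k \<in> A"
  then show "k \<in> A" using cnj_by_one[of k] one_closed by metis
qed

lemma normal_index_pow:
  assumes H: "H \<lhd> G" "card (carrier G) = r * card H" and g: "g \<in> carrier G"
  shows "g [^] r \<in> H"
proof -
  interpret Q: finite_group "G Mod H" by (rule quot_finite_group[OF H(1)])
  have "card (carrier (G Mod H)) = r"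
    using quot_order[OF H(1)] H(2) subgroup_card_pos[OF quot_sub[OF H(1)]] by simp
  then have "(H #> g) [^]\<^bsub>G Mod H\<^esub> r = \<one>\<^bsub>G Mod H\<^esub>"
    using Q.pow_order_eq_1[of "H #> g"] g by (simp add: order_def carrier_FactGroup)
  then have "H #> (g [^] r) = H" using normal.FactGroup_pow[OF H(1) g] by simp
  then show ?thesis using quot_eq_one[OF H(1)] g by simp
qed

text \<open>Whenever \<open>M\<close> is normal, division by it turns \<open>c\<close> into an
  element of order \<open>p\<close>, the situation of
  \<open>central_commutator_mod_contra\<close>.\<close>

lemma generate_prime_pow:
  assumes c: "c \<in> carrier G" and p: "prime (p::nat)" "p dvd ord c"
  defines "M \<equiv> generate G {c [^] p}"
  shows "subgroup M G" "M \<subseteq> generate G {c}" "card M * p = ord c" "c \<notin> M" "c [^] p \<in> M"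
proof -
  show M: "subgroup M G" unfolding M_def using c by simp
  show sub: "M \<subseteq> generate G {c}"
    unfolding M_def by (rule generate_subset) (use c pow_in_generate in auto)
  have "card M = ord c div p"
    unfolding M_def using generate_pow_card[of "c [^] p"] ord_pow[OF c p(2)] c p by (simp add: prime_gt_0_nat)
  then show cM: "card M * p = ord c" using p by simp
  show "c [^] p \<in> M" unfolding M_def by (rule generate_self)
  show "c \<notin> M"
  proof
    assume "c \<in> M"
    then have "generate G {c} \<subseteq> M" using generate_subset[OF M] by blast
    then have "ord c \<le> card M" using card_mono[OF subgroup_fin[OF M]] generate_pow_card[OF c] by simp
    then show False using cM p subgroup_card_pos[OF M] prime_gt_1_nat
      by (metis mult.right_neutral nat_mult_less_cancel1 not_less)
  qed
qed

text \<open>Orbit-stabilizer for conjugation: a transversal of the normalizer corresponds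
  bijectively to the conjugates.\<close>

lemma card_conjugates:
  assumes A: "A \<subseteq> carrier G"
  shows "card ((\<lambda>g. cnj g ` A) ` carrier G) * card (Nrm A) = card (carrier G)"
proof -
  interpret Tr: transversal G "Nrm A"
    by (intro transversal.intro transversal_axioms.intro finite_group_axioms Nrm_subgroup A)
  have rep: "cnj (Tr.rep g) ` A = cnj g ` A" if g: "g \<in> carrier G" for g
  proof -
    obtain p where p: "p \<in> Nrm A" "Tr.rep g = g \<otimes> p" using Tr.rep_ex[OF g] by blast
    then show ?thesis using Nrm_image[OF p(1) A] cnj_image_cnj[OF g _ A, of p] Tr.PsubG by simp
  qed
  have "inj_on (\<lambda>g. cnj g ` A) Tr.T"
  proof (rule inj_onI)
    fix s t assume st: "s \<in> Tr.T" "t \<in> Tr.T" "cnj s ` A = cnj t ` A"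
    note stG = Tr.T_carrier[OF st(1)] Tr.T_carrier[OF st(2)]
    have "cnj (inv t \<otimes> s) ` A = cnj (inv t) ` cnj s ` A" using cnj_image_cnj stG A by simp
    also have "\<dots> = A" using st stG A by (simp add: cnj_image_cnj cnj_image_one)
    finally have "inv t \<otimes> s \<in> Nrm A" using stG by (simp add: Nrm_def)
    then show "s = t" using Tr.rep_eq_iff[OF stG(1) st(2)] Tr.rep_T[OF st(1)] by simp
  qed
  moreover have "(\<lambda>g. cnj g ` A) ` carrier G = (\<lambda>g. cnj g ` A) ` Tr.T"
    using rep Tr.rep_in_T Tr.T_carrier by (auto simp: image_iff) metis+
  ultimately have "card ((\<lambda>g. cnj g ` A) ` carrier G) = card Tr.T" by (simp add: card_image)
  then show ?thesis using Tr.card_T by simp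
qed

lemma set_mult_Nrm_subgroup:
  assumes R: "subgroup R G" and Q: "subgroup Q G" "Q \<subseteq> Nrm R"
  shows "subgroup (R <#> Q) G"
proof (rule subgroupI)
  note RG = subgroup.mem_carrier[OF R] and QG = subgroup.mem_carrier[OF Q(1)]
  show "R <#> Q \<subseteq> carrier G" using RG QG by (auto simp: set_mult_def)
  show "R <#> Q \<noteq> {}" using subgroup.one_closed[OF R] subgroup.one_closed[OF Q(1)] by (auto simp: set_mult_def)
  fix a assume "a \<in> R <#> Q"
  then obtain r q where a: "r \<in> R" "q \<in> Q" "a = r \<otimes> q" by (auto simp: set_mult_def)
  have "inv q \<in> Q" using subgroup.m_inv_closed[OF Q(1) a(2)] .
  moreover have "cnj (inv q) (inv r) \<in> R"
    using NrmD[of "inv q" R "inv r"] Q(2) \<open>inv q \<in> Q\<close> subgroup.m_inv_closed[OF R a(1)] by blast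
  moreover have "inv a = cnj (inv q) (inv r) \<otimes> inv q" using a RG QG by (simp add: cnj_def word)
  ultimately show "inv a \<in> R <#> Q" unfolding set_mult_def by blast
  fix b assume "b \<in> R <#> Q"
  then obtain s t where b: "s \<in> R" "t \<in> Q" "b = s \<otimes> t" by (auto simp: set_mult_def)
  have "a \<otimes> b = (r \<otimes> cnj q s) \<otimes> (q \<otimes> t)" using a b RG QG by (simp add: cnj_def word)
  moreover have "r \<otimes> cnj q s \<in> R" using subgroup.m_closed[OF R a(1)] NrmD[of q R s] Q(2) a b by blast
  moreover have "q \<otimes> t \<in> Q" using subgroup.m_closed[OF Q(1)] a b by blast
  ultimately show "a \<otimes> b \<in> R <#> Q" unfolding set_mult_def by blast
qed

text \<open>A generator \<open>z\<close> of \<open>Q\<close> permutes the conjugates with period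
  \<open>q\<close> and fixes only \<open>Q\<close>: if \<open>Q\<close> normalized another
  conjugate, the product of the two would be a subgroup of order \<open>q ^ 2\<close>.\<close>

lemma card_conjugates_prime_subgroup:
  assumes Q: "subgroup Q G" "card Q = q" "prime (q::nat)" and q2: "\<not> q ^ 2 dvd card (carrier G)"
  shows "[card ((\<lambda>g. cnj g ` Q) ` carrier G) = 1] (mod q)"
proof -
  have QG: "Q \<subseteq> carrier G" using Q(1) by (rule subgroup.subset)
  let ?X = "(\<lambda>g. cnj g ` Q) ` carrier G"
  have "Q \<noteq> {\<one>}" using Q by auto
  then obtain z where z: "z \<in> Q" "z \<noteq> \<one>" using subgroup.one_closed[OF Q(1)] by blast
  have zG: "z \<in> carrier G" using z QG by blast
  have Qz: "Q = generate G {z}" "ord z = q" using prime_subgroup_generated[OF Q(1) _ z] Q by auto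
  have XG: "R \<subseteq> carrier G" if "R \<in> ?X" for R using that cnj_subset QG by blast
  have it: "((`) (cnj z) ^^ i) R = cnj (z [^] i) ` R" if "R \<subseteq> carrier G" for i R
  proof (induction i)
    case 0 then show ?case using cnj_image_one[OF that] by simp
  next
    case (Suc i)
    then show ?case using that zG by (simp add: cnj_image_cnj nat_pow_Suc2[symmetric] del: nat_pow_Suc)
  qed
  have fix_iff: "cnj z ` R = R \<longleftrightarrow> R = Q" if R: "R \<in> ?X" for R
  proof
    assume "R = Q" then show "cnj z ` R = R"
      using Nrm_image[OF _ QG] subgroup_subset_Nrm[OF Q(1)] z by blast
  next
    assume f: "cnj z ` R = R"
    obtain g where g: "g \<in> carrier G" "R = cnj g ` Q" using R by blast
    have sR: "subgroup R G" "card R = q" using g subgroup_cnj[OF g(1) Q(1)] Q QG by auto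
    show "R = Q"
    proof (rule ccontr)
      assume "R \<noteq> Q"
      then have triv: "R \<inter> Q = {\<one>}" using prime_subgroups_Int[OF sR(1) Q(1)] sR Q by simp
      have "z \<in> Nrm R" using f zG by (simp add: Nrm_def)
      then have "Q \<subseteq> Nrm R" using generate_subset[OF Nrm_subgroup[OF XG[OF R]]] Qz by simp
      then have "subgroup (R <#> Q) G" using set_mult_Nrm_subgroup[OF sR(1) Q(1)] by blast
      then have "card (R <#> Q) dvd card (carrier G)" by (rule card_subgroup_dvd_order)
      then show False using card_set_mult_trivial_Int[OF sR(1) Q(1) triv] sR Q q2
        by (simp add: power2_eq_square)
    qed
  qed
  have "[card ?X = card {R \<in> ?X. cnj z ` R = R}] (mod q)"
  proof (rule card_fixed_cong[OF Q(3)])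
    show "finite ?X" using fin by simp
    fix R assume R: "R \<in> ?X"
    then obtain g where g: "g \<in> carrier G" "R = cnj g ` Q" by blast
    have "cnj z ` R = cnj (z \<otimes> g) ` Q" using g zG QG cnj_image_cnj by simp
    then have "cnj z ` R \<in> ?X" using g zG by blast
    moreover have "((`) (cnj z) ^^ q) R = R" using it[OF XG[OF R]] Qz zG XG[OF R] cnj_image_one
      by (metis pow_ord_eq_1)
    ultimately show "cnj z ` R \<in> ?X \<and> ((`) (cnj z) ^^ q) R = R" by blast
  qed
  moreover have "Q \<in> ?X" using cnj_image_one[OF QG] by (metis imageI one_closed)
  then have "{R \<in> ?X. cnj z ` R = R} = {Q}" using fix_iff by blast
  ultimately show ?thesis by simp
qed

lemma card_Union_trivial_Int:
  assumes F: "finite F" "\<And>A. A \<in> F \<Longrightarrow> subgroup A G"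
    "\<And>A B. A \<in> F \<Longrightarrow> B \<in> F \<Longrightarrow> A \<noteq> B \<Longrightarrow> A \<inter> B = {\<one>}"
  shows "card ((\<Union>F) - {\<one>}) = (\<Sum>A\<in>F. card A - 1)"
proof -
  have "(\<Union>F) - {\<one>} = (\<Union>A\<in>F. A - {\<one>})" by blast
  also have "card \<dots> = (\<Sum>A\<in>F. card (A - {\<one>}))"
  proof (rule card_UN_disjoint[OF F(1)])
    show "\<forall>A\<in>F. finite (A - {\<one>})" using F(2) subgroup_fin by blast
    show "\<forall>A\<in>F. \<forall>B\<in>F. A \<noteq> B \<longrightarrow> (A - {\<one>}) \<inter> (B - {\<one>}) = {}" using F(3) by blast
  qed
  also have "\<dots> = (\<Sum>A\<in>F. card A - 1)"
  proof (rule sum.cong[OF refl])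
    fix A assume "A \<in> F"
    then show "card (A - {\<one>}) = card A - 1" using subgroup.one_closed[OF F(2)] subgroup_fin[OF F(2)] by simp
  qed
  finally show ?thesis .
qed

end

context two_gen
begin

text \<open>An element \<open>g\<close> outside \<open>C\<close> raises \<open>c\<close> to some
  power \<open>u\<close>, and \<open>g [^] q\<close> lies in the abelian group \<open>C\<close>, so
  \<open>u ^ q\<close> is 1 modulo \<open>p\<close>. If already \<open>u\<close> were 1 modulo
  \<open>p\<close>, then \<open>c\<close> would be central modulo \<open>?M\<close>, in a quotient
  of order \<open>q * p\<close>.\<close>

lemma normal_prime_index_factor:
  assumes C: "C \<lhd> G" and q: "prime (q::nat)" "card (carrier G) = q * card C"
    and p: "prime (p::nat)" "p dvd card C"
  shows "[p = 1] (mod q)"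
proof -
  let ?M = "generate G {c [^] p}"
  have pc: "p dvd ord c" using p card_C by simp
  note M = generate_prime_pow[OF c_closed p(1) pc]
  have Mn: "?M \<lhd> G" using cyclic_normal_subgroup[OF c_closed C M(1,2)] .
  have "C \<noteq> carrier G"
    using q subgroup_card_pos[OF C_sub] prime_gt_1_nat by (metis mult.left_neutral mult_cancel2 less_irrefl)
  then obtain g where g: "g \<in> carrier G" "g \<notin> C" using C_carrier by blast
  obtain u where u: "cnj g c = c [^] (u::nat)" "u > 0"
    using generateE_pos[OF c_closed normal_cnj[OF C g(1) generate_self]] .
  have it: "cnj (g [^] i) c = c [^] (u ^ i)" for i :: nat
  proof (induction i)
    case (Suc i)
    have "cnj (g [^] Suc i) c = cnj (g [^] i) (cnj g c)" using g by (simp add: cnj_cnj)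
    also have "\<dots> = c [^] (u ^ i * u)" using Suc g by (simp add: u cnj_pow nat_pow_pow)
    finally show ?case by (simp add: mult.commute)
  qed simp
  have gq: "g [^] q \<in> C" using normal_index_pow[OF C q(2) g(1)] .
  then have "cnj (g [^] q) c = c" using C_comm[OF gq generate_self] cnj_eq_iff g by simp
  then have "c [^] int (u ^ q) = c [^] (1::int)"
    using it[of q] by (simp only: int_pow_int int_pow_1[OF c_closed])
  then have "int (ord c) dvd 1 - int (u ^ q)" using int_pow_eq[of c "int (u ^ q)" 1] by simp
  then have "int p dvd 1 - int (u ^ q)" using pc by (meson dvd_trans int_dvd_int_iff)
  then have uq: "[u ^ q = 1] (mod p)"
    by (metis cong_iff_dvd_diff cong_int_iff cong_sym of_nat_1)
  have "\<not> [u = 1] (mod p)"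
  proof
    assume "[u = 1] (mod p)"
    then have "p dvd u - 1" using u(2) cong_to_1_nat by auto
    then obtain t where t: "u = 1 + p * t" using u(2) by (metis One_nat_def Suc_leI dvdE le_add_diff_inverse)
    have gM: "cnj g c \<otimes> inv c \<in> ?M"
    proof -
      have "cnj g c = c [^] (p * t) \<otimes> c" by (simp add: u t nat_pow_mult)
      then have "cnj g c \<otimes> inv c = (c [^] p) [^] t" by (simp add: m_assoc nat_pow_pow)
      then show ?thesis using pow_in_generate[of "c [^] p" t] by simp
    qed
    have mem: "?M #> c \<subseteq> carrier G" using M(1) subgroup.subset r_coset_subset_G by (metis c_closed)
    have coset: "a \<in> ?M #> c \<longleftrightarrow> a \<otimes> inv c \<in> ?M" if "a \<in> carrier G" for a
      using that subgroup.rcos_module[OF M(1) is_group c_closed] by blast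
    \<comment> \<open>The normalizer of the coset \<open>?M #> c\<close>, taken as a set, consists
      of the elements that fix \<open>c\<close> modulo \<open>?M\<close>. It contains both
      \<open>C\<close> and \<open>g\<close>, hence everything.\<close>
    have sN: "subgroup (Nrm (?M #> c)) G" using Nrm_subgroup[OF mem] .
    have "C \<subseteq> Nrm (?M #> c)"
    proof (rule comm_subset_Nrm[OF mem C_carrier])
      fix a k assume a: "a \<in> C" and k: "k \<in> ?M #> c"
      then obtain m where m: "m \<in> ?M" "k = m \<otimes> c" by (auto simp: r_coset_def)
      then have "k \<in> C" using M(2) subgroup.m_closed[OF C_sub] generate_self[of c] by blast
      then show "a \<otimes> k = k \<otimes> a" using C_comm a by blast
    qed
    moreover have gN: "g \<in> Nrm (?M #> c)"
    proof (rule NrmI[OF g(1)])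
      fix k assume "k \<in> ?M #> c"
      then obtain m where m: "m \<in> ?M" "k = m \<otimes> c" by (auto simp: r_coset_def)
      have mG: "m \<in> carrier G" using subgroup.mem_carrier[OF M(1) m(1)] .
      have "cnj g k \<otimes> inv c = cnj g m \<otimes> (cnj g c \<otimes> inv c)" using m mG g by (simp add: cnj_mult m_assoc)
      also have "\<dots> \<in> ?M" using subgroup.m_closed[OF M(1) normal_cnj[OF Mn g(1) m(1)] gM] .
      finally show "cnj g k \<in> ?M #> c" using coset m mG g by simp
    qed
    ultimately have "Nrm (?M #> c) = carrier G"
      using prime_index_between[OF C_sub sN subgroup_self _ _ q(2,1)] g(2) subgroup.subset[OF sN] by blast
    then have cen: "cnj h c \<otimes> inv c \<in> ?M" if "h \<in> carrier G" for h
      using NrmD[of h "?M #> c" c] that coset[of c] coset[of "cnj h c"] subgroup.one_closed[OF M(1)] by simp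
    have "card (carrier G) = card ?M * (q * p)" using q(2) M(3) card_C by (simp add: ac_simps)
    \<comment> \<open>The case \<open>p = q\<close> is included: even then the order is only
      \<open>p ^ 2\<close>.\<close>
    moreover have "\<not> p ^ 3 dvd q * p"
    proof
      assume "p ^ 3 dvd q * p"
      then have "p ^ 2 dvd q" using p(1) by (simp add: power3_eq_cube power2_eq_square prime_gt_0_nat)
      moreover from this have "p dvd q" by (auto simp: power2_eq_square dest: dvd_mult_left)
      then have "q = p" using primes_dvd_imp_eq[OF p(1) q(1)] by simp
      ultimately have "p * p dvd p * 1" by (simp add: power2_eq_square)
      then have "p dvd 1" using p(1) by (simp del: mult_1_right add: prime_gt_0_nat)
      then show False using p(1) not_prime_unit by blast
    qed
    ultimately show False
      using central_commutator_mod_contra[OF Mn x y p(1), of c 1 "q * p"] M(4,5) cen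
      by simp
  qed
  then show ?thesis using cong_1_if_prime_order[OF p(1) q(1) uq] by blast
qed

text \<open>Modulo \<open>?M\<close> the normal subgroup \<open>C\<close> has order 2, and its only
  nontrivial element is fixed by every conjugation. So \<open>c\<close> is central modulo
  \<open>?M\<close>, in a quotient of order \<open>4 * q\<close>, which 8 does not divide.\<close>

lemma normal_index_twice_prime_odd:
  assumes C: "C \<lhd> G" and q: "prime (q::nat)" "odd q" "card (carrier G) = 2 * q * card C"
  shows "odd (card C)"
proof
  assume ev: "even (card C)"
  let ?M = "generate G {c [^] (2::nat)}"
  have pc: "2 dvd ord c" using ev card_C by simp
  note M = generate_prime_pow[OF c_closed two_is_prime_nat pc]
  have Mn: "?M \<lhd> G" using cyclic_normal_subgroup[OF c_closed C M(1,2)] .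
  have cen: "cnj h c \<otimes> inv c \<in> ?M" if h: "h \<in> carrier G" for h
  proof -
    obtain u where u: "cnj h c = c [^] (u::nat)" "u > 0"
      using generateE_pos[OF c_closed normal_cnj[OF C h generate_self]] .
    have evM: "c [^] (2 * i) \<in> ?M" for i :: nat
      using pow_in_generate[of "c [^] (2::nat)" i] by (simp add: nat_pow_pow)
    have "odd u"
    proof
      assume "even u"
      then have "cnj h c \<in> ?M" using u evM by (auto elim!: evenE)
      then have "cnj (inv h) (cnj h c) \<in> ?M" using normal_cnj[OF Mn] h by blast
      then show False using h M(4) by simp
    qed
    then obtain i where "u = 2 * i + 1" by (elim oddE)
    then have "cnj h c \<otimes> inv c = c [^] (2 * i)" using u by (simp add: nat_pow_mult[symmetric] m_assoc)
    then show ?thesis using evM by simp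
  qed
  have "card (carrier G) = card ?M * (4 * q)" using q(3) M(3) card_C by simp
  moreover have "\<not> (2::nat) ^ 3 dvd 4 * q"
  proof
    assume "(2::nat) ^ 3 dvd 4 * q"
    then obtain k where "4 * q = 8 * k" by auto
    then show False using q(2) by presburger
  qed
  ultimately show False
    using central_commutator_mod_contra[OF Mn x y two_is_prime_nat, of c 1 "4 * q"] M(4,5) cen
    by simp
qed

end

subsection \<open>Commutators of index twice an odd prime\<close>

lemma prod_eq_twice_prime:
  fixes s r q :: nat
  assumes "s * r = 2 * q" "prime q" "s \<noteq> 1" "r \<noteq> 1"
  shows "(s = 2 \<and> r = q) \<or> (s = q \<and> r = 2)"
proof -
  have "even s \<or> even r" using assms(1) by (metis dvd_triv_left even_mult_iff)
  then show ?thesis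
  proof
    assume "even s"
    then obtain t where t: "s = 2 * t" by blast
    then have "t * r = q" using assms(1) by simp
    then have "t = 1" using assms(2,4) prime_product by blast
    then show ?thesis using t \<open>t * r = q\<close> by simp
  next
    assume "even r"
    then obtain t where t: "r = 2 * t" by blast
    then have "s * t = q" using assms(1) by simp
    then have "t = 1" using assms(2,3) prime_product by blast
    then show ?thesis using t \<open>s * t = q\<close> by simp
  qed
qed

text \<open>The situation after division by the core of \<open>C\<close>; \<open>C_nontriv\<close>
  expresses that \<open>C\<close> was not normal before.\<close>

locale core_free_two_gen = two_gen +
  fixes q :: nat
  assumes core: "\<And>N. N \<lhd> G \<Longrightarrow> N \<subseteq> C \<Longrightarrow> N = {\<one>}"
    and C_nontriv: "C \<noteq> {\<one>}"
    and q: "prime q" "odd q" and card_G: "card (carrier G) = 2 * q * card C"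
begin

lemma q_ge_3: "q \<ge> 3"
  using q prime_ge_2_nat by (metis One_nat_def Suc_leI eval_nat_numeral(3) even_numeral le_neq_implies_less)

lemma C_not_normal: "\<not> C \<lhd> G"
  using core C_nontriv by blast

lemma one_in_C: "\<one> \<in> C" by (rule subgroup.one_closed[OF C_sub])

lemma normal_Int_trivial:
  assumes "subgroup D G" "carrier G \<subseteq> Nrm (C \<inter> D)" shows "C \<inter> D = {\<one>}"
  using core[of "C \<inter> D"] normal_iff_Nrm[OF subgroups_Inter_pair[OF C_sub assms(1)]] assms(2) by blast

text \<open>The subgroup is \<open>N <#> C\<close>. It exceeds \<open>C\<close> because the
  core-free \<open>C\<close> cannot contain \<open>N\<close>, and it is proper by
  \<open>c_in_normal_if_cover\<close>. The index \<open>2 * q\<close> thus splits into two primes;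
  modulo \<open>N\<close> the image of \<open>C\<close> has prime index and is normal by
  \<open>prime_index_normal\<close>.\<close>

lemma intermediate_normal_subgroup:
  assumes N: "N \<lhd> G" "N \<noteq> {\<one>}" "N \<noteq> carrier G"
  obtains H where "H \<lhd> G" "C \<subseteq> H" "card H = q * card C" "card (carrier G) = 2 * card H"
  | H where "H \<lhd> G" "C \<subseteq> H" "card H = 2 * card C" "card (carrier G) = q * card H"
proof -
  note sN = quot_sub[OF N(1)]
  have NG: "N \<subseteq> carrier G" using sN by (rule subgroup.subset)
  let ?H = "N <#> C"
  have "C \<subseteq> Nrm N" using normal_iff_Nrm[OF sN] N(1) C_carrier by blast
  then have sH: "subgroup ?H G" using set_mult_Nrm_subgroup[OF sN C_sub] by blast
  have NH: "N \<subseteq> ?H"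
  proof
    fix n assume n: "n \<in> N"
    then have "n = n \<otimes> \<one>" using NG by (simp add: subset_iff)
    then show "n \<in> ?H" using n one_in_C unfolding set_mult_def by blast
  qed
  have CH: "C \<subseteq> ?H"
  proof
    fix n assume n: "n \<in> C"
    then have "n = \<one> \<otimes> n" using C_carrier by (simp add: subset_iff)
    then show "n \<in> ?H" using n subgroup.one_closed[OF sN] unfolding set_mult_def by blast
  qed
  have Nmult: "N #> (n \<otimes> a) = N #> a" if "n \<in> N" "a \<in> C" for n a
  proof -
    have cs: "n \<in> carrier G" "a \<in> carrier G" using that NG C_carrier by auto
    show ?thesis using quot_eq[OF N(1) m_closed[OF cs] cs(2)] that(1) cs by (simp add: m_assoc)
  qed
  have im: "(#>) N ` ?H = (#>) N ` C"
  proof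
    show "(#>) N ` ?H \<subseteq> (#>) N ` C" using Nmult by (auto simp: set_mult_def)
    show "(#>) N ` C \<subseteq> (#>) N ` ?H" using CH by blast
  qed
  obtain s where s: "card ?H = card C * s" using card_subgroup_dvd[OF C_sub sH CH] by blast
  obtain r where r: "card (carrier G) = card ?H * r" using card_subgroup_dvd_order[OF sH] by blast
  have "s * r = 2 * q" using s r card_G subgroup_card_pos[OF C_sub] by simp
  moreover have "s \<noteq> 1"
  proof
    assume "s = 1"
    then have "C = ?H" using subgroup_eq_if_card[OF C_sub sH CH] s by simp
    then show False using core N NH by blast
  qed
  moreover have "r \<noteq> 1"
  proof
    assume "r = 1"
    then have "?H = carrier G" using subgroup_eq_if_card[OF sH subgroup_self subgroup.subset[OF sH]] r by simp
    then have "N #> g \<in> (#>) N ` C" if "g \<in> carrier G" for g using im that by blast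
    then show False using c_in_normal_if_cover[OF N(1)] N(3) by blast
  qed
  ultimately have sr: "(s = 2 \<and> r = q) \<or> (s = q \<and> r = 2)" using prod_eq_twice_prime q(1) by blast
  then have pr: "prime r" using q(1) by auto
  interpret Q: two_gen "G Mod N" "N #> x" "N #> y" by (rule quot_two_gen[OF N(1)])
  have QC: "Q.C = (#>) N ` ?H" using quot_two_gen[OF N(1)] im by simp
  have "card (carrier (G Mod N)) * card N = r * (card Q.C * card N)"
    unfolding QC quot_card[OF N(1) sH NH] quot_order[OF N(1)] using r by simp
  then have "card (carrier (G Mod N)) = r * card Q.C" using subgroup_card_pos[OF sN] by simp
  then have "Q.C \<lhd> (G Mod N)" using Q.prime_index_normal[OF pr] by blast
  then have "?H \<lhd> G" using quot_normal[OF N(1) sH NH] QC by simp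
  then show ?thesis using that CH sr s r by (auto simp: mult.commute)
qed

text \<open>Squares of elements of \<open>H\<close> lie in every conjugate of \<open>C\<close>,
  hence in the trivial core. So \<open>H\<close> is a Klein four-group, and an element moving
  \<open>c\<close> permutes its three involutions nontrivially with period \<open>q\<close>, which
  leaves only \<open>q = 3\<close>.\<close>

lemma index_2_over_C:
  assumes H: "H \<lhd> G" "C \<subseteq> H" "card H = 2 * card C" "card (carrier G) = q * card H"
  shows "q = 3 \<and> ord c = 2 \<and> (\<forall>h\<in>H. h \<otimes> h = \<one>)"
proof -
  note sH = normal_imp_subgroup[OF H(1)]
  note HG = subgroup.mem_carrier[OF sH]
  let ?K = "{k \<in> carrier G. \<forall>g\<in>carrier G. cnj g k \<in> C}"
  have K1: "?K = {\<one>}" using core[OF core_normal[OF C_sub] core_subset] .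
  have sq: "h \<otimes> h = \<one>" if h: "h \<in> H" for h
  proof -
    have "cnj g (h \<otimes> h) \<in> C" if g: "g \<in> carrier G" for g
      using index2_square[OF C_sub sH H(2,3) normal_cnj[OF H(1) g h]] cnj_mult[OF g HG[OF h] HG[OF h]] by simp
    then have "h \<otimes> h \<in> ?K" using HG[OF h] by simp
    then show ?thesis using K1 by blast
  qed
  have c1: "c \<noteq> \<one>"
  proof
    assume "c = \<one>" then show False using C_nontriv by (simp add: generate_one)
  qed
  have cH: "c \<in> H" using H(2) generate_self by blast
  have "c [^] (2::nat) = \<one>" using sq[OF cH] by (simp add: numeral_2_eq_2)
  then have "ord c dvd 2" using pow_eq_id by simp
  moreover have "ord c \<noteq> 1" using c1 ord_eq_1 by simp
  ultimately have oc: "ord c = 2" using two_is_prime_nat prime_nat_iff by blast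
  then have cardH: "card H = 4" using H(3) card_C by simp
  have comm: "a \<otimes> b = b \<otimes> a" if "a \<in> H" "b \<in> H" for a b
  proof -
    have cs: "a \<in> carrier G" "b \<in> carrier G" using that HG by auto
    have "inv z = z" if "z \<in> H" for z using inv_equality[OF sq[OF that]] HG[OF that] by simp
    then have "inv (a \<otimes> b) = a \<otimes> b" "inv a = a" "inv b = b" using subgroup.m_closed[OF sH] that by auto
    then show ?thesis using inv_mult_group[OF cs] by simp
  qed
  obtain g where g: "g \<in> carrier G" "g \<notin> Nrm C" using C_not_normal normal_iff_Nrm[OF C_sub] by blast
  have gc: "cnj g c \<noteq> c"
  proof
    assume "cnj g c = c"
    then have "cnj g ` C = C" using generate_cnj[OF g(1), of c] by simp
    then show False using g by (simp add: Nrm_def)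
  qed
  let ?X = "H - {\<one>}"
  have it: "(cnj g ^^ i) h = cnj (g [^] i) h" if "h \<in> carrier G" for i :: nat and h
  proof (induction i)
    case (Suc i) then show ?case using g that
      by (simp add: cnj_cnj nat_pow_Suc2[symmetric] del: nat_pow_Suc)
  qed (use that in simp)
  have gq: "g [^] q \<in> H" using normal_index_pow[OF H(1,4) g(1)] .
  have "[card ?X = card {h \<in> ?X. cnj g h = h}] (mod q)"
  proof (rule card_fixed_cong[OF q(1)])
    show "finite ?X" using subgroup_fin[OF sH] by simp
    fix h assume h: "h \<in> ?X"
    have "cnj g h \<noteq> \<one>" using h g HG cnj_inv_cancel[of g h] cnj_one[of "inv g"] by force
    moreover have "cnj (g [^] q) h = h" using cnj_eq_iff comm[OF gq] h g HG by auto
    ultimately show "cnj g h \<in> ?X \<and> (cnj g ^^ q) h = h"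
      using h normal_cnj[OF H(1) g(1)] it HG by auto
  qed
  moreover have cX: "card ?X = 3" using cardH subgroup.one_closed[OF sH] subgroup_fin[OF sH] by simp
  moreover have "{h \<in> ?X. cnj g h = h} \<subset> ?X" using gc cH c1 by blast
  then have lt: "card {h \<in> ?X. cnj g h = h} < card ?X"
    using psubset_card_mono subgroup_fin[OF sH] by (metis finite_Diff)
  ultimately have "[3 = card {h \<in> ?X. cnj g h = h}] (mod q)" "card {h \<in> ?X. cnj g h = h} < 3" by auto
  then have "q dvd 3 - card {h \<in> ?X. cnj g h = h}"
    by (metis cong_altdef_nat less_imp_le_nat)
  then have "q \<le> 3" using \<open>card {h \<in> ?X. cnj g h = h} < 3\<close>
    by (meson diff_le_self dvd_imp_le le_trans zero_less_diff)
  then show ?thesis using q_ge_3 oc sq by simp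
qed

text \<open>If \<open>H\<close> normalizes \<open>C\<close>, then \<open>H\<close> is the abelian
  product of \<open>C\<close> and its conjugate under an outer element \<open>t\<close>, and the
  transfer to \<open>H\<close> exhibits an element outside \<open>H\<close> that normalizes
  \<open>C\<close>. Otherwise \<open>C\<close> is self-normalizing in \<open>H\<close>, and a
  subgroup centralized by \<open>c\<close> is found that does not fit into \<open>C\<close>.\<close>

lemma no_index_2_subgroup:
  assumes H: "H \<lhd> G" "C \<subseteq> H" "card H = q * card C" "card (carrier G) = 2 * card H"
  shows False
proof -
  note sH = normal_imp_subgroup[OF H(1)]
  note HG = subgroup.mem_carrier[OF sH]
  have HsubG: "H \<subseteq> carrier G" using sH by (rule subgroup.subset)
  obtain t where t: "t \<in> carrier G" "t \<notin> H"
    using H(4) subgroup_card_pos[OF sH] HsubG by (metis subset_antisym subsetI mult_2 less_add_same_cancel1 less_irrefl)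
  have extend: "carrier G \<subseteq> Nrm K" if "K \<subseteq> carrier G" "t \<in> Nrm K" "H \<subseteq> Nrm K" for K
    using prime_index_between[OF sH Nrm_subgroup[OF that(1)] subgroup_self that(3) _ H(4) two_is_prime_nat]
      that t subgroup.subset[OF Nrm_subgroup[OF that(1)]] by blast
  have tt: "t \<otimes> t \<in> H" using index2_square[OF sH subgroup_self HsubG H(4) t(1)] .
  have HtN: "H \<subseteq> Nrm (cnj t ` L)" if L: "L \<subseteq> carrier G" "H \<subseteq> Nrm L" for L
  proof -
    have "H = cnj t ` H"
      using Nrm_image[of t H] normal_iff_Nrm[OF sH] H(1) t(1) HsubG by blast
    also have "\<dots> \<subseteq> cnj t ` Nrm L" using L(2) by blast
    finally show ?thesis using Nrm_cnj[OF t(1) L(1)] by simp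
  qed
  \<comment> \<open>\<open>t\<close> exchanges \<open>L\<close> and its conjugate, because
    \<open>t \<otimes> t\<close> lies in \<open>H\<close> and normalizes \<open>L\<close>. The
    intersection is therefore normal in \<open>G\<close> and trivial as a part of the core.\<close>
  have swap: "L \<inter> cnj t ` L = {\<one>}" if L: "subgroup L G" "L \<subseteq> C" "H \<subseteq> Nrm L" for L
  proof -
    have LG: "L \<subseteq> carrier G" using L(1) by (rule subgroup.subset)
    have tL: "subgroup (cnj t ` L) G" using subgroup_cnj[OF t(1) L(1)] .
    have tLG: "cnj t ` L \<subseteq> carrier G" using tL by (rule subgroup.subset)
    have HtL: "H \<subseteq> Nrm (cnj t ` L)" using HtN[OF LG L(3)] .
    have "cnj t ` cnj t ` L = L" using Nrm_image[of "t \<otimes> t" L] tt L(3) LG t(1) cnj_image_cnj by auto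
    then have "cnj t ` (L \<inter> cnj t ` L) = L \<inter> cnj t ` L" using cnj_Int[OF t(1) LG tLG] by blast
    then have "t \<in> Nrm (L \<inter> cnj t ` L)" using t(1) by (simp add: Nrm_def)
    moreover have "H \<subseteq> Nrm (L \<inter> cnj t ` L)" using Nrm_Int L(3) HtL by blast
    ultimately have "carrier G \<subseteq> Nrm (L \<inter> cnj t ` L)" using extend[of "L \<inter> cnj t ` L"] LG by blast
    then have "L \<inter> cnj t ` L \<lhd> G" using normal_iff_Nrm[OF subgroups_Inter_pair[OF L(1) tL]] by blast
    then show ?thesis using core L(2) by blast
  qed
  have HtH: "cnj t ` H \<subseteq> H" using normal_cnj[OF H(1) t(1)] by blast
  have commute: "a \<otimes> b = b \<otimes> a"
    if AB: "subgroup A G" "subgroup B G" "A \<subseteq> H" "B \<subseteq> H" "H \<subseteq> Nrm A" "H \<subseteq> Nrm B" "A \<inter> B = {\<one>}"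
      and ab: "a \<in> A" "b \<in> B" for A B a b
  proof -
    have cs: "a \<in> carrier G" "b \<in> carrier G" using AB ab HG by auto
    have aB: "a \<in> Nrm B" and bA: "b \<in> Nrm A" using AB(3-6) ab by auto
    have "cnj a b \<otimes> inv b \<in> B"
      by (rule subgroup.m_closed[OF AB(2) NrmD[OF aB ab(2)] subgroup.m_inv_closed[OF AB(2) ab(2)]])
    moreover have "a \<otimes> cnj b (inv a) \<in> A"
      by (rule subgroup.m_closed[OF AB(1) ab(1) NrmD[OF bA subgroup.m_inv_closed[OF AB(1) ab(1)]]])
    moreover have "cnj a b \<otimes> inv b = a \<otimes> cnj b (inv a)" using cs by (simp add: cnj_def word)
    ultimately have e: "cnj a b \<otimes> inv b = \<one>" using AB(7) by auto
    have "cnj a b = cnj a b \<otimes> inv b \<otimes> b" using cs by (simp add: m_assoc)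
    then have "cnj a b = b" using e cs by simp
    then show ?thesis using cnj_eq_iff cs by simp
  qed
  show False
  proof (cases "H \<subseteq> Nrm C")
    case True
    let ?D = "cnj t ` C"
    have sD: "subgroup ?D G" using subgroup_cnj[OF t(1) C_sub] .
    have DH: "?D \<subseteq> H" using H(2) HtH by blast
    have triv: "C \<inter> ?D = {\<one>}" using swap[OF C_sub subset_refl True] .
    have ND: "H \<subseteq> Nrm ?D" using HtN[OF C_carrier True] .
    have cD: "card ?D = card C" using t(1) C_carrier by simp
    have sCD: "subgroup (C <#> ?D) G" using set_mult_Nrm_subgroup[OF C_sub sD] DH True by blast
    have CCD: "C \<subseteq> C <#> ?D"
    proof
      fix a assume a: "a \<in> C"
      then have "a = a \<otimes> \<one>" using C_carrier by (simp add: subset_iff)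
      then show "a \<in> C <#> ?D" using a subgroup.one_closed[OF sD] unfolding set_mult_def by blast
    qed
    have "C <#> ?D \<subseteq> H" using set_mult_subset_subgroup[OF sH H(2) DH] .
    moreover have "C <#> ?D \<noteq> C"
    proof
      assume "C <#> ?D = C"
      then have "card C * card C = card C" using card_set_mult_trivial_Int[OF C_sub sD triv] cD by metis
      then have "card C = 1" using subgroup_card_pos[OF C_sub] by simp
      then show False using C_nontriv one_in_C by (metis card_1_singletonE singletonD)
    qed
    ultimately have HCD: "H = C <#> ?D" using prime_index_between[OF C_sub sCD sH CCD _ H(3) q(1)] by blast
    then have "card C * card C = q * card C"
      using card_set_mult_trivial_Int[OF C_sub sD triv] cD H(3) by simp
    then have Cq: "card C = q" using subgroup_card_pos[OF C_sub] by simp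
    have cCD: "a \<otimes> b = b \<otimes> a" if "a \<in> C" "b \<in> ?D" for a b
      using commute[OF C_sub sD H(2) DH True ND triv that] .
    have gD: "?D = generate G {cnj t c}" using generate_cnj[OF t(1)] by simp
    have cDD: "a \<otimes> b = b \<otimes> a" if "a \<in> ?D" "b \<in> ?D" for a b
      using generate_comm[of "cnj t c" a b] that gD t(1) by simp
    have Hcomm: "a \<otimes> b = b \<otimes> a" if "a \<in> H" "b \<in> H" for a b
    proof -
      obtain a1 a2 where a: "a1 \<in> C" "a2 \<in> ?D" "a = a1 \<otimes> a2" using \<open>a \<in> H\<close> HCD by (auto simp: set_mult_def)
      obtain b1 b2 where b: "b1 \<in> C" "b2 \<in> ?D" "b = b1 \<otimes> b2" using \<open>b \<in> H\<close> HCD by (auto simp: set_mult_def)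
      have cs: "a1 \<in> carrier G" "a2 \<in> carrier G" "b1 \<in> carrier G" "b2 \<in> carrier G"
        using a b C_carrier subgroup.mem_carrier[OF sD] by auto
      have "a \<otimes> b = a1 \<otimes> (a2 \<otimes> b1) \<otimes> b2" using a b cs by (simp add: m_assoc)
      also have "\<dots> = (a1 \<otimes> b1) \<otimes> (a2 \<otimes> b2)" unfolding cCD[OF b(1) a(2), symmetric] using cs by (simp add: m_assoc)
      also have "\<dots> = (b1 \<otimes> a1) \<otimes> (b2 \<otimes> a2)" using C_comm[OF a(1) b(1)] cDD[OF a(2) b(2)] by simp
      also have "\<dots> = b1 \<otimes> (a1 \<otimes> b2) \<otimes> a2" using cs by (simp add: m_assoc)
      also have "\<dots> = b \<otimes> a" unfolding cCD[OF a(1) b(2)] a(3) b(3) using cs by (simp add: m_assoc)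
      finally show ?thesis .
    qed
    interpret Tr: transfer G H
      by (intro transfer.intro transversal.intro transversal_axioms.intro transfer_axioms.intro
          finite_group_axioms sH) (rule Hcomm)
    have cH: "c \<in> H" using H(2) generate_self by blast
    have T2: "card Tr.T = 2" using Tr.card_T H(4) subgroup_card_pos[OF sH] by simp
    have mem: "inv s \<otimes> c \<otimes> s \<in> H" if "s \<in> Tr.T" for s
      using normal_cnj[OF H(1) _ cH, of "inv s"] Tr.T_carrier[OF that] by (simp add: cnj_def)
    interpret PG: comm_group "G\<lparr>carrier := H\<rparr>" by (rule Tr.PG_comm)
    obtain s1 s2 where s: "Tr.T = {s1, s2}" "s1 \<noteq> s2" using T2 card_2_iff by metis
    have sG: "s1 \<in> carrier G" "s2 \<in> carrier G" using s Tr.T_carrier by auto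
    have "c [^] q = \<one>" using pow_card_subgroup[OF C_sub generate_self] Cq by simp
    moreover have "{t \<in> Tr.T. inv t \<otimes> c \<otimes> t \<in> H} = {s1, s2}" using mem s by auto
    ultimately have "Tr.V c = finprod (G\<lparr>carrier := H\<rparr>) (\<lambda>t. inv t \<otimes> c \<otimes> t) {s1, s2}"
      using Tr.V_eval[OF c_closed q(1)] by simp
    also have "\<dots> = (inv s1 \<otimes> c \<otimes> s1) \<otimes> (inv s2 \<otimes> c \<otimes> s2)"
      using PG.finprod_insert[of "{s2}" s1] PG.finprod_insert[of "{}" s2] mem s HG by simp
    finally have V: "(inv s1 \<otimes> c \<otimes> s1) \<otimes> (inv s2 \<otimes> c \<otimes> s2) = \<one>" using Tr.V_comtr by simp
    text \<open>The two conjugates of \<open>c\<close> in \<open>V\<close> are \<open>c\<close> and \<open>tct\<^sup>-\<^sup>1\<close> up to conjugation, so they are inverse to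
      each other although their powers meet trivially.\<close>
    define g where "g = s1 \<otimes> inv s2"
    have gG: "g \<in> carrier G" using sG by (simp add: g_def)
    have "cnj s1 ((inv s1 \<otimes> c \<otimes> s1) \<otimes> (inv s2 \<otimes> c \<otimes> s2)) = c \<otimes> cnj g c"
      using sG by (simp add: cnj_def g_def word)
    then have e: "c \<otimes> cnj g c = \<one>" using V sG by simp
    have "cnj g c \<otimes> c = \<one>" using e gG by (simp add: inv_comm)
    then have cg: "cnj g c = inv c" using inv_equality[of "cnj g c" c] gG by simp
    have "g \<in> Nrm C"
    proof -
      have "cnj g ` C = generate G {inv c}" using generate_cnj[OF gG c_closed] cg by simp
      also have "\<dots> \<subseteq> C" by (rule generate_subset[OF C_sub subgroup.m_inv_closed[OF C_sub generate_self]])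
      finally show ?thesis using gG by (simp add: Nrm_def)
    qed
    moreover have "g \<notin> H"
    proof
      assume "g \<in> H"
      have "inv s2 \<otimes> s1 = cnj (inv s2) g" using sG by (simp add: cnj_def g_def word)
      then have "inv s2 \<otimes> s1 \<in> H" using normal_cnj[OF H(1) _ \<open>g \<in> H\<close>, of "inv s2"] sG by simp
      then have "s1 = s2" using Tr.rep_eq_iff[of s1 s2] Tr.rep_T[of s1] s sG by simp
      then show False using s by blast
    qed
    ultimately have "carrier G \<subseteq> Nrm C"
      using prime_index_between[OF sH Nrm_subgroup[OF C_carrier] subgroup_self True _ H(4) two_is_prime_nat] 
        subgroup.subset[OF Nrm_subgroup[OF C_carrier]] by blast
    then show False using C_not_normal normal_iff_Nrm[OF C_sub] by blast
  next
    case False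
    have NCH: "a \<in> C" if "a \<in> Nrm C" "a \<in> H" for a
    proof -
      have "subgroup (Nrm C \<inter> H) G" using subgroups_Inter_pair[OF Nrm_subgroup[OF C_carrier] sH] .
      then have "Nrm C \<inter> H = C \<or> Nrm C \<inter> H = H"
        using prime_index_between[OF C_sub _ sH _ _ H(3) q(1), of "Nrm C \<inter> H"]
          subgroup_subset_Nrm[OF C_sub] H(2) by blast
      then show ?thesis using False that by blast
    qed
    obtain h where h: "h \<in> H" "h \<notin> Nrm C" using False by blast
    have hG: "h \<in> carrier G" using h HG by blast
    have hC: "h \<notin> C" using h subgroup_subset_Nrm[OF C_sub] by blast
    let ?D = "cnj h ` C"
    let ?L = "C \<inter> ?D"
    have sD: "subgroup ?D G" using subgroup_cnj[OF hG C_sub] .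
    have DH: "?D \<subseteq> H" using h(1) H(2) subgroup_subset_Nrm[OF sH] by (auto simp: Nrm_def)
    have Dcomm: "a \<otimes> b = b \<otimes> a" if "a \<in> ?D" "b \<in> ?D" for a b
      using generate_comm[of "cnj h c" a b] that generate_cnj[OF hG c_closed] hG by simp
    have LG: "?L \<subseteq> carrier G" using C_carrier by blast
    have sL: "subgroup ?L G" using subgroups_Inter_pair[OF C_sub sD] .
    have NL: "H \<subseteq> Nrm ?L"
    proof (rule Nrm_prime_index[OF C_sub sH H(3) q(1) H(2) LG _ _ DH])
      show "C \<subseteq> Nrm ?L" using C_comm by (intro comm_subset_Nrm[OF LG C_carrier]) blast
      show "?D \<subseteq> Nrm ?L" using Dcomm by (intro comm_subset_Nrm[OF LG subgroup.subset[OF sD]]) blast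
      show "\<not> ?D \<subseteq> C" using h hG by (auto simp: Nrm_def)
    qed
    show False
    proof (cases "?L = {\<one>}")
      case True
      \<comment> \<open>The count from the case of prime index, now inside \<open>H\<close>.\<close>
      have "card C * card C < q * card C"
        using card_prod_less_cnj[OF C_sub C_sub sH _ H(2) h(1) hC True] H(3) by simp
      then have mq: "card C < q" by simp
      obtain Q where Q: "subgroup Q G" "Q \<subseteq> H" "card Q = q" "Q \<lhd> G"
        using exists_normal_prime_subgroup[OF H(1,3) mq q(1)] by blast
      have "Q \<noteq> {\<one>}" using Q q by auto
      then obtain z where z: "z \<in> Q" "z \<noteq> \<one>" using subgroup.one_closed[OF Q(1)] by blast
      have Qz: "Q = generate G {z}" using prime_subgroup_generated[OF Q(1) _ z] Q q by simp
      have "Q \<subseteq> Nrm C"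
        using c_centralizes_imp_Nrm_C[OF subgroup.subset[OF Q(1)]]
          c_centralizes_cyclic_normal[of z] Qz Q subgroup.mem_carrier[OF Q(1) z(1)] by simp
      then have "Q \<subseteq> C" using NCH Q(2) by blast
      then show False using card_mono[OF subgroup_fin[OF C_sub]] Q(3) mq by (metis not_less)
    next
      case LN: False
      let ?E = "cnj t ` ?L"
      have sE: "subgroup ?E G" using subgroup_cnj[OF t(1) sL] .
      have EG: "?E \<subseteq> carrier G" using sE by (rule subgroup.subset)
      have EH: "?E \<subseteq> H" using HtH H(2) by blast
      have NE: "H \<subseteq> Nrm ?E" using HtN[OF LG NL] .
      have triv: "?L \<inter> ?E = {\<one>}" using swap[OF sL _ NL] by blast
      \<comment> \<open>Inside \<open>C\<close>, the group \<open>?E\<close> would also lie in the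
        conjugate \<open>?D\<close>, since \<open>h\<close> normalizes it; then it would lie in
        \<open>?L\<close>, which it meets trivially.\<close>
      have nEC: "\<not> ?E \<subseteq> C"
      proof
        assume EC: "?E \<subseteq> C"
        have "?E = cnj h ` ?E" using Nrm_image[of h ?E] NE h(1) EG by blast
        then have "?E \<subseteq> ?D" using EC by blast
        then have "?E \<subseteq> ?L" using EC by blast
        then have "?E = {\<one>}" using triv by blast
        then have "card ?L = 1" using card_cnj[OF t(1) LG] by simp
        then show False using LN subgroup.one_closed[OF sL] by (metis card_1_singletonE singletonD)
      qed
      have LH: "?L \<subseteq> H" using H(2) by blast
      \<comment> \<open>\<open>C\<close> is maximal in \<open>H\<close> and does not contain
        \<open>?E\<close>, so the two together generate \<open>H\<close>.\<close>
      have span: "H \<subseteq> M" if "subgroup M G" "C \<subseteq> M" "?E \<subseteq> M" for M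
      proof -
        have "M \<inter> H = C \<or> M \<inter> H = H"
          using prime_index_between[OF C_sub subgroups_Inter_pair[OF that(1) sH] sH _ _ H(3) q(1)] that H(2) by blast
        then show ?thesis using nEC that EH by blast
      qed
      have cenL: "a \<otimes> l = l \<otimes> a" if "a \<in> H" "l \<in> ?L" for a l
      proof -
        have "H \<subseteq> {g \<in> carrier G. \<forall>a\<in>?L. g \<otimes> a = a \<otimes> g}"
        proof (rule span[OF centralizer_subgroup[OF LG]])
          show "C \<subseteq> {g \<in> carrier G. \<forall>a\<in>?L. g \<otimes> a = a \<otimes> g}" using C_comm C_carrier by blast
          show "?E \<subseteq> {g \<in> carrier G. \<forall>a\<in>?L. g \<otimes> a = a \<otimes> g}"
            using commute[OF sL sE LH EH NL NE triv] EG by (auto 0 3 simp: subset_iff)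
        qed
        then show ?thesis using that by blast
      qed
      \<comment> \<open>\<open>?L\<close> is central in \<open>H\<close>. Conjugation by
        \<open>t\<close> carries this over to \<open>?E\<close>, so \<open>c\<close> in particular
        centralizes \<open>?E\<close>.\<close>
      have "?E \<subseteq> Nrm C"
      proof (rule c_centralizes_imp_Nrm_C[OF EG])
        fix e assume "e \<in> ?E"
        then obtain l where l: "l \<in> ?L" "e = cnj t l" by blast
        have lG: "l \<in> carrier G" using l LG by blast
        have "cnj (inv t) c \<in> H" using normal_cnj[OF H(1)] H(2) generate_self[of c] t(1) by blast
        then have "cnj (inv t) c \<otimes> l = l \<otimes> cnj (inv t) c" using cenL l by blast
        then have "cnj t (cnj (inv t) c \<otimes> l) = cnj t (l \<otimes> cnj (inv t) c)" by simp
        then show "c \<otimes> e = e \<otimes> c" using l lG t(1) by (simp add: cnj_mult)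
      qed
      then show False using NCH EH nEC by blast
    qed
  qed
qed

lemma gen_cnj: "g \<in> carrier G \<Longrightarrow> cnj g ` C = generate G {cnj g c}"
  using generate_cnj[of g c] by simp

lemma cnj_C_comm:
  assumes "g \<in> carrier G" "a \<in> cnj g ` C" "b \<in> cnj g ` C" shows "a \<otimes> b = b \<otimes> a"
  using generate_comm[of "cnj g c" a b] assms gen_cnj by simp

lemma prime_subgroup_not_normal:
  assumes Q: "subgroup Q G" "card Q = q" and N: "\<not> Q \<subseteq> Nrm C" shows "\<not> Q \<lhd> G"
proof
  assume n: "Q \<lhd> G"
  have "Q \<noteq> {\<one>}" using Q q by auto
  then obtain z where z: "z \<in> Q" "z \<noteq> \<one>" using subgroup.one_closed[OF Q(1)] by blast
  have Qz: "Q = generate G {z}" using prime_subgroup_generated[OF Q(1) _ z] Q q by simp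
  have "Q \<subseteq> Nrm C"
    using c_centralizes_imp_Nrm_C[OF subgroup.subset[OF Q(1)]]
      c_centralizes_cyclic_normal[of z] Qz n subgroup.mem_carrier[OF Q(1) z(1)] by simp
  then show False using N by blast
qed

lemma card_conjugates_ge:
  assumes Q: "subgroup Q G" "card Q = q" "\<not> q ^ 2 dvd card (carrier G)" and n: "\<not> Q \<lhd> G"
  shows "card ((\<lambda>g. cnj g ` Q) ` carrier G) \<ge> q + 1"
proof -
  let ?X = "(\<lambda>g. cnj g ` Q) ` carrier G"
  have QG: "Q \<subseteq> carrier G" using Q(1) by (rule subgroup.subset)
  obtain g where g: "g \<in> carrier G" "g \<notin> Nrm Q" using n normal_iff_Nrm[OF Q(1)] by blast
  then have "cnj g ` Q \<noteq> Q" by (auto simp: Nrm_def)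
  moreover have "{Q, cnj g ` Q} \<subseteq> ?X" using g cnj_image_one[OF QG] by (auto simp: image_iff)
  then have "card {Q, cnj g ` Q} \<le> card ?X" using fin by (intro card_mono) auto
  ultimately have ge: "card ?X \<ge> 2" by simp
  have "q dvd card ?X - 1"
    using card_conjugates_prime_subgroup[OF Q(1,2) q(1) Q(3)] ge by (simp add: cong_altdef_nat)
  then have "q \<le> card ?X - 1" using ge by (intro dvd_imp_le) auto
  then show ?thesis using ge by linarith
qed

text \<open>A maximal \<open>C\<close> would be self-normalizing, with \<open>2 * q\<close>
  conjugates meeting pairwise trivially, and there would be at least \<open>q + 1\<close> subgroups
  of order \<open>q\<close>. With \<open>m = card C\<close>, these have at least
  \<open>(q + 1) * (q - 1) + 2 * q * (m - 1)\<close> nontrivial elements, more than the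
  \<open>2 * q * m - 1\<close> available, because \<open>q ^ 2 > 2 * q\<close>.\<close>

lemma C_not_maximal:
  obtains M where "subgroup M G" "C \<subseteq> M" "M \<noteq> C" "M \<noteq> carrier G"
proof (rule ccontr)
  note witness = that
  assume "\<not> thesis"
  then have max: "M = C \<or> M = carrier G" if "subgroup M G" "C \<subseteq> M" for M
    using witness[OF that] by blast
  have NC: "Nrm C = C"
    using max[OF Nrm_subgroup[OF C_carrier] subgroup_subset_Nrm[OF C_sub]] C_not_normal
      normal_iff_Nrm[OF C_sub] by blast
  have triv: "C \<inter> cnj g ` C = {\<one>}" if g: "g \<in> carrier G" "g \<notin> C" for g
  proof -
    have sD: "subgroup (cnj g ` C) G" using subgroup_cnj[OF g(1) C_sub] .
    have DG: "cnj g ` C \<subseteq> carrier G" using sD by (rule subgroup.subset)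
    have IG: "C \<inter> cnj g ` C \<subseteq> carrier G" using C_carrier by blast
    have a: "C \<subseteq> Nrm (C \<inter> cnj g ` C)"
      by (intro comm_subset_Nrm[OF IG C_carrier]) (use C_comm in blast)
    have b: "cnj g ` C \<subseteq> Nrm (C \<inter> cnj g ` C)"
      by (intro comm_subset_Nrm[OF IG DG]) (use cnj_C_comm[OF g(1)] in blast)
    have "\<not> cnj g ` C \<subseteq> C" using g NC by (auto simp: Nrm_def)
    then have "Nrm (C \<inter> cnj g ` C) = carrier G" using max[OF Nrm_subgroup[OF IG] a] b by blast
    then show ?thesis using normal_Int_trivial[OF sD] by blast
  qed
  define m where "m = card C"
  have m0: "m > 0" unfolding m_def by (rule subgroup_card_pos[OF C_sub])
  have m1: "m \<noteq> 1" unfolding m_def using C_nontriv one_in_C by (metis card_1_singletonE singletonD)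
  obtain g where g: "g \<in> carrier G" "g \<notin> C" using C_not_normal NC normal_iff_Nrm[OF C_sub] by blast
  have "m * m < 2 * q * m"
    using card_prod_less_cnj[OF C_sub C_sub subgroup_self _ C_carrier g triv[OF g]] card_G by (simp add: m_def)
  then have m2q: "m < 2 * q" by simp
  let ?Y = "(\<lambda>g. cnj g ` C) ` carrier G"
  have cY: "card ?Y = 2 * q" using card_conjugates[OF C_carrier] NC card_G m0 by (simp add: m_def)
  have Ydisj: "A \<inter> B = {\<one>}" if AB: "A \<in> ?Y" "B \<in> ?Y" "A \<noteq> B" for A B
  proof -
    obtain a b where ab: "a \<in> carrier G" "A = cnj a ` C" "b \<in> carrier G" "B = cnj b ` C" using AB by blast
    have BG: "B \<subseteq> carrier G" using ab cnj_subset C_carrier by blast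
    have iB: "cnj (inv a) ` B = cnj (inv a \<otimes> b) ` C" using ab C_carrier by (simp add: cnj_image_cnj)
    have "inv a \<otimes> b \<notin> C"
    proof
      assume "inv a \<otimes> b \<in> C"
      then have "cnj (inv a) ` B = C" using iB NC Nrm_image[OF _ C_carrier] by simp
      then have "cnj a ` cnj (inv a) ` B = A" using ab by simp
      then show False using AB ab BG by (simp add: cnj_image_cnj cnj_image_one)
    qed
    then have "C \<inter> cnj (inv a) ` B = {\<one>}" using triv[of "inv a \<otimes> b"] ab iB by simp
    then have "cnj a ` (C \<inter> cnj (inv a) ` B) = {\<one>}" using ab by simp
    moreover have "cnj a ` cnj (inv a) ` B = B" using ab BG by (simp add: cnj_image_cnj cnj_image_one)
    ultimately show ?thesis using cnj_Int[OF ab(1) C_carrier, of "cnj (inv a) ` B"] ab cnj_subset[OF _ BG, of "inv a"]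
      by simp
  qed
  \<comment> \<open>The two families of subgroups are disjoint only if \<open>q\<close> does not
    divide \<open>m\<close>. As \<open>m < 2 * q\<close>, the alternative is \<open>m = q\<close>;
    then \<open>c\<close> permutes the \<open>2 * q\<close> conjugates of \<open>C\<close> with
    period \<open>q\<close> and fixes only \<open>C\<close>, although \<open>2 * q\<close> is not 1
    modulo \<open>q\<close>.\<close>
  have nqm: "\<not> q dvd m"
  proof
    assume "q dvd m"
    then obtain k where "m = q * k" by blast
    then have mq: "m = q" using m2q m0 by (cases k; cases "k - 1") auto
    have cq: "c [^] q = \<one>" using pow_card_subgroup[OF C_sub generate_self] mq by (simp add: m_def)
    have it: "((`) (cnj c) ^^ i) R = cnj (c [^] i) ` R" if "R \<subseteq> carrier G" for i R
    proof (induction i)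
      case 0 then show ?case using cnj_image_one[OF that] by simp
    next
      case (Suc i)
      then show ?case using that by (simp add: cnj_image_cnj nat_pow_Suc2[symmetric] del: nat_pow_Suc)
    qed
    have "[card ?Y = card {R \<in> ?Y. cnj c ` R = R}] (mod q)"
    proof (rule card_fixed_cong[OF q(1)])
      show "finite ?Y" using fin by simp
      fix R assume R: "R \<in> ?Y"
      then obtain g where g: "g \<in> carrier G" "R = cnj g ` C" by blast
      have RG: "R \<subseteq> carrier G" using g cnj_subset C_carrier by blast
      have "cnj c ` R = cnj (c \<otimes> g) ` C" using g C_carrier cnj_image_cnj by simp
      moreover have "c \<otimes> g \<in> carrier G" using g by simp
      ultimately have "cnj c ` R \<in> ?Y" by blast
      moreover have "((`) (cnj c) ^^ q) R = R" using it[OF RG, of q] cq cnj_image_one[OF RG] by simp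
      ultimately show "cnj c ` R \<in> ?Y \<and> ((`) (cnj c) ^^ q) R = R" by blast
    qed
    moreover have "{R \<in> ?Y. cnj c ` R = R} = {C}"
    proof -
      have CY: "C \<in> ?Y" using cnj_image_one[OF C_carrier] by (metis imageI one_closed)
      have "cnj c ` C = C" using Nrm_image[OF _ C_carrier] NC generate_self by blast
      moreover have "R = C" if R: "R \<in> ?Y" "cnj c ` R = R" for R
      proof (rule ccontr)
        assume "R \<noteq> C"
        then have RC: "R \<inter> C = {\<one>}" using Ydisj[OF R(1) CY] by blast
        obtain g where g: "g \<in> carrier G" "R = cnj g ` C" using R by blast
        have "c \<in> Nrm R" using R(2) by (simp add: Nrm_def)
        then have "c \<in> R" using Nrm_cnj[OF g(1) C_carrier] NC g by simp
        then have "c = \<one>" using RC generate_self[of c] by blast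
        then show False using C_nontriv by (simp add: generate_one)
      qed
      ultimately show ?thesis using CY by blast
    qed
    ultimately have "[2 * q = 1] (mod q)" using cY by simp
    then have "q dvd 1" by (metis cong_dvd_iff dvd_triv_right)
    then show False using q(1) not_prime_unit by blast
  qed
  have nq2: "\<not> q ^ 2 dvd card (carrier G)"
  proof
    assume "q ^ 2 dvd card (carrier G)"
    then have "q * q dvd q * (2 * m)" using card_G by (simp add: m_def power2_eq_square ac_simps)
    then have "q dvd 2 * m" using q(1) by (simp add: prime_gt_0_nat)
    then have "q dvd 2" using nqm q(1) prime_dvd_mult_iff by blast
    then show False using q_ge_3 by (auto dest: dvd_imp_le)
  qed
  obtain Q where Q: "subgroup Q G" "card Q = q"
    using cauchy_subgroup[OF subgroup_self q(1)] card_G by (metis dvd_triv_right dvd_mult2)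
  have QG: "Q \<subseteq> carrier G" using Q(1) by (rule subgroup.subset)
  have "\<not> Q \<subseteq> Nrm C" using card_subgroup_dvd[OF Q(1) C_sub] NC Q nqm by (auto simp: m_def)
  then have Qn: "\<not> Q \<lhd> G" using prime_subgroup_not_normal[OF Q] by blast
  let ?X = "(\<lambda>g. cnj g ` Q) ` carrier G"
  have X: "card ?X \<ge> q + 1" using card_conjugates_ge[OF Q nq2 Qn] .
  have Xs: "subgroup R G \<and> card R = q" if "R \<in> ?X" for R
    using that subgroup_cnj[OF _ Q(1)] Q(2) QG by auto
  have Ys: "subgroup R G \<and> card R = m" if "R \<in> ?Y" for R
    using that subgroup_cnj[OF _ C_sub] C_carrier by (auto simp: m_def)
  have XY: "?X \<inter> ?Y = {}" using Xs Ys nqm by fastforce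
  have disj: "A \<inter> B = {\<one>}" if AB: "A \<in> ?X \<union> ?Y" "B \<in> ?X \<union> ?Y" "A \<noteq> B" for A B
  proof -
    have mixed: "A \<inter> B = {\<one>}" if "A \<in> ?X" "B \<in> ?Y" for A B
    proof -
      have "z = \<one>" if "z \<in> A" "z \<in> B" for z
      proof (rule ccontr)
        assume "z \<noteq> \<one>"
        then have "ord z = q" using prime_subgroup_generated(2)[of A z] Xs \<open>A \<in> ?X\<close> that q by auto
        then show False using ord_dvd_card_subgroup[of B z] Ys \<open>B \<in> ?Y\<close> that nqm by auto
      qed
      moreover have "\<one> \<in> A" "\<one> \<in> B"
        using Xs[OF that(1)] Ys[OF that(2)] subgroup.one_closed by auto
      ultimately show ?thesis by blast
    qed
    have "A \<inter> B = {\<one>}" if "A \<in> ?X" "B \<in> ?X"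
      using prime_subgroups_Int[of A B] Xs[OF that(1)] Xs[OF that(2)] q(1) AB(3) by simp
    moreover have "A \<inter> B = {\<one>}" if "A \<in> ?Y" "B \<in> ?X"
      using mixed[OF that(2,1)] by (simp add: Int_commute)
    ultimately show ?thesis using AB(1,2) mixed Ydisj[OF _ _ AB(3)] by (elim UnE) simp_all
  qed
  have "card (\<Union>(?X \<union> ?Y) - {\<one>}) = (\<Sum>A\<in>?X \<union> ?Y. card A - 1)"
    by (rule card_Union_trivial_Int) (use fin Xs Ys disj in auto)
  also have "\<dots> = (\<Sum>A\<in>?X. card A - 1) + (\<Sum>A\<in>?Y. card A - 1)"
    using XY fin by (intro sum.union_disjoint) auto
  also have "\<dots> = card ?X * (q - 1) + 2 * q * (m - 1)" using Xs Ys cY by simp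
  finally have "card ?X * (q - 1) + 2 * q * (m - 1) = card (\<Union>(?X \<union> ?Y) - {\<one>})" by simp
  also have "\<dots> \<le> card (carrier G - {\<one>})"
  proof (rule card_mono)
    have "R \<subseteq> carrier G" if "R \<in> ?X \<union> ?Y" for R
      using Xs[of R] Ys[of R] that subgroup.subset[of R G] by blast
    then show "\<Union>(?X \<union> ?Y) - {\<one>} \<subseteq> carrier G - {\<one>}" by blast
  qed (use fin in simp)
  also have "\<dots> = 2 * q * m - 1" using card_G fin by (simp add: m_def)
  finally have le: "card ?X * (q - 1) + 2 * q * (m - 1) \<le> 2 * q * m - 1" .
  obtain q' where q': "q = q' + 3" using q_ge_3 by (metis le_add_diff_inverse2)
  obtain m' where m': "m = m' + 1" using m0 by (metis Suc_eq_plus1 gr0_implies_Suc)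
  have "(q + 1) * (q - 1) \<le> card ?X * (q - 1)" using X by (rule mult_le_mono1)
  then show False using le unfolding q' m' by (simp add: algebra_simps)
qed

text \<open>A subgroup \<open>M\<close> strictly between \<open>C\<close> and \<open>G\<close> has
  index \<open>q\<close>, as index 2 would make it normal, and is the normalizer of
  \<open>C\<close>. Some conjugate of \<open>M\<close> meets \<open>C\<close> trivially, whence
  \<open>card C < q\<close>. This pins the number of subgroups of order \<open>q\<close> to
  \<open>2 * card C\<close>, and their nontrivial elements fill the complement of \<open>M\<close>;
  as a complement of a conjugation-invariant set, \<open>M\<close> would be normal.\<close>

lemma not_simple:
  obtains N where "N \<lhd> G" "N \<noteq> {\<one>}" "N \<noteq> carrier G"
proof (rule ccontr)
  note witness = that
  assume "\<not> thesis"
  then have simple: "N = {\<one>} \<or> N = carrier G" if "N \<lhd> G" for N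
    using witness[OF that] by blast
  obtain M where M: "subgroup M G" "C \<subseteq> M" "M \<noteq> C" "M \<noteq> carrier G" using C_not_maximal .
  have MG: "M \<subseteq> carrier G" using M(1) by (rule subgroup.subset)
  have Mnn: "\<not> M \<lhd> G" using simple[of M] M C_nontriv one_in_C by blast
  define a where "a = card C"
  have a0: "a > 0" unfolding a_def by (rule subgroup_card_pos[OF C_sub])
  obtain s where s: "card M = card C * s" using card_subgroup_dvd[OF C_sub M(1,2)] by blast
  obtain r where r: "card (carrier G) = card M * r" using card_subgroup_dvd_order[OF M(1)] by blast
  have "s * r = 2 * q" using s r card_G a0 by (simp add: a_def)
  moreover have "s \<noteq> 1" using subgroup_eq_if_card[OF C_sub M(1,2)] s M(3) by auto
  moreover have "r \<noteq> 1" using subgroup_eq_if_card[OF M(1) subgroup_self MG] r M(4) by auto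
  ultimately have "(s = 2 \<and> r = q) \<or> (s = q \<and> r = 2)" using prod_eq_twice_prime q(1) by blast
  moreover have "r \<noteq> 2"
  proof
    assume "r = 2"
    then have "carrier G \<subseteq> Nrm M" using index2_Nrm[OF M(1) subgroup_self MG] r by simp
    then show False using Mnn normal_iff_Nrm[OF M(1)] by blast
  qed
  ultimately have s2: "s = 2" and rq: "r = q" by auto
  have cM: "card M = 2 * card C" using s s2 by simp
  have cGM: "card (carrier G) = q * card M" using r rq by simp
  have maxM: "A = M \<or> A = carrier G" if "subgroup A G" "M \<subseteq> A" for A
    using prime_index_between[OF M(1) that(1) subgroup_self that(2) subgroup.subset[OF that(1)] cGM q(1)] .
  have MNC: "M \<subseteq> Nrm C" using index2_Nrm[OF C_sub M(1,2) cM] .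
  have NM: "Nrm M = M"
    using maxM[OF Nrm_subgroup[OF MG] subgroup_subset_Nrm[OF M(1)]] Mnn normal_iff_Nrm[OF M(1)] by blast
  have NC: "Nrm C = M"
    using maxM[OF Nrm_subgroup[OF C_carrier] MNC] C_not_normal normal_iff_Nrm[OF C_sub] by blast
  have triv: "C \<inter> cnj g ` C = {\<one>}" if g: "g \<in> carrier G" "g \<notin> M" for g
  proof -
    have sD: "subgroup (cnj g ` C) G" using subgroup_cnj[OF g(1) C_sub] .
    have sI: "subgroup (C \<inter> cnj g ` C) G" using subgroups_Inter_pair[OF C_sub sD] .
    have IG: "C \<inter> cnj g ` C \<subseteq> carrier G" using C_carrier by blast
    have a: "M \<subseteq> Nrm (C \<inter> cnj g ` C)" using cyclic_subgroup_Nrm[OF c_closed sI] MNC by blast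
    have "cnj g ` M = Nrm (cnj g ` C)" using Nrm_cnj[OF g(1) C_carrier] NC by simp
    also have "\<dots> \<subseteq> Nrm (C \<inter> cnj g ` C)"
      using cyclic_subgroup_Nrm[of "cnj g c" "C \<inter> cnj g ` C"] sI gen_cnj[OF g(1)] g(1) by simp
    finally have b: "cnj g ` M \<subseteq> Nrm (C \<inter> cnj g ` C)" .
    have "\<not> cnj g ` M \<subseteq> M" using g NM by (auto simp: Nrm_def)
    then have "Nrm (C \<inter> cnj g ` C) = carrier G" using maxM[OF Nrm_subgroup[OF IG] a] b by blast
    then show ?thesis using normal_Int_trivial[OF sD] by blast
  qed
  text \<open>If \<open>C\<close> met every conjugate of \<open>M\<close>, its unique involution would lie in the core of \<open>M\<close>.\<close>
  have "\<exists>g\<in>carrier G. g \<notin> M \<and> C \<inter> cnj g ` M = {\<one>}"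
  proof (rule ccontr)
    assume n: "\<not> (\<exists>g\<in>carrier G. g \<notin> M \<and> C \<inter> cnj g ` M = {\<one>})"
    let ?z = "c [^] (ord c div 2)"
    have inv: "?z \<in> cnj g ` M \<and> ?z \<noteq> \<one>" if g: "g \<in> carrier G" "g \<notin> M" for g
    proof -
      have sM: "subgroup (cnj g ` M) G" using subgroup_cnj[OF g(1) M(1)] .
      obtain k where k: "k \<in> C" "k \<in> cnj g ` M" "k \<noteq> \<one>"
        using n g one_in_C subgroup.one_closed[OF sM] by blast
      have "k \<otimes> k \<in> cnj g ` C"
      proof -
        obtain l where l: "l \<in> M" "k = cnj g l" using k by blast
        then have "k \<otimes> k = cnj g (l \<otimes> l)" using g MG by (auto simp: cnj_mult)
        then show ?thesis using index2_square[OF C_sub M(1,2) cM l(1)] by blast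
      qed
      moreover have "k \<otimes> k \<in> C" using subgroup.m_closed[OF C_sub k(1) k(1)] .
      ultimately have kk: "k \<otimes> k = \<one>" using triv[OF g] by blast
      obtain i0 where i0: "k = c [^] (i0::nat)" using generateE[OF c_closed k(1)] .
      define i where "i = i0 mod ord c"
      have "k = c [^] (ord c * (i0 div ord c) + i0 mod ord c)" using i0 by simp
      also have "\<dots> = c [^] i"
        unfolding i_def nat_pow_mult[OF c_closed, symmetric] nat_pow_pow[OF c_closed, symmetric] by simp
      finally have i: "k = c [^] i" "i < ord c" by (simp_all add: i_def ord_pos)
      have "c [^] (i + i) = \<one>" using kk i by (simp add: nat_pow_mult)
      then have "ord c dvd 2 * i" using pow_eq_id[OF c_closed, of "i + i"] by (simp add: mult_2)
      moreover have "i \<noteq> 0" using i(1) k(3) by (metis nat_pow_0)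
      moreover obtain e where e: "2 * i = ord c * e" using calculation(1) by blast
      have "ord c * e < ord c * 2" using i(2) e by linarith
      then have "e < 2" by simp
      ultimately have "2 * i = ord c" using e by (cases e) auto
      then have "i = ord c div 2" by linarith
      then show ?thesis using i k by simp
    qed
    have zC: "?z \<in> C" using pow_in_generate by simp
    have zG: "?z \<in> carrier G" by simp
    let ?K = "{k \<in> carrier G. \<forall>g\<in>carrier G. cnj g k \<in> M}"
    have "cnj g ?z \<in> M" if g: "g \<in> carrier G" for g
    proof (cases "g \<in> M")
      case True
      then show ?thesis using NrmD[of g C ?z] MNC zC M(2) by blast
    next
      case False
      have ig: "inv g \<in> carrier G" "inv g \<notin> M"
        using g False subgroup.m_inv_closed[OF M(1), of "inv g"] by auto
      then have "?z \<in> cnj (inv g) ` M" using inv by blast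
      then show ?thesis using mem_cnj_image[OF ig(1) MG zG] g by simp
    qed
    then have zK: "?z \<in> ?K" by simp
    obtain g where "g \<in> carrier G" "g \<notin> M" using M(4) MG by blast
    then have "?K \<noteq> {\<one>}" using inv zK by blast
    moreover have "?K \<noteq> carrier G" using core_subset[of M] M(4) MG by blast
    ultimately show False using simple[OF core_normal[OF M(1)]] by blast
  qed
  then obtain g where g: "g \<in> carrier G" "g \<notin> M" "C \<inter> cnj g ` M = {\<one>}" by blast
  have "a * (2 * a) < q * (2 * a)"
    using card_prod_less_cnj[OF C_sub M(1) subgroup_self M(2) MG g] cM cGM by (simp add: a_def)
  then have aq: "a < q" by simp
  have nq: "\<not> q dvd 2 * a"
    using q(1) q_ge_3 aq a0 by (auto simp: prime_dvd_mult_iff dest: dvd_imp_le)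
  have cG: "card (carrier G) = q * (2 * a)" using cGM cM by (simp add: a_def)
  have nq2: "\<not> q ^ 2 dvd card (carrier G)"
    using nq q(1) unfolding cG by (simp add: power2_eq_square prime_gt_0_nat)
  obtain Q where Q: "subgroup Q G" "card Q = q"
    using cauchy_subgroup[OF subgroup_self q(1)] cG by auto
  have QG: "Q \<subseteq> carrier G" using Q(1) by (rule subgroup.subset)
  have "\<not> Q \<subseteq> Nrm C" using card_subgroup_dvd[OF Q(1) M(1)] NC Q nq cM by (auto simp: a_def)
  then have Qn: "\<not> Q \<lhd> G" using prime_subgroup_not_normal[OF Q] by blast
  let ?X = "(\<lambda>g. cnj g ` Q) ` carrier G"
  have X: "card ?X \<ge> q + 1" using card_conjugates_ge[OF Q nq2 Qn] .
  have Xs: "subgroup R G \<and> card R = q" if "R \<in> ?X" for R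
    using that subgroup_cnj[OF _ Q(1)] Q(2) QG by auto
  have "card ?X dvd q * (2 * a)" using card_conjugates[OF QG] cG by (metis dvd_triv_left)
  moreover have "coprime (card ?X) q"
    using card_conjugates_prime_subgroup[OF Q q(1) nq2]
    by (metis cong_imp_coprime coprime_1_left cong_sym)
  ultimately have "card ?X dvd 2 * a" using coprime_dvd_mult_right_iff by blast
  then obtain b where b: "2 * a = card ?X * b" by blast
  \<comment> \<open>A proper divisor of \<open>2 * a\<close> is at most \<open>a\<close>, which is
    below \<open>q\<close>, while there are more than \<open>q\<close> conjugates.\<close>
  have "b = 1"
  proof (rule ccontr)
    assume "b \<noteq> 1"
    then have "b \<ge> 2" using b a0 by (cases b) auto
    then have "card ?X * 2 \<le> 2 * a" using b by simp
    then show False using X aq by linarith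
  qed
  then have cX: "card ?X = 2 * a" using b by simp
  let ?E = "\<Union>?X - {\<one>}"
  have "card ?E = (\<Sum>A\<in>?X. card A - 1)"
    by (rule card_Union_trivial_Int) (use fin Xs q prime_subgroups_Int in auto)
  then have cE: "card ?E = 2 * a * (q - 1)" using Xs cX by simp
  have "R \<subseteq> carrier G" if "R \<in> ?X" for R using Xs[OF that] subgroup.subset[of R G] by blast
  then have EG: "?E \<subseteq> carrier G" by blast
  have EM: "?E \<inter> M = {}"
  proof (rule ccontr)
    assume "?E \<inter> M \<noteq> {}"
    then obtain z R where z: "R \<in> ?X" "z \<in> R" "z \<noteq> \<one>" "z \<in> M" by blast
    then have "ord z = q" using prime_subgroup_generated(2)[of R z] Xs q by auto
    then show False using ord_dvd_card_subgroup[OF M(1) z(4)] nq cM by (simp add: a_def)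
  qed
  have "card (carrier G - ?E) = card M"
    using card_Diff_subset[OF finite_subset[OF EG fin] EG] cE cG cM q_ge_3
    by (simp add: a_def algebra_simps diff_mult_distrib2)
  then have ME: "M = carrier G - ?E"
  proof -
    have "M \<subseteq> carrier G - ?E" using MG EM by blast
    moreover have "finite (carrier G - ?E)" using fin by blast
    ultimately show ?thesis using card_subset_eq \<open>card (carrier G - ?E) = card M\<close> by metis
  qed
  have "h \<in> Nrm M" if h: "h \<in> carrier G" for h
  proof (rule NrmI[OF h], rule ccontr)
    fix k assume k: "k \<in> M" "cnj h k \<notin> M"
    have kG: "k \<in> carrier G" using k MG by blast
    then obtain g where g: "g \<in> carrier G" "cnj h k \<in> cnj g ` Q" "cnj h k \<noteq> \<one>" using k ME h by auto
    have "k = cnj (inv h) (cnj h k)" using h kG by simp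
    then have "k \<in> cnj (inv h \<otimes> g) ` Q" using g h QG cnj_image_cnj[of "inv h" g Q] by (metis imageI inv_closed)
    moreover have "k \<noteq> \<one>" using g h by auto
    moreover have "inv h \<otimes> g \<in> carrier G" using g h by simp
    ultimately have "k \<in> ?E" by blast
    then show False using k EM by blast
  qed
  then show False using Mnn normal_iff_Nrm[OF M(1)] by blast
qed

theorem core_free_structure:
  obtains H where "H \<lhd> G" "C \<subseteq> H" "card H = 2 * card C" "card (carrier G) = q * card H"
    "q = 3" "ord c = 2" "\<And>h. h \<in> H \<Longrightarrow> h \<otimes> h = \<one>"
proof -
  obtain N where N: "N \<lhd> G" "N \<noteq> {\<one>}" "N \<noteq> carrier G" using not_simple .
  show ?thesis
  proof (rule intermediate_normal_subgroup[OF N])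
    fix H assume "H \<lhd> G" "C \<subseteq> H" "card H = q * card C" "card (carrier G) = 2 * card H"
    from no_index_2_subgroup[OF this] show ?thesis ..
  next
    fix H assume H: "H \<lhd> G" "C \<subseteq> H" "card H = 2 * card C" "card (carrier G) = q * card H"
    from that[OF H] index_2_over_C[OF H] show ?thesis by blast
  qed
qed

end

section \<open>Index twice an odd prime when \<open>c\<close> has even order\<close>

context finite_group
begin

text \<open>This is the preimage of the centralizer of the image of \<open>a\<close> in the quotient
  by \<open>M\<close>.\<close>

lemma commute_mod_normal_subgroup:
  assumes M: "M \<lhd> G" and a: "a \<in> carrier G"
  shows "subgroup {h \<in> carrier G. cnj h a \<otimes> inv a \<in> M} G" (is "subgroup ?D G")
proof (rule subgroupI)
  note sM = normal_imp_subgroup[OF M]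
  show "?D \<noteq> {}" using a subgroup.one_closed[OF sM] by (auto intro!: exI[of _ \<one>])
  fix h assume h: "h \<in> ?D"
  have "cnj (inv h) (inv (cnj h a \<otimes> inv a)) \<in> M"
    using normal_cnj[OF M _ subgroup.m_inv_closed[OF sM]] h by simp
  moreover have "cnj (inv h) (inv (cnj h a \<otimes> inv a)) = cnj (inv h) a \<otimes> inv a"
    using h a by (simp add: cnj_def word)
  ultimately show "inv h \<in> ?D" using h by simp
  fix k assume k: "k \<in> ?D"
  have "cnj h (cnj k a \<otimes> inv a) \<otimes> (cnj h a \<otimes> inv a) \<in> M"
    using normal_cnj[OF M] subgroup.m_closed[OF sM] h k by blast
  moreover have "cnj h (cnj k a \<otimes> inv a) \<otimes> (cnj h a \<otimes> inv a) = cnj (h \<otimes> k) a \<otimes> inv a"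
    using h k a by (simp add: cnj_def word)
  ultimately show "h \<otimes> k \<in> ?D" using h k by simp
qed auto

end

context two_gen
begin

text \<open>In the core-free quotient \<open>c\<close> has order 2, so the core has index 2 in the
  cyclic group \<open>C\<close> and is generated by the square of \<open>c\<close>. \<open>H\<close>
  is the preimage of the Klein four-group.\<close>

lemma even_index_twice_prime_structure:
  assumes q: "prime (q::nat)" "odd q" and card_G: "card (carrier G) = 2 * q * card C" and ev: "even (card C)"
  defines "K \<equiv> generate G {c [^] (2::nat)}"
  obtains H where "q = 3" "H \<lhd> G" "C \<subseteq> H" "card H = 2 * card C" "card (carrier G) = 3 * card H"
    "K \<lhd> G" "\<And>h. h \<in> H \<Longrightarrow> h \<otimes> h \<in> K" "\<not> C \<lhd> G"
proof -
  have nn: "\<not> C \<lhd> G" using normal_index_twice_prime_odd[OF _ q card_G] ev by blast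
  obtain N where N: "N \<lhd> G" "N \<subseteq> C" "\<And>A. A \<lhd> (G Mod N) \<Longrightarrow> A \<subseteq> (#>) N ` C \<Longrightarrow> A = {\<one>\<^bsub>G Mod N\<^esub>}"
    using exists_core[OF C_sub] by blast
  note sN = quot_sub[OF N(1)]
  interpret Q: two_gen "G Mod N" "N #> x" "N #> y" by (rule quot_two_gen[OF N(1)])
  have Qc: "Q.c = N #> c" using quot_two_gen[OF N(1)] by simp
  have QC: "Q.C = (#>) N ` C" using quot_two_gen[OF N(1)] by simp
  have cN: "c \<notin> N"
  proof
    assume "c \<in> N"
    then have "C = N" using generate_subset[OF sN] N(2) by blast
    then show False using nn N(1) by simp
  qed
  interpret Q: core_free_two_gen "G Mod N" "N #> x" "N #> y" q
  proof
    show "A = {\<one>\<^bsub>G Mod N\<^esub>}" if "A \<lhd> (G Mod N)" "A \<subseteq> Q.C" for A using N(3) that QC by simp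
    show "Q.C \<noteq> {\<one>\<^bsub>G Mod N\<^esub>}" using Q.generate_self[of Q.c] Qc quot_eq_one[OF N(1) c_closed] cN by auto
    have "card (carrier (G Mod N)) * card N = 2 * q * (card Q.C * card N)"
      unfolding QC quot_card[OF N(1) C_sub N(2)] quot_order[OF N(1)] by (rule card_G)
    then show "card (carrier (G Mod N)) = 2 * q * card Q.C" using subgroup_card_pos[OF sN] by simp
  qed (use q in auto)
  obtain HQ where HQ: "HQ \<lhd> (G Mod N)" "Q.C \<subseteq> HQ" "card HQ = 2 * card Q.C"
      "card (carrier (G Mod N)) = q * card HQ" "q = 3" "Q.ord Q.c = 2"
      "\<And>h. h \<in> HQ \<Longrightarrow> h \<otimes>\<^bsub>G Mod N\<^esub> h = \<one>\<^bsub>G Mod N\<^esub>"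
    using Q.core_free_structure by blast
  define H where "H = {a \<in> carrier G. N #> a \<in> HQ}"
  note H = quot_preimage_normal[OF N(1) HQ(1), folded H_def]
  note sH = normal_imp_subgroup[OF H(1)]
  have cH: "card H = card HQ * card N" using quot_card[OF N(1) sH H(3)] H(2) by simp
  have cC: "card C = card Q.C * card N" using quot_card[OF N(1) C_sub N(2)] QC by simp
  have sq: "h \<otimes> h \<in> N" if h: "h \<in> H" for h
  proof -
    interpret hom: group_hom G "G Mod N" "(#>) N" by (rule quot_hom[OF N(1)])
    have hG: "h \<in> carrier G" using h by (simp add: H_def)
    have "N #> (h \<otimes> h) = N" using HQ(7)[of "N #> h"] h hom.hom_mult[OF hG hG] by (simp add: H_def)
    then show ?thesis using quot_eq_one[OF N(1) m_closed[OF hG hG]] by simp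
  qed
  have CH: "C \<subseteq> H" using HQ(2) QC C_carrier by (auto simp: H_def)
  have two: "2 dvd ord c" using ev card_C by simp
  have c2N: "c [^] (2::nat) \<in> N"
    using sq[of c] CH generate_self[of c] by (simp add: numeral_2_eq_2 subset_iff)
  have "K \<subseteq> N" unfolding K_def by (rule generate_subset[OF sN c2N])
  moreover have "card N \<le> card K"
    using generate_prime_pow(3)[OF c_closed two_is_prime_nat two] cC card_C Q.card_C HQ(6) by (simp add: K_def)
  ultimately have KN: "K = N"
    using subgroup_eq_if_card[of K N] sN generate_prime_pow(1)[OF c_closed two_is_prime_nat two] by (simp add: K_def)
  have "card (carrier G) = 3 * card H" using quot_order[OF N(1)] HQ(4,5) cH by simp
  moreover have "card H = 2 * card C" using cH cC HQ(3) by simp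
  ultimately show ?thesis using that[OF HQ(5) H(1) CH _ _ _ _ nn] KN N(1) sq by simp
qed

context
  fixes H K
  assumes ev: "even (card C)" and K_def: "K = generate G {c [^] (2::nat)}"
    and H: "H \<lhd> G" "C \<subseteq> H" "card H = 2 * card C" "card (carrier G) = 3 * card H"
    and K: "K \<lhd> G" and square: "\<And>h. h \<in> H \<Longrightarrow> h \<otimes> h \<in> K" and nn: "\<not> C \<lhd> G"
begin

lemma sH: "subgroup H G" using H(1) by (rule normal_imp_subgroup)

lemma sK: "subgroup K G" using K by (rule normal_imp_subgroup)

lemma HG: "h \<in> H \<Longrightarrow> h \<in> carrier G" by (rule subgroup.mem_carrier[OF sH])

lemma KG: "h \<in> K \<Longrightarrow> h \<in> carrier G" by (rule subgroup.mem_carrier[OF sK])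

lemma two_dvd: "2 dvd ord c" using ev card_C by simp

lemma K_C: "K \<subseteq> C" "card K * 2 = card C" "c \<notin> K"
  using generate_prime_pow[OF c_closed two_is_prime_nat two_dvd] K_def card_C by auto

text \<open>Since \<open>C\<close> has index 2 in \<open>H\<close>, the conjugate found here
  generates \<open>H\<close> together with \<open>C\<close>.\<close>

lemma exists_moving: obtains g where "g \<in> carrier G" "cnj g c \<in> H" "cnj g c \<notin> C"
proof -
  obtain g where g: "g \<in> carrier G" "g \<notin> Nrm C" using nn normal_iff_Nrm[OF C_sub] by blast
  have "cnj g c \<notin> C"
  proof
    assume "cnj g c \<in> C"
    then have "cnj g ` C \<subseteq> C" using generate_cnj[OF g(1) c_closed] generate_subset[OF C_sub] by simp
    then show False using g by (simp add: Nrm_def)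
  qed
  moreover have "cnj g c \<in> H" using normal_cnj[OF H(1) g(1)] H(2) generate_self by blast
  ultimately show ?thesis using that g by blast
qed

text \<open>\<open>C\<close> is abelian and contains \<open>K\<close>; since \<open>K\<close> is
  normal, conjugates of \<open>c\<close> centralize it too, and one of them lies in \<open>H\<close>
  outside \<open>C\<close>.\<close>

lemma H_centralizes_K:
  assumes "h \<in> H" "k \<in> K" shows "h \<otimes> k = k \<otimes> h"
proof -
  have KsG: "K \<subseteq> carrier G" using sK by (rule subgroup.subset)
  let ?Z = "{g \<in> carrier G. \<forall>a\<in>K. g \<otimes> a = a \<otimes> g}"
  obtain g where g: "g \<in> carrier G" "cnj g c \<in> H" "cnj g c \<notin> C" by (rule exists_moving)
  have sZ: "subgroup (?Z \<inter> H) G" using subgroups_Inter_pair[OF centralizer_subgroup[OF KsG] sH] .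
  have "C \<subseteq> ?Z \<inter> H" using C_comm K_C(1) C_carrier H(2) by blast
  moreover have "cnj g c \<otimes> a = a \<otimes> cnj g c" if a: "a \<in> K" for a
  proof -
    have b: "cnj (inv g) a \<in> K" using normal_cnj[OF K _ a] g by simp
    then have "c \<otimes> cnj (inv g) a = cnj (inv g) a \<otimes> c" using C_comm[OF generate_self] K_C(1) by blast
    then have "cnj g (c \<otimes> cnj (inv g) a) = cnj g (cnj (inv g) a \<otimes> c)" by simp
    then show ?thesis using g KG[OF a] by (simp add: cnj_mult)
  qed
  then have "cnj g c \<in> ?Z \<inter> H" using g by simp
  ultimately have "?Z \<inter> H = H"
    using prime_index_between[OF C_sub sZ sH _ _ H(3) two_is_prime_nat] g(3) by blast
  then show ?thesis using assms by blast
qed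

text \<open>The commutator is \<open>a \<otimes> b\<close> squared, times a conjugate of the inverse
  square of \<open>a\<close>, times the inverse square of \<open>b\<close>, so it lies in
  \<open>K\<close> and is central in \<open>H\<close>. Its square is then the commutator of
  \<open>a \<otimes> a\<close> and \<open>b\<close>, trivial because \<open>a \<otimes> a\<close>
  lies in \<open>K\<close>.\<close>

lemma H_comtr:
  assumes "a \<in> H" "b \<in> H"
  shows "comtr G a b \<in> K" "comtr G a b \<otimes> comtr G a b = \<one>"
proof -
  have cs: "a \<in> carrier G" "b \<in> carrier G" using assms HG by auto
  have "comtr G a b = ((a \<otimes> b) \<otimes> (a \<otimes> b)) \<otimes> cnj (inv b) (inv (a \<otimes> a)) \<otimes> inv (b \<otimes> b)"
    using cs by (simp add: comtr_def cnj_def word)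
  also have "\<dots> \<in> K"
    using square[OF subgroup.m_closed[OF sH assms]] square[OF assms(1)] square[OF assms(2)] cs
      normal_cnj[OF K, of "inv b"] subgroup.m_closed[OF sK] subgroup.m_inv_closed[OF sK] by simp
  finally show e: "comtr G a b \<in> K" .
  let ?e = "comtr G a b"
  have ab: "a \<otimes> b = ?e \<otimes> b \<otimes> a" using cs by (simp add: comtr_def word)
  have ea: "a \<otimes> ?e = ?e \<otimes> a" using H_centralizes_K[OF assms(1) e] .
  have "a \<otimes> a \<otimes> b = a \<otimes> (?e \<otimes> b \<otimes> a)" using cs ab by (simp add: m_assoc)
  also have "\<dots> = (a \<otimes> ?e) \<otimes> b \<otimes> a" using cs by (simp add: m_assoc)
  also have "\<dots> = ?e \<otimes> (a \<otimes> b) \<otimes> a" unfolding ea using cs by (simp add: m_assoc)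
  also have "\<dots> = ?e \<otimes> (?e \<otimes> b \<otimes> a) \<otimes> a" using ab by simp
  also have "\<dots> = (?e \<otimes> ?e) \<otimes> (b \<otimes> (a \<otimes> a))" using cs by (simp add: m_assoc)
  also have "b \<otimes> (a \<otimes> a) = a \<otimes> a \<otimes> b" using H_centralizes_K[OF assms(2) square[OF assms(1)]] .
  finally show "?e \<otimes> ?e = \<one>" using cs by (metis comtr_closed m_closed r_cancel_one')
qed

text \<open>\<open>?S\<close> is the group of squares in \<open>K\<close>. The conjugates
  \<open>c\<close>, \<open>?c2\<close>, \<open>?c3\<close> represent the three nontrivial cosets of
  \<open>K\<close> in \<open>H\<close>, so \<open>?c3\<close> is \<open>?c2 \<otimes> c\<close>
  times some \<open>z\<close> in \<open>K\<close>. Squaring gives the squares of \<open>?c2\<close>,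
  \<open>c\<close> and \<open>z\<close> times a commutator \<open>?e\<close> of order at most 2. The
  squares of \<open>c\<close>, \<open>?c2\<close> and \<open>?c3\<close> lie in \<open>K\<close>
  outside \<open>?S\<close>, so the right side lies in \<open>?S\<close> as soon as
  \<open>?e\<close> does, but the left side never does.\<close>

lemma not_8_dvd_card_C: "\<not> 8 dvd card C"
proof
  assume d8: "8 dvd card C"
  let ?a = "c [^] (2::nat)"
  let ?S = "generate G {?a [^] (2::nat)}"
  have aK: "?a \<in> K" unfolding K_def by (rule generate_self)
  have oa: "ord ?a = card K" using generate_pow_card[of ?a] by (simp add: K_def)
  have d4: "4 dvd ord ?a" using d8 K_C(2) unfolding oa by (auto elim!: dvdE)
  then have "2 dvd ord ?a" by (metis dvd_trans even_numeral)
  note S = generate_prime_pow[OF nat_pow_closed[OF c_closed] two_is_prime_nat this]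
  have SK: "?S \<subseteq> K" using S(2) K_def by simp
  have K2S: "card K = 2 * card ?S" using S(3) oa by simp
  have Sn: "?S \<lhd> G" using cyclic_normal_subgroup[of ?a] K S(1,2) K_def by simp
  have prodS: "k \<otimes> l \<in> ?S" if kl: "k \<in> K" "k \<notin> ?S" "l \<in> K" "l \<notin> ?S" for k l
  proof -
    have "inv k \<in> K" "inv k \<notin> ?S"
      using subgroup.m_inv_closed[OF sK kl(1)] subgroup.m_inv_closed[OF S(1), of "inv k"] kl KG by auto
    from index2_quotient[OF S(1) sK SK K2S this kl(3,4)] show ?thesis using KG kl by simp
  qed
  have moveS: "cnj h k \<notin> ?S" if "h \<in> carrier G" "k \<in> carrier G" "k \<notin> ?S" for h k
    using normal_cnj[OF Sn, of "inv h" "cnj h k"] that by auto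
  obtain g where g: "g \<in> carrier G" "cnj g c \<in> H" "cnj g c \<notin> C" by (rule exists_moving)
  let ?c2 = "cnj g c" and ?c3 = "cnj g (cnj g c)"
  have cs: "?c2 \<in> carrier G" "?c3 \<in> carrier G" using g by auto
  have cH: "c \<in> H" using H(2) generate_self by blast
  have c3H: "?c3 \<in> H" using normal_cnj[OF H(1) g(1,2)] .
  have g3: "g [^] (3::nat) \<in> H" using normal_index_pow[OF H(1,4) g(1)] .
  have C_mult: "a \<otimes> b \<in> C" if "a \<in> C" "b \<in> C" for a b using that subgroup.m_closed[OF C_sub] by blast
  \<comment> \<open>Otherwise \<open>?c3\<close> and \<open>c\<close> agree modulo \<open>K\<close>.
    Conjugating by \<open>g\<close>, and since the cube of \<open>g\<close> lies in \<open>H\<close>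
    and fixes \<open>c\<close> modulo \<open>K\<close>, also \<open>?c2\<close> would agree with
    \<open>c\<close> modulo \<open>K\<close>.\<close>
  have c3C: "?c3 \<notin> C"
  proof
    assume c3: "?c3 \<in> C"
    have c3K: "?c3 \<notin> K"
    proof
      assume "?c3 \<in> K"
      then have "cnj (inv g) (cnj (inv g) ?c3) \<in> K"
        using normal_cnj[OF K inv_closed[OF g(1)]] by blast
      then show False using g K_C(3) by simp
    qed
    have ck: "inv c \<otimes> ?c3 \<in> K"
      by (rule index2_quotient[OF sK C_sub K_C(1) _ generate_self K_C(3) c3 c3K]) (use K_C in simp)
    have "cnj g (inv c \<otimes> ?c3) \<in> K" using normal_cnj[OF K g(1) ck] .
    moreover have "cnj (g [^] (3::nat)) c = cnj g ?c3"
      using g by (simp add: cnj_cnj numeral_3_eq_3 m_assoc)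
    moreover have "comtr G (g [^] (3::nat)) c \<in> K" using H_comtr(1)[OF g3 cH] .
    then have "cnj (g [^] (3::nat)) c \<otimes> inv c \<in> K" by (simp add: comtr_def cnj_def)
    ultimately have 1: "inv ?c2 \<otimes> cnj g ?c3 \<in> K" "cnj g ?c3 \<otimes> inv c \<in> K"
      using g cs by (simp_all add: cnj_mult cnj_inv)
    have c2e: "?c2 = cnj g ?c3 \<otimes> inv (inv ?c2 \<otimes> cnj g ?c3)" using g cs by (simp add: word)
    have c3e: "cnj g ?c3 = (cnj g ?c3 \<otimes> inv c) \<otimes> c" using g cs by (simp add: word)
    have "cnj g ?c3 \<in> C"
      using c3e C_mult[of "cnj g ?c3 \<otimes> inv c" c] 1(2) K_C(1) generate_self[of c] by auto
    then have "cnj g ?c3 \<otimes> inv (inv ?c2 \<otimes> cnj g ?c3) \<in> C"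
      using C_mult 1(1) K_C(1) subgroup.m_inv_closed[OF sK] by blast
    then show False using c2e g(3) by simp
  qed
  have q1: "inv ?c2 \<otimes> ?c3 \<in> C" by (rule index2_quotient[OF C_sub sH H(2,3) g(2,3) c3H c3C])
  have q2: "inv ?c2 \<otimes> ?c3 \<notin> K"
  proof
    assume "inv ?c2 \<otimes> ?c3 \<in> K"
    then have "cnj (inv g) (inv ?c2 \<otimes> ?c3) \<in> K" by (rule normal_cnj[OF K inv_closed[OF g(1)]])
    then have "inv c \<otimes> ?c2 \<in> K" using g by (simp add: cnj_mult cnj_inv)
    then have "c \<otimes> (inv c \<otimes> ?c2) \<in> C" using C_mult K_C(1) generate_self[of c] by blast
    then show False using g by (simp add: word)
  qed
  define z where "z = inv c \<otimes> (inv ?c2 \<otimes> ?c3)"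
  have zK: "z \<in> K" unfolding z_def
    by (rule index2_quotient[OF sK C_sub K_C(1) _ generate_self K_C(3) q1 q2]) (use K_C in simp)
  have zG: "z \<in> carrier G" using KG zK .
  have c3z: "?c3 = ?c2 \<otimes> c \<otimes> z" using cs by (simp add: z_def word)
  let ?e = "comtr G c ?c2"
  have e: "?e \<in> K" "?e \<otimes> ?e = \<one>" using H_comtr[OF cH g(2)] by auto
  have "?c3 \<otimes> ?c3 = ?c2 \<otimes> c \<otimes> (z \<otimes> (?c2 \<otimes> c)) \<otimes> z" using cs zG by (simp add: c3z m_assoc)
  also have "z \<otimes> (?c2 \<otimes> c) = ?c2 \<otimes> c \<otimes> z"
    using H_centralizes_K[OF subgroup.m_closed[OF sH g(2) cH] zK] by simp
  also have "?c2 \<otimes> c \<otimes> (?c2 \<otimes> c \<otimes> z) \<otimes> z = ?c2 \<otimes> (c \<otimes> ?c2) \<otimes> c \<otimes> (z \<otimes> z)"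
    using cs zG by (simp add: m_assoc)
  also have "c \<otimes> ?c2 = ?e \<otimes> ?c2 \<otimes> c" using cs by (simp add: comtr_def word)
  also have "?c2 \<otimes> (?e \<otimes> ?c2 \<otimes> c) = (?c2 \<otimes> ?e) \<otimes> ?c2 \<otimes> c" using cs by (simp add: m_assoc)
  also have "?c2 \<otimes> ?e = ?e \<otimes> ?c2" using H_centralizes_K[OF g(2) e(1)] .
  also have "?e \<otimes> ?c2 \<otimes> ?c2 \<otimes> c \<otimes> c \<otimes> (z \<otimes> z) = ?e \<otimes> ((?c2 \<otimes> ?c2) \<otimes> ?a) \<otimes> (z \<otimes> z)"
    using cs zG by (simp add: m_assoc numeral_2_eq_2)
  finally have eq: "?c3 \<otimes> ?c3 = ?e \<otimes> ((?c2 \<otimes> ?c2) \<otimes> ?a) \<otimes> (z \<otimes> z)" .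
  have c2sq: "?c2 \<otimes> ?c2 = cnj g ?a" using g by (simp add: cnj_mult numeral_2_eq_2)
  have c3sq: "?c3 \<otimes> ?c3 = cnj g (cnj g ?a)" using g by (simp add: cnj_mult numeral_2_eq_2)
  have n2: "cnj g ?a \<notin> ?S" using moveS[OF g(1) _ S(4)] by simp
  have n3: "?c3 \<otimes> ?c3 \<notin> ?S" unfolding c3sq using moveS[OF g(1) _ n2] g by simp
  have "(?c2 \<otimes> ?c2) \<otimes> ?a \<in> ?S"
    unfolding c2sq by (rule prodS[OF _ n2 aK S(4)]) (rule normal_cnj[OF K g(1) aK])
  moreover have "z \<otimes> z \<in> ?S" using index2_square[OF S(1) sK SK K2S zK] .
  \<comment> \<open>Here divisibility by 8 enters: 4 divides the order of \<open>?a\<close>, so an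
    exponent \<open>j\<close> for which that order divides \<open>2 * j\<close> is even.\<close>
  moreover have "?e \<in> ?S"
  proof -
    obtain j where j: "?e = ?a [^] (j::nat)" using generateE[of ?a ?e] e(1) K_def by auto
    then have "?a [^] (j + j) = \<one>" using e(2) nat_pow_mult[of ?a j j] by simp
    then have "ord ?a dvd j + j" using pow_eq_id[of ?a "j + j"] by simp
    then have "4 dvd 2 * j" using d4 by (metis dvd_trans mult_2)
    then have "even j" by presburger
    then obtain i where "j = 2 * i" by blast
    then have "?e = (?a [^] (2::nat)) [^] i" using j by (simp add: nat_pow_pow)
    then show ?thesis using pow_in_generate[of "?a [^] (2::nat)" i] by simp
  qed
  ultimately have "?c3 \<otimes> ?c3 \<in> ?S" unfolding eq using subgroup.m_closed[OF S(1)] by blast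
  then show False using n3 by blast
qed

text \<open>The argument of \<open>normal_prime_index_factor\<close> with \<open>K\<close> in place
  of \<open>C\<close>. As \<open>H\<close> centralizes \<open>K\<close>, the cube of
  \<open>g\<close> acts trivially and \<open>u ^ 3\<close> is 1 modulo \<open>p\<close>. If
  \<open>u\<close> were 1 modulo \<open>p\<close>, the square of \<open>c\<close> would be central
  modulo \<open>?M\<close>, which has index \<open>12 * p\<close>.\<close>

lemma odd_prime_factor_cong:
  assumes p: "prime (p::nat)" "odd p" "p dvd card C"
  shows "[p = 1] (mod 3)"
proof -
  let ?a = "c [^] (2::nat)"
  have aK: "?a \<in> K" unfolding K_def by (rule generate_self)
  have aG: "?a \<in> carrier G" by simp
  have oa: "ord ?a = card K" using generate_pow_card[of ?a] by (simp add: K_def)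
  have "p dvd card K * 2" using p(3) K_C(2) by simp
  then have pa: "p dvd ord ?a"
    using p(1,2) oa by (metis even_numeral prime_dvd_mult_iff primes_dvd_imp_eq two_is_prime_nat)
  let ?M = "generate G {?a [^] p}"
  note M = generate_prime_pow[OF aG p(1) pa]
  have Mn: "?M \<lhd> G" using cyclic_normal_subgroup[of ?a] K M(1,2) K_def by simp
  obtain g where g: "g \<in> carrier G" "cnj g c \<in> H" "cnj g c \<notin> C" by (rule exists_moving)
  obtain u where u: "cnj g ?a = ?a [^] (u::nat)" "u > 0"
    using generateE_pos[OF aG, of "cnj g ?a"] normal_cnj[OF K g(1) aK] K_def by auto
  have it: "cnj (g [^] i) ?a = ?a [^] (u ^ i)" for i :: nat
  proof (induction i)
    case (Suc i)
    have "cnj (g [^] Suc i) ?a = cnj (g [^] i) (cnj g ?a)" using g by (simp add: cnj_cnj)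
    also have "\<dots> = cnj (g [^] i) ?a [^] u" using g u aG by (simp only: cnj_pow nat_pow_closed)
    also have "\<dots> = ?a [^] (u ^ i * u)" using Suc aG by (simp only: nat_pow_pow)
    finally show ?case by (simp add: mult.commute)
  qed (use aG in simp)
  have g3: "g [^] (3::nat) \<in> H" using normal_index_pow[OF H(1,4) g(1)] .
  then have "cnj (g [^] (3::nat)) ?a = ?a" using H_centralizes_K[OF g3 aK] cnj_eq_iff g aG by blast
  then have "?a [^] int (u ^ 3) = ?a [^] (1::int)"
    using it[of 3] by (simp only: int_pow_int int_pow_1[OF aG])
  then have "int (ord ?a) dvd 1 - int (u ^ 3)" using int_pow_eq[OF aG, of "int (u ^ 3)" 1] by simp
  then have "int p dvd 1 - int (u ^ 3)" using pa by (meson dvd_trans int_dvd_int_iff)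
  then have uq: "[u ^ 3 = 1] (mod p)"
    by (metis cong_iff_dvd_diff cong_int_iff cong_sym of_nat_1)
  have gH: "g \<notin> H"
  proof
    assume "g \<in> H"
    have cH: "c \<in> H" using H(2) generate_self by blast
    have "comtr G g c \<in> C" using H_comtr(1)[OF \<open>g \<in> H\<close> cH] K_C(1) by blast
    then have "comtr G g c \<otimes> c \<in> C" using subgroup.m_closed[OF C_sub] generate_self by blast
    then show False using g by (simp add: comtr_def cnj_def word)
  qed
  have "\<not> [u = 1] (mod p)"
  proof
    assume "[u = 1] (mod p)"
    then have "p dvd u - 1" using u(2) cong_to_1_nat by auto
    then obtain t where t: "u = 1 + p * t" using u(2) by (metis One_nat_def Suc_leI dvdE le_add_diff_inverse)
    let ?D = "{h \<in> carrier G. cnj h ?a \<otimes> inv ?a \<in> ?M}"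
    have sD: "subgroup ?D G" by (rule commute_mod_normal_subgroup[OF Mn aG])
    have "cnj g ?a = (?a [^] p) [^] t \<otimes> ?a"
      using aG by (simp add: u t nat_pow_pow nat_pow_mult mult.assoc)
    then have "cnj g ?a \<otimes> inv ?a = (?a [^] p) [^] t" using aG by (simp add: m_assoc)
    then have "g \<in> ?D" using pow_in_generate[of "?a [^] p" t] g by simp
    moreover have "H \<subseteq> ?D"
    proof
      fix h assume h: "h \<in> H"
      then have "cnj h ?a = ?a" using H_centralizes_K[OF h aK] cnj_eq_iff HG aG by blast
      then show "h \<in> ?D" using HG[OF h] subgroup.one_closed[OF M(1)] aG by (simp del: nat_pow_closed)
    qed
    ultimately have "?D = carrier G"
      using prime_index_between[OF sH sD subgroup_self _ _ H(4)] gH by auto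
    then have cen: "cnj h ?a \<otimes> inv ?a \<in> ?M" if "h \<in> carrier G" for h using that by blast
    have "card C = card ?M * p * 2" unfolding M(3) oa K_C(2) ..
    then have cG: "card (carrier G) = card ?M * (12 * p)" using H(3,4) by simp
    \<comment> \<open>Divisibility of 12 by \<open>p ^ 2\<close> would force \<open>p = 2\<close>,
      which is excluded because \<open>p\<close> is odd.\<close>
    have p3: "\<not> p ^ 3 dvd 12 * p"
    proof
      assume "p ^ 3 dvd 12 * p"
      then have "p ^ 2 dvd 12" using p(1) by (simp add: power3_eq_cube power2_eq_square prime_gt_0_nat)
      then have "p ^ 2 \<le> 12" by (rule dvd_imp_le) simp
      then have "p < 4" using power_mono[of 4 p 2] by (cases "p < 4") auto
      then have "p \<in> {0, 1, 2, 3}" by auto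
      then have "p = 3" using p by auto
      then show False using \<open>p ^ 2 dvd 12\<close> by simp
    qed
    show False
      using central_commutator_mod_contra[OF Mn x y p(1), of ?a 2 "12 * p"] M(4,5) cen cG p3 by simp
  qed
  then show ?thesis using cong_1_if_prime_order[OF p(1) _ uq] by simp
qed

end

theorem index_twice_prime_even:
  assumes q: "prime (q::nat)" "odd q" "card (carrier G) = 2 * q * card C" and ev: "even (card C)"
  shows "q = 3" "\<not> 8 dvd card C" "\<And>p. prime p \<Longrightarrow> odd p \<Longrightarrow> p dvd card C \<Longrightarrow> [p = 1] (mod 3)"
proof -
  obtain H where H: "q = 3" "H \<lhd> G" "C \<subseteq> H" "card H = 2 * card C" "card (carrier G) = 3 * card H"
    "generate G {c [^] (2::nat)} \<lhd> G" "\<And>h. h \<in> H \<Longrightarrow> h \<otimes> h \<in> generate G {c [^] (2::nat)}" "\<not> C \<lhd> G"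
    using even_index_twice_prime_structure[OF assms] by blast
  show "q = 3" by (rule H(1))
  show "\<not> 8 dvd card C" by (rule not_8_dvd_card_C[OF ev refl H(2-8)])
  show "[p = 1] (mod 3)" if "prime p" "odd p" "p dvd card C" for p
    by (rule odd_prime_factor_cong[OF ev refl H(2-8) that])
qed

end

subsection \<open>Commutators of order three\<close>

context finite_group
begin

text \<open>Even powers of \<open>g\<close> fix \<open>a\<close> and odd powers invert it, but some
  odd power of \<open>g\<close> is the identity; so \<open>a\<close> would equal its inverse, which
  order 3 forbids.\<close>

lemma no_real_element_if_odd:
  assumes odd: "odd (card (carrier G))" and g: "g \<in> carrier G" and a: "a \<in> carrier G"
    and e: "cnj g a = inv a" and a3: "ord a = 3"
  shows False
proof -
  have it: "cnj (g [^] (2 * i)) a = a" for i :: nat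
  proof (induction i)
    case (Suc i)
    have "cnj (g [^] (2 * Suc i)) a = cnj (g [^] (2 * i)) (cnj g (cnj g a))"
      using g a by (simp add: cnj_cnj m_assoc)
    then show ?case using Suc e g a by (simp add: cnj_inv)
  qed (use a in simp)
  obtain i where i: "card (carrier G) = 2 * i + 1" using odd by (elim oddE)
  have one: "g [^] (2 * i + 1) = \<one>" using pow_order_eq_1[OF g] i by (simp add: order_def)
  have "a = cnj (g [^] (2 * i + 1)) a" unfolding one using a by simp
  also have "\<dots> = cnj (g [^] (2 * i)) (cnj g a)" using g a by (simp add: cnj_cnj)
  also have "\<dots> = inv a" using it[of i] e g a by (simp add: cnj_inv)
  finally have "a \<otimes> a = \<one>" using a by (metis r_inv)
  then have "a [^] (2::nat) = \<one>" using a by (simp add: numeral_2_eq_2)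
  then have "3 dvd (2::nat)" using pow_eq_id[OF a] a3 by metis
  then show False by simp
qed

lemma generate_order_3:
  assumes a: "a \<in> carrier G" "ord a = 3" shows "generate G {a} = {\<one>, a, inv a}"
proof -
  have "a [^] (3::nat) = \<one>" using a pow_eq_id[of a 3] by simp
  then have "a \<otimes> a \<otimes> a = \<one>" using a(1) by (simp add: numeral_3_eq_3)
  then have "inv a = a \<otimes> a" using inv_equality[of "a \<otimes> a" a] a by simp
  moreover have "generate G {a} = {\<one>, a, a \<otimes> a}"
  proof
    have "a [^] i \<in> {\<one>, a, a \<otimes> a}" for i :: nat
    proof (induction i)
      case (Suc i) then show ?case using a \<open>a \<otimes> a \<otimes> a = \<one>\<close> by auto
    qed simp
    then show "generate G {a} \<subseteq> {\<one>, a, a \<otimes> a}" using generate_eq_powers[OF a(1)] by auto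
    show "{\<one>, a, a \<otimes> a} \<subseteq> generate G {a}" using generate.one generate_self generate.eng by fast
  qed
  ultimately show ?thesis by simp
qed

text \<open>Two distinct conjugates of the group generated by \<open>a\<close> would make
  \<open>P\<close> have more than 9 elements. So \<open>k\<close> normalizes that group and sends
  \<open>a\<close> to itself or to its inverse, and odd order excludes the inverse.\<close>

lemma order_3_normal_in_9:
  assumes odd: "odd (card (carrier G))" and P: "subgroup P G" "card P dvd 9"
    and a: "a \<in> P" "ord a = 3" and k: "k \<in> P"
  shows "k \<otimes> a = a \<otimes> k"
proof -
  note PG = subgroup.mem_carrier[OF P(1)]
  let ?A = "generate G {a}"
  have aG: "a \<in> carrier G" "k \<in> carrier G" using PG a k by auto
  have sA: "subgroup ?A G" using aG by simp
  have AG: "?A \<subseteq> carrier G" using sA by (rule subgroup.subset)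
  have cA: "card ?A = 3" using generate_pow_card[OF aG(1)] a by simp
  have AP: "?A \<subseteq> P" using generate_subset[OF P(1) a(1)] .
  have "k \<in> Nrm ?A"
  proof (rule ccontr)
    assume n: "k \<notin> Nrm ?A"
    then have "k \<notin> ?A" using subgroup_subset_Nrm[OF sA] by blast
    have sk: "subgroup (cnj k ` ?A) G" using subgroup_cnj[OF aG(2) sA] .
    have "?A \<noteq> cnj k ` ?A" using n aG by (auto simp: Nrm_def)
    then have "?A \<inter> cnj k ` ?A = {\<one>}" using prime_subgroups_Int[OF sA sk] cA aG AG by simp
    then have "3 * 3 < card P"
      using card_prod_less_cnj[OF sA sA P(1) _ AP k \<open>k \<notin> ?A\<close>] cA by simp
    then show False using P(2) by (auto dest: dvd_imp_le)
  qed
  then have "cnj k a \<in> {\<one>, a, inv a}" using NrmD generate_self generate_order_3[OF aG(1) a(2)] by metis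
  moreover have "cnj k a \<noteq> \<one>"
  proof
    assume "cnj k a = \<one>"
    then have "cnj (inv k) (cnj k a) = \<one>" using aG by simp
    then show False using aG a by simp
  qed
  moreover have "cnj k a \<noteq> inv a" using no_real_element_if_odd[OF odd aG(2,1)] a by blast
  ultimately show ?thesis using cnj_eq_iff aG by blast
qed

end

text \<open>Collects the factors of the transfer by their value, each of which occurs
  \<open>r\<close> times.\<close>

lemma (in comm_group) finprod_fibres:
  assumes "finite S" "finite F" "\<And>t. t \<in> F \<Longrightarrow> f t \<in> carrier G"
    and "\<And>s. s \<in> S \<Longrightarrow> card {t \<in> F. f t = s} = r" "S \<subseteq> carrier G"
  shows "finprod G f {t \<in> F. f t \<in> S} = finprod G (\<lambda>s. s [^] r) S"
  using assms(1,4,5)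
proof (induction S)
  case empty then show ?case by simp
next
  case (insert s S)
  have "{t \<in> F. f t \<in> insert s S} = {t \<in> F. f t = s} \<union> {t \<in> F. f t \<in> S}" by blast
  also have "finprod G f \<dots> = finprod G f {t \<in> F. f t = s} \<otimes> finprod G f {t \<in> F. f t \<in> S}"
    by (rule finprod_Un_disjoint) (use insert assms in auto)
  also have "finprod G f {t \<in> F. f t = s} = finprod G (\<lambda>_. s) {t \<in> F. f t = s}"
    by (rule finprod_cong') (use insert in auto)
  also have "\<dots> = s [^] card {t \<in> F. f t = s}" by (rule finprod_const) (use insert in auto)
  also have "card {t \<in> F. f t = s} = r" using insert by simp
  also have "finprod G f {t \<in> F. f t \<in> S} = finprod G (\<lambda>s. s [^] r) S" using insert by simp
  also have "s [^] r \<otimes> \<dots> = finprod G (\<lambda>s. s [^] r) (insert s S)"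
    by (rule finprod_insert[symmetric]) (use insert in auto)
  finally show ?case .
qed

text \<open>The set \<open>S\<close> consists of one generator of each of one, two or four of the at most four subgroups
  of order 3 of \<open>P\<close>.\<close>

lemma (in finite_group) prod_half_system_nontrivial:
  assumes P: "subgroup P G" "card P dvd 9" and comm: "\<And>a b. a \<in> P \<Longrightarrow> b \<in> P \<Longrightarrow> a \<otimes> b = b \<otimes> a"
    and S: "S \<subseteq> P" "\<And>s. s \<in> S \<Longrightarrow> ord s = 3" "\<And>s. s \<in> S \<Longrightarrow> inv s \<notin> S"
    and card_S: "\<not> 3 dvd card S" and r: "\<not> 3 dvd r"
  shows "finprod (G\<lparr>carrier := P\<rparr>) (\<lambda>s. s [^]\<^bsub>G\<lparr>carrier := P\<rparr>\<^esub> (r::nat)) S \<noteq> \<one>"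
proof -
  let ?PG = "G\<lparr>carrier := P\<rparr>"
  note PG = subgroup.mem_carrier[OF P(1)]
  interpret Tr: transfer G P
    by (intro transfer.intro transversal.intro transversal_axioms.intro transfer_axioms.intro
          finite_group_axioms P(1)) (rule comm)
  interpret Q: comm_group ?PG by (rule Tr.PG_comm)
  have pw: "s [^]\<^bsub>?PG\<^esub> r = s [^] r" for s by (rule nat_pow_consistent[symmetric])
  have cl: "a \<otimes> b \<in> P" "inv a \<in> P" if "a \<in> P" "b \<in> P" for a b
    using that subgroup.m_closed[OF P(1)] subgroup.m_inv_closed[OF P(1)] by auto
  have fS: "finite S" using S(1) subgroup_fin[OF P(1)] finite_subset by blast
  have r1: "w = \<one>" if "w \<in> P" "w [^] r = \<one>" "w [^] (3::nat) = \<one>" for w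
  proof -
    have "ord w dvd r" "ord w dvd 3" using that PG pow_eq_id by blast+
    moreover have "coprime r 3" using r prime_imp_coprime[of 3 r] by (simp add: coprime_commute)
    ultimately have "ord w dvd 1" using coprime_common_divisor[of r 3 "ord w"] by simp
    then show ?thesis using ord_eq_1[of w] PG[OF that(1)] by simp
  qed
  have S3: "s [^] (3::nat) = \<one>" if "s \<in> S" for s using S(2)[OF that] pow_eq_id[of s 3] S(1) PG that by auto
  have mult_pow: "(a \<otimes> b) [^] (i::nat) = a [^] i \<otimes> b [^] i" if "a \<in> P" "b \<in> P" for a b i
    using Q.nat_pow_distrib[of a b i] that by (simp flip: nat_pow_consistent)
  obtain a where a: "a \<in> S" using card_S by (metis card.empty dvd_0_right ex_in_conv)
  have aP: "a \<in> P" and aG: "a \<in> carrier G" using a S(1) PG by auto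
  have a1: "a \<noteq> \<one>" using S(2)[OF a] by auto
  have prodw: "w = \<one>" if "finprod ?PG (\<lambda>s. s [^]\<^bsub>?PG\<^esub> r) S = w [^] r" "w \<in> P" "w [^] (3::nat) = \<one>"
      "finprod ?PG (\<lambda>s. s [^]\<^bsub>?PG\<^esub> r) S = \<one>" for w
    using r1 that by metis
  have pow_closed: "b [^] (i::nat) \<in> P" if "b \<in> P" for b i using pow_in_subgroup[OF P(1) that] .
  show ?thesis
  proof (cases "S = {a}")
    case True
    have "finprod ?PG (\<lambda>s. s [^]\<^bsub>?PG\<^esub> r) S = a [^] r"
      unfolding True pw using Q.finprod_insert[of "{}" a "\<lambda>s. s [^] r"] pow_closed aP PG[OF pow_closed[OF aP]] by simp
    then show ?thesis using prodw[OF _ aP S3[OF a]] a1 by blast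
  next
    case False
    then obtain b where b: "b \<in> S" "b \<noteq> a" using a by blast
    have bP: "b \<in> P" and bG: "b \<in> carrier G" using b S(1) PG by auto
    have b1: "b \<noteq> \<one>" using S(2)[OF b(1)] by auto
    have ia: "inv a \<noteq> b" "inv b \<noteq> a" using S(3) a b by auto
    let ?A = "generate G {a}" and ?B = "generate G {b}"
    have gA: "?A = {\<one>, a, inv a}" "?B = {\<one>, b, inv b}"
      using generate_order_3[OF aG S(2)[OF a]] generate_order_3[OF bG S(2)[OF b(1)]] by simp_all
    have cAB: "card ?A = 3" "card ?B = 3" using generate_pow_card[OF aG] generate_pow_card[OF bG] S(2)[OF a] S(2)[OF b(1)] by simp_all
    have "b \<notin> ?A" using gA b b1 ia by auto
    then have "?A \<noteq> ?B" using generate_self by metis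
    then have triv: "?A \<inter> ?B = {\<one>}" using prime_subgroups_Int[of ?A ?B] aG bG cAB by simp
    have "card (?A <#> ?B) = 9"
      using card_set_mult_trivial_Int[OF _ _ triv] aG bG cAB by simp
    moreover have sub: "?A <#> ?B \<subseteq> P"
      by (rule set_mult_subset_subgroup[OF P(1)]) (use generate_subset[OF P(1)] aP bP in auto)
    moreover have "card P \<le> 9" using P(2) by (rule dvd_imp_le) simp
    ultimately have PAB: "P = ?A <#> ?B" using card_seteq[OF subgroup_fin[OF P(1)] sub] by simp
    let ?d = "a \<otimes> b" and ?e = "a \<otimes> inv b"
    have dP: "?d \<in> P" "?e \<in> P" "inv ?d \<in> P" "inv ?e \<in> P" using cl aP bP by auto
    have inv_d: "inv ?d = inv a \<otimes> inv b" "inv ?e = inv a \<otimes> b"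
      using aG bG comm[OF cl(2)[OF bP bP] cl(2)[OF aP aP]] comm[OF bP cl(2)[OF aP aP]] by (simp_all add: inv_mult_group)
    \<comment> \<open>Of the nine elements of \<open>P\<close>, the identity and the inverses of
      \<open>a\<close> and \<open>b\<close> cannot belong to \<open>S\<close>.\<close>
    have cases: "s \<in> {a, b, ?d, inv ?d, ?e, inv ?e}" if s: "s \<in> S" for s
    proof -
      obtain i j where ij: "i \<in> ?A" "j \<in> ?B" "s = i \<otimes> j" using s S(1) PAB by (auto simp: set_mult_def)
      have "s \<noteq> \<one>" "s \<noteq> inv a" "s \<noteq> inv b" using S(2)[OF s] S(3)[OF a] S(3)[OF b(1)] s by auto
      then show ?thesis using ij unfolding gA inv_d using aG bG by auto
    qed
    have not_both: "\<not> (?d \<in> S \<and> inv ?d \<in> S)" "\<not> (?e \<in> S \<and> inv ?e \<in> S)" using S(3) by auto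
    have w3: "(u \<otimes> v) [^] (3::nat) = \<one>" if "u \<in> P" "v \<in> P" "u [^] (3::nat) = \<one>" "v [^] (3::nat) = \<one>" for u v
      using mult_pow that by simp
    define D where "D = S \<inter> {?d, inv ?d}"
    define E where "E = S \<inter> {?e, inv ?e}"
    have aa: "a \<otimes> a = inv a" and bb: "b \<otimes> b = inv b"
    proof -
      have "a \<otimes> a \<otimes> a = \<one>" "b \<otimes> b \<otimes> b = \<one>" using S3[OF a] S3[OF b(1)] aG bG by (simp_all add: numeral_3_eq_3)
      then show "a \<otimes> a = inv a" "b \<otimes> b = inv b"
        using inv_equality[of "a \<otimes> a" a] inv_equality[of "b \<otimes> b" b] aG bG by simp_all
    qed
    have ab: "a \<otimes> b = b \<otimes> a" "a \<otimes> inv b = inv b \<otimes> a" "inv a \<otimes> b = b \<otimes> inv a"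
      "inv a \<otimes> inv b = inv b \<otimes> inv a"
      by (rule comm[OF aP bP] comm[OF aP cl(2)[OF bP bP]] comm[OF cl(2)[OF aP aP] bP]
          comm[OF cl(2)[OF aP aP] cl(2)[OF bP bP]])+
    have SDE: "S = {a, b} \<union> (D \<union> E)" using cases a b unfolding D_def E_def by blast
    have cD: "card D \<le> 1" "card E \<le> 1"
    proof -
      have "D = {} \<or> (\<exists>u. D = {u})" "E = {} \<or> (\<exists>u. E = {u})"
        using not_both unfolding D_def E_def by blast+
      then show "card D \<le> 1" "card E \<le> 1" by auto
    qed
    have cS: "card S \<le> 2 + (card D + card E)"
      using SDE card_Un_le[of "{a, b}" "D \<union> E"] card_Un_le[of D E] b by simp
    have "card {a, b} \<le> card S" using a b fS by (intro card_mono) auto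
    then have "card S \<ge> 2" using b by simp
    \<comment> \<open>\<open>S\<close> contains \<open>a\<close>, \<open>b\<close> and at most one
      element from each of the two remaining inverse pairs; size 3 is excluded by
      \<open>card_S\<close>.\<close>
    then consider "card S = 2" | "card S = 4" using cS cD card_S by (cases "card S = 3") force+
    then show ?thesis
    proof cases
      case 1
      then have "S = {a, b}" using card_subset_eq[OF fS, of "{a, b}"] a b by simp
      then have "finprod ?PG (\<lambda>s. s [^]\<^bsub>?PG\<^esub> r) S = a [^] r \<otimes> b [^] r"
        unfolding pw using Q.finprod_insert[of "{b}" a "\<lambda>s. s [^] r"] Q.finprod_insert[of "{}" b "\<lambda>s. s [^] r"]
          pow_closed aP bP b PG[OF pow_closed[OF bP]] by simp
      also have "\<dots> = ?d [^] r" using mult_pow[OF aP bP] by simp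
      finally have e: "finprod ?PG (\<lambda>s. s [^]\<^bsub>?PG\<^esub> r) S = ?d [^] r" .
      have "?d \<noteq> \<one>"
      proof
        assume "?d = \<one>"
        then have "inv b = a" using inv_equality[of a b] aG bG by simp
        then show False using ia by simp
      qed
      then show ?thesis using prodw[OF e dP(1) w3[OF aP bP S3[OF a] S3[OF b(1)]]] by blast
    next
      case 2
      then have "card D = 1" "card E = 1" using cS cD by auto
      then obtain u v where uv: "D = {u}" "E = {v}" using card_1_singletonE by metis
      have u: "u \<in> S" "u = ?d \<or> u = inv ?d" and v: "v \<in> S" "v = ?e \<or> v = inv ?e"
        using uv unfolding D_def E_def by blast+
      have uvP: "u \<in> P" "v \<in> P" using u v S(1) by auto
      have Seq: "S = {a, b, u, v}" using SDE uv by auto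
      have dist: "a \<notin> {b, u, v}" "b \<notin> {u, v}" "u \<notin> {v}"
        using 2 unfolding Seq by (auto simp: card_insert_if split: if_splits)
      let ?w = "a \<otimes> (b \<otimes> (u \<otimes> v))"
      have "finprod ?PG (\<lambda>s. s [^]\<^bsub>?PG\<^esub> r) S = a [^] r \<otimes> (b [^] r \<otimes> (u [^] r \<otimes> v [^] r))"
        unfolding pw Seq
        using Q.finprod_insert[of "{b, u, v}" a "\<lambda>s. s [^] r"] Q.finprod_insert[of "{u, v}" b "\<lambda>s. s [^] r"]
          Q.finprod_insert[of "{v}" u "\<lambda>s. s [^] r"] Q.finprod_insert[of "{}" v "\<lambda>s. s [^] r"]
          pow_closed aP bP uvP dist PG[OF pow_closed[OF uvP(2)]] by simp
      also have "\<dots> = ?w [^] r" using mult_pow aP bP uvP cl(1) by simp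
      finally have e: "finprod ?PG (\<lambda>s. s [^]\<^bsub>?PG\<^esub> r) S = ?w [^] r" .
      have wP: "?w \<in> P" using cl(1) aP bP uvP by simp
      have w3: "?w [^] (3::nat) = \<one>" using w3 S3 a b u v aP bP uvP cl(1) by simp
      \<comment> \<open>The four sign choices for \<open>u\<close> and \<open>v\<close> make their
        product a square of \<open>a\<close> or \<open>b\<close> or the inverse of such a square.
        Multiplied by \<open>a \<otimes> b\<close>, none of these becomes trivial.\<close>
      have "u \<otimes> v = inv a \<or> u \<otimes> v = inv b \<or> u \<otimes> v = b \<or> u \<otimes> v = a"
      proof -
        have "?d \<otimes> ?e = a \<otimes> a" unfolding ab(2) using aG bG by (simp add: word)
        moreover have "?d \<otimes> inv ?e = b \<otimes> b" unfolding inv_d(2) ab(1) using aG bG by (simp add: word)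
        moreover have "inv ?d \<otimes> ?e = inv (b \<otimes> b)" using aG bG by (simp add: word)
        moreover have "inv ?d \<otimes> inv ?e = inv (a \<otimes> a)" unfolding inv_d(1) using aG bG by (simp add: word)
        ultimately show ?thesis using u(2) v(2) aG bG unfolding aa bb by auto
      qed
      moreover have "a \<otimes> (b \<otimes> inv a) = b" using ab(3) aG bG by (simp add: word flip: ab(3))
      moreover have "a \<otimes> (b \<otimes> inv b) = a" using aG bG by simp
      moreover have "a \<otimes> (b \<otimes> b) \<noteq> \<one>" unfolding bb
      proof
        assume "a \<otimes> inv b = \<one>"
        then have "a = b" using inv_equality[of a "inv b"] aG bG by simp
        then show False using b by simp
      qed
      moreover have "a \<otimes> (b \<otimes> a) \<noteq> \<one>"
      proof
        assume "a \<otimes> (b \<otimes> a) = \<one>"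
        then have "(a \<otimes> a) \<otimes> b = \<one>" using aG bG by (simp add: m_assoc ab(1))
        then have "inv b = inv a" unfolding aa using inv_equality[of "inv a" b] aG bG by simp
        then have "inv (inv b) = inv (inv a)" by simp
        then show False using b aG bG by simp
      qed
      ultimately have "?w \<noteq> \<one>" using a1 b1 by auto
      then show ?thesis using prodw[OF e wP w3] by blast
    qed
  qed
qed

text \<open>\<open>P\<close> is a Sylow 3-subgroup conjugated so as to contain \<open>c\<close>. The
  transfer of \<open>c\<close> is the product of \<open>s [^] r\<close> over the set
  \<open>S\<close> of conjugates of \<open>c\<close> in \<open>P\<close>, where \<open>r\<close> is
  the index of \<open>P\<close> in the centralizer of \<open>c\<close>. Oddness keeps inverse pairs
  out of \<open>S\<close>, and \<open>r * card S\<close> is congruent modulo 3 to the index of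
  \<open>P\<close>, so 3 divides neither factor.\<close>

theorem (in two_gen) order_3_commutator_odd:
  assumes odd: "odd (card (carrier G))" and o3: "card C = 3" shows "27 dvd card (carrier G)"
proof (rule ccontr)
  assume n27: "\<not> 27 dvd card (carrier G)"
  have oc: "ord c = 3" using o3 card_C by simp
  have c3: "c [^] (3::nat) = \<one>" using oc pow_eq_id[of c 3] by simp
  have p3: "prime (3::nat)" by simp
  obtain P0 e where P0: "transversal G P0" "card P0 = 3 ^ e" "\<not> 3 dvd card (transversal.T G P0)"
      "3 ^ e dvd card (carrier G)"
    using sylow_transversal[OF p3] by blast
  interpret T0: transversal G P0 by (rule P0)
  obtain t where t: "t \<in> carrier G" "inv t \<otimes> c \<otimes> t \<in> P0"
    using T0.conj_into_subgroup[OF c_closed p3 c3 P0(3)] by blast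
  define P where "P = cnj t ` P0"
  have P0G: "P0 \<subseteq> carrier G" using T0.P by (rule subgroup.subset)
  have sP: "subgroup P G" unfolding P_def by (rule subgroup_cnj[OF t(1) T0.P])
  have cardP: "card P = 3 ^ e" using t P0 P0G by (simp add: P_def)
  note PG = subgroup.mem_carrier[OF sP]
  have "cnj (inv t) c \<in> P0" using t by (simp add: cnj_def)
  then have cP: "c \<in> P" using mem_cnj_image[OF t(1) P0G c_closed] by (simp add: P_def)
  have "e \<le> 2"
  proof (rule ccontr)
    assume "\<not> e \<le> 2"
    then have "(3::nat) ^ 3 dvd 3 ^ e" by (intro le_imp_power_dvd) simp
    then show False using P0(4) n27 by (auto dest: dvd_trans)
  qed
  then have P9: "card P dvd 3 ^ 2" unfolding cardP by (rule le_imp_power_dvd)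
  have c1: "c \<noteq> \<one>" using oc by auto
  have central: "k \<otimes> c = c \<otimes> k" if "k \<in> P" for k
    using order_3_normal_in_9[OF odd sP _ cP oc that] P9 by simp
  have comm: "a \<otimes> b = b \<otimes> a" if "a \<in> P" "b \<in> P" for a b
    using p_squared_subgroup_comm[OF sP p3 P9 cP c1 central that] .
  interpret Tr: transfer G P
    by (intro transfer.intro transversal.intro transversal_axioms.intro transfer_axioms.intro
          finite_group_axioms sP) (rule comm)
  let ?PG = "G\<lparr>carrier := P\<rparr>"
  interpret Q: comm_group ?PG by (rule Tr.PG_comm)
  have "card Tr.T * 3 ^ e = card T0.T * 3 ^ e" using Tr.card_T T0.card_T P0(2) cardP by metis
  then have T3: "\<not> 3 dvd card Tr.T" using P0(3) by simp
  define f where "f = (\<lambda>t. inv t \<otimes> c \<otimes> t)"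
  have fcnj: "f t = cnj (inv t) c" if "t \<in> carrier G" for t using that by (simp add: f_def cnj_def)
  let ?F = "{t \<in> Tr.T. f t \<in> P}"
  define S where "S = f ` ?F"
  have V1: "finprod ?PG f ?F = \<one>"
    using Tr.V_eval[OF c_closed p3 c3] Tr.V_comtr[OF x y] by (simp add: f_def)
  let ?Z = "{g \<in> carrier G. \<forall>a\<in>{c}. g \<otimes> a = a \<otimes> g}"
  have sZ: "subgroup ?Z G" using centralizer_subgroup[of "{c}"] by simp
  have PZ: "P \<subseteq> ?Z" using central PG by auto
  obtain r where r: "card ?Z = card P * r" using card_subgroup_dvd[OF sP sZ PZ] by blast
  have fP: "f (t \<otimes> p) = f t" if "t \<in> carrier G" "p \<in> P" "f t \<in> P" for t p
  proof -
    have "f (t \<otimes> p) = inv p \<otimes> (f t \<otimes> p)" using that PG by (simp add: f_def word)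
    also have "f t \<otimes> p = p \<otimes> f t" using comm that by blast
    also have "inv p \<otimes> (p \<otimes> f t) = f t" using that PG by (simp add: cancel2)
    finally show ?thesis .
  qed
  \<comment> \<open>The elements \<open>g\<close> with \<open>f g = s\<close> form a coset of the
    centralizer \<open>?Z\<close>, which has \<open>card P * r\<close> elements; each representative
    \<open>t\<close> accounts for \<open>card P\<close> of them.\<close>
  have fib: "card {t \<in> Tr.T. f t = s} = r" if s: "s \<in> S" for s
  proof -
    obtain t0 where t0: "t0 \<in> Tr.T" "f t0 = s" "s \<in> P" using s by (auto simp: S_def)
    have t0G: "t0 \<in> carrier G" by (rule Tr.T_carrier[OF t0(1)])
    have "bij_betw (\<lambda>(t, p). t \<otimes> p) ({t \<in> Tr.T. f t = s} \<times> P) {g \<in> carrier G. f g = s}"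
    proof (rule bij_betwI[where g = "\<lambda>g. (Tr.rep g, inv (Tr.rep g) \<otimes> g)"])
      show "(\<lambda>(t, p). t \<otimes> p) \<in> {t \<in> Tr.T. f t = s} \<times> P \<rightarrow> {g \<in> carrier G. f g = s}"
        using fP t0(3) Tr.T_carrier PG by auto
      show "(\<lambda>g. (Tr.rep g, inv (Tr.rep g) \<otimes> g)) \<in> {g \<in> carrier G. f g = s} \<rightarrow> {t \<in> Tr.T. f t = s} \<times> P"
      proof
        fix g assume g: "g \<in> {g \<in> carrier G. f g = s}"
        then obtain p where p: "p \<in> P" "Tr.rep g = g \<otimes> p" using Tr.rep_ex by blast
        then have "f (Tr.rep g) = s" using fP[of g p] g t0(3) by simp
        then show "(Tr.rep g, inv (Tr.rep g) \<otimes> g) \<in> {t \<in> Tr.T. f t = s} \<times> P"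
          using g Tr.rep_in_T Tr.inv_rep_mult by simp
      qed
    qed (auto simp: Tr.T_carrier PG Tr.rep_mult Tr.rep_T cancel1 cancel2)
    from bij_betw_same_card[OF this]
    have "card {t \<in> Tr.T. f t = s} * card P = card {g \<in> carrier G. f g = s}" by (simp add: card_cartesian_product)
    also have "\<dots> = card ?Z"
    proof (rule bij_betw_same_card[of "\<lambda>g. g \<otimes> inv t0"], rule bij_betwI[where g = "\<lambda>z. z \<otimes> t0"])
      show "(\<lambda>g. g \<otimes> inv t0) \<in> {g \<in> carrier G. f g = s} \<rightarrow> ?Z"
      proof
        fix g assume "g \<in> {g \<in> carrier G. f g = s}"
        then have g: "g \<in> carrier G" "inv g \<otimes> c \<otimes> g = inv t0 \<otimes> c \<otimes> t0" using t0 by (auto simp: f_def)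
        have "g \<otimes> inv t0 \<otimes> c = g \<otimes> (inv t0 \<otimes> c \<otimes> t0) \<otimes> inv t0" using g(1) t0G by (simp add: word)
        also have "\<dots> = c \<otimes> (g \<otimes> inv t0)" unfolding g(2)[symmetric] using g(1) t0G by (simp add: word)
        finally show "g \<otimes> inv t0 \<in> ?Z" using g t0G by simp
      qed
      show "(\<lambda>z. z \<otimes> t0) \<in> ?Z \<rightarrow> {g \<in> carrier G. f g = s}"
      proof
        fix z assume z: "z \<in> ?Z"
        have "f (z \<otimes> t0) = inv t0 \<otimes> (inv z \<otimes> (c \<otimes> z)) \<otimes> t0" using z t0G by (simp add: f_def word)
        also have "c \<otimes> z = z \<otimes> c" using z by simp
        also have "inv z \<otimes> (z \<otimes> c) = c" using z by (simp only: cancel2 mem_Collect_eq c_closed)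
        also have "inv t0 \<otimes> c \<otimes> t0 = s" using t0 by (simp add: f_def)
        finally show "z \<otimes> t0 \<in> {g \<in> carrier G. f g = s}" using z t0G by simp
      qed
    qed (use t0G in \<open>auto simp: word\<close>)
    finally show ?thesis using r subgroup_card_pos[OF sP] by simp
  qed
  have SP: "S \<subseteq> P" by (auto simp: S_def)
  have fS: "finite S" using SP subgroup_fin[OF sP] finite_subset by blast
  have fprod: "finprod ?PG f ?F = finprod ?PG (\<lambda>s. s [^]\<^bsub>?PG\<^esub> r) S"
  proof -
    have "finprod ?PG f {t \<in> ?F. f t \<in> S} = finprod ?PG (\<lambda>s. s [^]\<^bsub>?PG\<^esub> r) S"
    proof (rule Q.finprod_fibres[OF fS])
      fix s assume s: "s \<in> S"
      then have "{t \<in> ?F. f t = s} = {t \<in> Tr.T. f t = s}" using SP by auto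
      then show "card {t \<in> ?F. f t = s} = r" using fib[OF s] by simp
    qed (use Tr.fin_T SP in auto)
    moreover have "{t \<in> ?F. f t \<in> S} = ?F" by (auto simp: S_def)
    ultimately show ?thesis by simp
  qed
  have cardF: "card ?F = r * card S"
  proof -
    have "?F = (\<Union>s\<in>S. {t \<in> Tr.T. f t = s})" by (auto simp: S_def)
    also have "card \<dots> = (\<Sum>s\<in>S. card {t \<in> Tr.T. f t = s})"
      using fS Tr.fin_T by (intro card_UN_disjoint) auto
    also have "\<dots> = r * card S" using fib by simp
    finally show ?thesis .
  qed
  \<comment> \<open>The cosets fixed by \<open>c\<close> are those indexed by \<open>?F\<close>, so
    their number is congruent to the index of \<open>P\<close>.\<close>
  have "[card Tr.T = card {t \<in> Tr.T. Tr.rep (c \<otimes> t) = t}] (mod 3)"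
    by (rule card_fixed_cong[OF p3 Tr.fin_T])
      (auto simp: Tr.iterate_rep c3 Tr.T_carrier Tr.rep_T Tr.rep_in_T)
  moreover have "{t \<in> Tr.T. Tr.rep (c \<otimes> t) = t} = ?F"
    using Tr.rep_eq_iff by (auto simp: f_def Tr.T_carrier m_assoc)
  ultimately have "\<not> 3 dvd card ?F" using T3 by (metis cong_dvd_iff cong_sym)
  then have n3: "\<not> 3 dvd r" "\<not> 3 dvd card S" unfolding cardF by auto
  have conj: "\<exists>g\<in>carrier G. s = cnj g c" if "s \<in> S" for s
    using that fcnj Tr.T_carrier by (auto simp: S_def)
  have Sord: "ord s = 3" if "s \<in> S" for s
  proof -
    obtain g where g: "g \<in> carrier G" "s = cnj g c" using conj \<open>s \<in> S\<close> by blast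
    have "s [^] n = \<one> \<longleftrightarrow> 3 dvd n" for n :: nat
    proof -
      have "s [^] n = cnj g (c [^] n)" using g by (simp add: cnj_pow)
      moreover have "cnj g (c [^] n) = \<one> \<longleftrightarrow> c [^] n = \<one>" using inj_on_eq_iff[OF cnj_inj[OF g(1) subset_refl], of "c [^] n" \<one>] g by simp
      ultimately show ?thesis using pow_eq_id[of c n] oc by simp
    qed
    then show ?thesis using ord_unique[of s 3] g by simp
  qed
  have Sinv: "inv s \<notin> S" if "s \<in> S" for s
  proof
    assume "inv s \<in> S"
    then obtain h where h: "h \<in> carrier G" "inv s = cnj h c" using conj by blast
    obtain g where g: "g \<in> carrier G" "s = cnj g c" using conj \<open>s \<in> S\<close> by blast
    have "cnj (h \<otimes> inv g) s = inv s" using g h by (simp add: cnj_cnj m_assoc)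
    then show False using no_real_element_if_odd[OF odd, of "h \<otimes> inv g" s] Sord[OF \<open>s \<in> S\<close>] g h by simp
  qed
  have "card P dvd 9" using P9 by simp
  from prod_half_system_nontrivial[OF sP this comm SP Sord Sinv n3(2,1)]
  show False using V1 fprod by simp
qed

subsection \<open>Extensions by cyclic groups\<close>

text \<open>Supplies the multipliers of the split extensions; a unit \<open>u - 1\<close> gives the
  commutator full order \<open>m\<close>. If \<open>p\<close> already divides \<open>x\<close>, then
  \<open>u ^ p\<close> works: the power lifts the congruence from \<open>x\<close> to
  \<open>p * x\<close>, and \<open>p = 1 + q * j\<close> keeps it congruent to \<open>u\<close>
  modulo \<open>x\<close>. If \<open>p\<close> is new, an element of order \<open>q\<close> modulo
  \<open>p\<close> is combined with \<open>u\<close> by the Chinese remainder theorem.\<close>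

lemma exists_unit_of_prime_order:
  fixes q m :: nat
  assumes q: "prime q"
  shows "m > 0 \<Longrightarrow> (\<And>p. prime p \<Longrightarrow> p dvd m \<Longrightarrow> [p = 1] (mod q)) \<Longrightarrow>
    \<exists>u::nat. [int u ^ q = 1] (mod int m) \<and> coprime (int u - 1) (int m)"
proof (induction m rule: prime_divisors_induct)
  case (unit x) then show ?case by (auto intro!: exI[of _ 0])
next
  case (factor p x)
  have x0: "x > 0" using factor.prems by simp
  obtain u where u: "[int u ^ q = 1] (mod int x)" "coprime (int u - 1) (int x)"
    using factor.IH[OF x0] factor.prems(2) by (meson dvd_mult)
  have pq: "[p = 1] (mod q)" using factor by simp
  have p1: "p > 1" using factor.hyps prime_gt_1_nat by blast
  obtain j where j: "p = 1 + q * j"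
    using pq p1 by (metis One_nat_def cong_to_1_nat dvdE le_add_diff_inverse less_imp_le_nat)
  have j0: "j > 0" using p1 j by (cases j) auto
  show ?case
  proof (cases "p dvd x")
    case True
    obtain t where t: "int u ^ q = 1 + int x * t"
      using u(1) by (metis add.commute cong_iff_lin cong_sym mult.commute)
    have "[(int u ^ p) ^ q = 1] (mod int (p * x))"
    proof -
      have "(int u ^ p) ^ q = (1 + int x * t) ^ p" by (metis t mult.commute power_mult)
      moreover have "(1 + int x * t) ^ p - 1 = (int x * t) * (\<Sum>i<p. (1 + int x * t) ^ i)"
        using power_diff_1_eq[of "1 + int x * t" p] by simp
      moreover have "int p dvd (\<Sum>i<p. (1 + int x * t) ^ i)"
      proof -
        have "[(1 + int x * t) ^ i = 1 ^ i] (mod int p)" for i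
          by (intro cong_pow) (use True in \<open>simp add: cong_iff_dvd_diff\<close>)
        then have "[(\<Sum>i<p. (1 + int x * t) ^ i) = (\<Sum>i<p. 1)] (mod int p)" by (intro cong_sum) simp
        then show ?thesis by (simp add: cong_0_iff[symmetric] cong_def)
      qed
      ultimately show ?thesis by (simp add: cong_iff_dvd_diff)
    qed
    moreover have "coprime (int u ^ p - 1) (int (p * x))"
    proof -
      have "int u ^ p = int u * (int u ^ q) ^ j" by (simp add: j power_mult)
      moreover have "[int u * (int u ^ q) ^ j = int u * 1 ^ j] (mod int x)"
        by (intro cong_mult cong_pow u(1)) simp
      ultimately have "[int u ^ p - 1 = int u - 1] (mod int x)" by (simp add: cong_diff)
      then have "coprime (int u ^ p - 1) (int x)" using u(2) cong_imp_coprime cong_sym by blast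
      moreover have "coprime (int u ^ p - 1) (int p)"
        using calculation True by (meson coprime_divisors dvd_refl int_dvd_int_iff)
      ultimately show ?thesis by simp
    qed
    ultimately show ?thesis by (intro exI[of _ "u ^ p"]) simp
  next
    case False
    then have cop: "coprime x p" using factor.hyps prime_imp_coprime coprime_commute by blast
    obtain g where g: "residue_primroot p g" using prime_primitive_root_exists[of p] factor.hyps p1 by auto
    have og: "ord p g = q * j"
      using g factor.hyps j by (simp add: residue_primroot_def totient_prime)
    \<comment> \<open>\<open>g\<close> has order \<open>p - 1 = q * j\<close> modulo
      \<open>p\<close>, so this power has order \<open>q\<close>.\<close>
    define v where "v = g ^ j"
    have v1: "[v ^ q = 1] (mod p)"
      using ord_divides[of g "j * q" p] og by (simp add: v_def power_mult[symmetric] mult.commute)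
    have v2: "\<not> [v = 1] (mod p)"
    proof
      assume "[v = 1] (mod p)"
      then have "q * j dvd j" using ord_divides[of g j p] og by (simp add: v_def)
      then show False using j0 prime_gt_1_nat[OF q] by (auto dest!: dvd_imp_le)
    qed
    obtain w where w: "[w = u] (mod x)" "[w = v] (mod p)" using binary_chinese_remainder_nat[OF cop] by blast
    have wx: "[int w = int u] (mod int x)" and wp: "[int w = int v] (mod int p)"
      using w by (simp_all add: cong_int_iff)
    have "[int w ^ q = 1] (mod int x)" using u(1) cong_pow[OF wx, of q] cong_trans by blast
    moreover have "[int w ^ q = 1] (mod int p)"
    proof -
      have "[int (v ^ q) = int 1] (mod int p)" using v1 by (simp only: cong_int_iff)
      then show ?thesis using cong_pow[OF wp, of q] cong_trans by fastforce
    qed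
    ultimately have "[int w ^ q = 1] (mod int (p * x))"
      using coprime_cong_mult[of "int w ^ q" 1 "int x" "int p"] cop by (simp add: mult.commute)
    moreover have "coprime (int w - 1) (int x)"
      using u(2) cong_diff[OF wx cong_refl, of 1] cong_imp_coprime cong_sym by blast
    moreover have "coprime (int w - 1) (int p)"
    proof -
      have "\<not> int p dvd int w - 1"
      proof
        assume "int p dvd int w - 1"
        then have "[int w = 1] (mod int p)" by (simp add: cong_iff_dvd_diff)
        then have "[int v = int 1] (mod int p)" using wp cong_sym cong_trans by (metis of_nat_1)
        then show False using v2 by (simp only: cong_int_iff)
      qed
      then have "coprime (int p) (int w - 1)" using factor.hyps prime_imp_coprime[of "int p" "int w - 1"] by simp
      then show ?thesis using coprime_commute by blast
    qed
    ultimately show ?thesis by (intro exI[of _ w]) simp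
  qed
qed simp

text \<open>The data of a semidirect product with a cyclic group of order \<open>L\<close> whose
  generator acts as \<open>s\<close>. The period \<open>L\<close> may be a proper multiple of the
  order of \<open>s\<close>, as in the group of order \<open>27 * m\<close> below.\<close>

locale cyclic_extension = finite_group +
  fixes s :: "'a \<Rightarrow> 'a" and L :: nat
  assumes s_closed: "a \<in> carrier G \<Longrightarrow> s a \<in> carrier G"
    and s_mult: "a \<in> carrier G \<Longrightarrow> b \<in> carrier G \<Longrightarrow> s (a \<otimes> b) = s a \<otimes> s b"
    and s_period: "a \<in> carrier G \<Longrightarrow> (s ^^ L) a = a"
    and L_pos: "L > 0"
begin

definition ext :: "('a \<times> nat) monoid" where
  "ext = \<lparr>carrier = carrier G \<times> {..<L},
    mult = (\<lambda>(a, i) (b, j). (a \<otimes> (s ^^ i) b, (i + j) mod L)), one = (\<one>, 0)\<rparr>"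

lemma ext_simps [simp]: "carrier ext = carrier G \<times> {..<L}" "\<one>\<^bsub>ext\<^esub> = (\<one>, 0)"
  "(a, i) \<otimes>\<^bsub>ext\<^esub> (b, j) = (a \<otimes> (s ^^ i) b, (i + j) mod L)"
  by (simp_all add: ext_def)

lemma sp_closed [simp]: "a \<in> carrier G \<Longrightarrow> (s ^^ i) a \<in> carrier G"
  by (induction i) (simp_all add: s_closed)

lemma sp_mult: "a \<in> carrier G \<Longrightarrow> b \<in> carrier G \<Longrightarrow> (s ^^ i) (a \<otimes> b) = (s ^^ i) a \<otimes> (s ^^ i) b"
  by (induction i) (simp_all add: s_mult)

lemma sp_one [simp]: "(s ^^ i) \<one> = \<one>"
proof -
  have "(s ^^ i) \<one> \<otimes> (s ^^ i) \<one> = (s ^^ i) \<one>" using sp_mult[of \<one> \<one> i] by simp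
  then show ?thesis using sp_closed[of \<one> i] by (metis l_cancel_one' one_closed)
qed

lemma s_one: "s \<one> = \<one>"
  using sp_one[of 1] by simp

lemma sp_mod: "a \<in> carrier G \<Longrightarrow> (s ^^ (i mod L)) a = (s ^^ i) a"
  by (rule funpow_mod_eq) (rule s_period)

lemma s_inv: "a \<in> carrier G \<Longrightarrow> s (inv a) = inv (s a)"
proof -
  assume a: "a \<in> carrier G"
  have "s (inv a) \<otimes> s a = \<one>" using s_mult[of "inv a" a] sp_one[of 1] a by simp
  then show ?thesis using inv_equality[of "s (inv a)" "s a"] a s_closed by simp
qed

lemma ext_group: "finite_group ext"
proof -
  have "group ext"
  proof (rule groupI)
    fix u v w assume "u \<in> carrier ext" "v \<in> carrier ext" "w \<in> carrier ext"
    then show "u \<otimes>\<^bsub>ext\<^esub> v \<otimes>\<^bsub>ext\<^esub> w = u \<otimes>\<^bsub>ext\<^esub> (v \<otimes>\<^bsub>ext\<^esub> w)"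
      by (auto simp: sp_mult sp_mod m_assoc funpow_add add.assoc mod_simps)
  next
    fix u assume "u \<in> carrier ext"
    then obtain a i where u: "u = (a, i)" "a \<in> carrier G" "i < L" by auto
    let ?j = "(L - i) mod L"
    have "(?j + i) mod L = 0" using u(3) by (simp add: mod_simps)
    moreover have "(s ^^ ?j) a \<in> carrier G" using u by simp
    ultimately show "\<exists>v\<in>carrier ext. v \<otimes>\<^bsub>ext\<^esub> u = \<one>\<^bsub>ext\<^esub>"
      using u L_pos by (intro bexI[of _ "(inv ((s ^^ ?j) a), ?j)"]) auto
  qed (use L_pos in auto)
  then interpret E: group ext .
  show ?thesis by unfold_locales (simp add: fin)
qed

lemma embed_hom: "group_hom G ext (\<lambda>a. (a, 0))"
proof -
  interpret E: finite_group ext by (rule ext_group)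
  show ?thesis by unfold_locales (use L_pos in \<open>auto simp: hom_def\<close>)
qed

lemma card_ext: "card (carrier ext) = card (carrier G) * L"
  by (simp add: card_cartesian_product)

lemma inv_ext_generator: "L > 1 \<Longrightarrow> inv\<^bsub>ext\<^esub> (\<one>, 1) = (\<one>, L - 1)"
proof -
  interpret E: finite_group ext by (rule ext_group)
  show "L > 1 \<Longrightarrow> ?thesis" by (rule E.inv_equality) auto
qed

lemma inv_ext_embed: "a \<in> carrier G \<Longrightarrow> inv\<^bsub>ext\<^esub> (a, 0) = (inv a, 0)"
  using group_hom.hom_inv[OF embed_hom, of a] by simp

text \<open>The commutator of an element \<open>h\<close> of the base with the generator of the
  cyclic factor stays in the base: it is \<open>h \<otimes> inv (s h)\<close>.\<close>

lemma ext_card_commutator: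
  assumes L: "L > 1" and h: "h \<in> carrier G"
  shows "card (generate ext {comtr ext (h, 0) (\<one>, 1)}) = ord (h \<otimes> inv (s h))"
proof -
  have com: "comtr ext (h, 0) (\<one>, 1) = (h \<otimes> inv (s h), 0)"
    unfolding comtr_def inv_ext_embed[OF h] inv_ext_generator[OF L] using h L by (simp add: s_inv s_closed s_one)
  interpret e: group_hom G ext "\<lambda>a. (a, 0)" by (rule embed_hom)
  have cl: "h \<otimes> inv (s h) \<in> carrier G" using h s_closed by simp
  have "generate ext {(h \<otimes> inv (s h), 0)} = (\<lambda>a. (a, 0)) ` generate G {h \<otimes> inv (s h)}"
    using e.generate_img[of "{h \<otimes> inv (s h)}"] cl by simp
  then have "card (generate ext {(h \<otimes> inv (s h), 0)}) = card (generate G {h \<otimes> inv (s h)})"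
    by (simp add: card_image inj_on_def)
  then show ?thesis using com generate_pow_card[OF cl] by simp
qed

text \<open>Conjugation by the generator of the cyclic factor acts as \<open>s\<close> on the base,
  so the base part of the generated subgroup contains \<open>h\<close> and is invariant under
  \<open>s\<close>.\<close>

lemma ext_two_gen:
  assumes L: "L > 1" and h: "h \<in> carrier G"
    and gen: "\<And>D. subgroup D G \<Longrightarrow> h \<in> D \<Longrightarrow> (\<And>a. a \<in> D \<Longrightarrow> s a \<in> D) \<Longrightarrow> D = carrier G"
  shows "two_gen ext (h, 0) (\<one>, 1)"
proof -
  interpret E: finite_group ext by (rule ext_group)
  have mem: "(h, 0) \<in> carrier ext" "(\<one>, 1) \<in> carrier ext" using h L by auto
  let ?X = "generate ext {(h, 0), (\<one>, 1)}"
  have sX: "subgroup ?X ext" by (rule E.generate_is_subgroup) (use mem in simp)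
  have xy: "(h, 0) \<in> ?X" "(\<one>, 1) \<in> ?X" by (auto intro: generate.incl)
  let ?D = "{a \<in> carrier G. (a, 0) \<in> ?X}"
  have "?D = carrier G"
  proof (rule gen)
    show "subgroup ?D G"
    proof (rule subgroupI)
      show "?D \<noteq> {}" using h xy by auto
      show "inv a \<in> ?D" if "a \<in> ?D" for a
        using that subgroup.m_inv_closed[OF sX, of "(a, 0)"] inv_ext_embed by simp
      show "a \<otimes> b \<in> ?D" if "a \<in> ?D" "b \<in> ?D" for a b
        using that subgroup.m_closed[OF sX, of "(a, 0)" "(b, 0)"] by simp
    qed auto
    show "h \<in> ?D" using h xy by simp
    show "s a \<in> ?D" if a: "a \<in> ?D" for a
    proof -
      have "(\<one>, 1) \<otimes>\<^bsub>ext\<^esub> (a, 0) \<otimes>\<^bsub>ext\<^esub> inv\<^bsub>ext\<^esub> (\<one>, 1) \<in> ?X"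
        using a xy subgroup.m_closed[OF sX] subgroup.m_inv_closed[OF sX] by blast
      then show ?thesis unfolding inv_ext_generator[OF L] using a L s_closed by (simp add: s_one)
    qed
  qed
  moreover have "(\<one>, i) \<in> ?X" if "i < L" for i
    using that
  proof (induction i)
    case 0 then show ?case using subgroup.one_closed[OF sX] by simp
  next
    case (Suc i)
    then have "(\<one>, i) \<in> ?X" by simp
    from subgroup.m_closed[OF sX this xy(2)] show ?case using Suc.prems by simp
  qed
  ultimately have "(a, i) \<in> ?X" if "a \<in> carrier G" "i < L" for a i
    using that subgroup.m_closed[OF sX, of "(a, 0)" "(\<one>, i)"] by auto
  then have "carrier ext \<subseteq> ?X" by auto
  then show "two_gen ext (h, 0) (\<one>, 1)"
    using mem subgroup.subset[OF sX] by unfold_locales auto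
qed

end

lemma integer_mod_finite_group:
  "N > 0 \<Longrightarrow> finite_group (integer_mod_group N)"
  by (intro finite_group.intro finite_group_axioms.intro) (simp_all add: carrier_integer_mod_group)

lemma funpow_mult_mod: "((\<lambda>a. (u * a) mod N) ^^ i) a mod N = (u ^ i * a) mod (N::int)"
proof (induction i)
  case (Suc i)
  have "((\<lambda>a. (u * a) mod N) ^^ Suc i) a mod N = (u * (((\<lambda>a. (u * a) mod N) ^^ i) a mod N)) mod N"
    by (simp add: mod_mult_right_eq)
  also have "\<dots> = (u * (u ^ i * a)) mod N" unfolding Suc by (rule mod_mult_right_eq)
  finally show ?case by (simp add: mult.assoc)
qed simp

lemma integer_mod_subgroup_one:
  assumes N: "N > 0" and D: "subgroup D (integer_mod_group N)" "1 mod int N \<in> D"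
  shows "D = carrier (integer_mod_group N)"
proof -
  interpret finite_group "integer_mod_group N" by (rule integer_mod_finite_group[OF N])
  have "a \<in> D" if a: "a \<in> carrier (integer_mod_group N)" for a
  proof -
    have "(1 mod int N) [^]\<^bsub>integer_mod_group N\<^esub> nat a \<in> D" by (rule pow_in_subgroup[OF D])
    then show ?thesis using a N by (simp add: carrier_integer_mod_group mod_simps)
  qed
  then show ?thesis using subgroup.subset[OF D(1)] by blast
qed

text \<open>The split extensions of \<open>\<int>/N\<close> by \<open>\<int>/L\<close>, where the generator of \<open>\<int>/L\<close> acts as multiplication
  by \<open>u\<close>.\<close>

lemma metacyclic_two_gen:
  fixes u :: int
  assumes N: "N > 0" and L: "L > 1" and u: "[u ^ L = 1] (mod int N)"
    and n: "\<And>i::nat. int N dvd int i * (1 - u) \<longleftrightarrow> n dvd i"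
  shows "\<exists>(G :: (int \<times> nat) monoid) x y. two_gen G x y \<and> card (generate G {comtr G x y}) = n
    \<and> card (carrier G) = N * L"
proof -
  let ?H = "integer_mod_group N"
  let ?s = "\<lambda>a. (u * a) mod int N"
  interpret H: finite_group ?H by (rule integer_mod_finite_group[OF N])
  have car: "carrier ?H = {0..<int N}" using N by (simp add: carrier_integer_mod_group)
  interpret cyclic_extension ?H ?s L
  proof
    fix a assume a: "a \<in> carrier ?H"
    show "?s a \<in> carrier ?H" using N by (simp add: car)
    show "?s (a \<otimes>\<^bsub>?H\<^esub> b) = ?s a \<otimes>\<^bsub>?H\<^esub> ?s b" for b by (simp add: mod_simps distrib_left)
    have "(?s ^^ L) a \<in> carrier ?H" using a N by (cases L) (auto simp: car)
    then have "(?s ^^ L) a = (u ^ L * a) mod int N" using funpow_mult_mod[of L u "int N" a] by (simp add: car)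
    also have "\<dots> = a" using cong_mult[OF u cong_refl, of a] a by (simp add: cong_def car)
    finally show "(?s ^^ L) a = a" .
  qed (use L in simp)
  let ?h = "1 mod int N"
  have h: "?h \<in> carrier ?H" using N by (simp add: car)
  have gen: "D = carrier ?H" if "subgroup D ?H" "?h \<in> D" for D
    using integer_mod_subgroup_one[OF N that] .
  have hs: "?h \<otimes>\<^bsub>?H\<^esub> inv\<^bsub>?H\<^esub> (?s ?h) = (1 - u) mod int N"
    using N by (simp add: car mod_simps)
  have "H.ord ((1 - u) mod int N) = n"
    using N n by (subst H.ord_unique) (simp_all add: car mod_simps dvd_eq_mod_eq_0[symmetric])
  then have "card (generate ext {comtr ext (?h, 0) (\<one>\<^bsub>?H\<^esub>, 1)}) = n"
    using ext_card_commutator[OF L h] hs by simp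
  moreover have "two_gen ext (?h, 0) (\<one>\<^bsub>?H\<^esub>, 1)" by (rule ext_two_gen[OF L h]) (rule gen)
  moreover have "card (carrier ext) = N * L" using card_ext car by simp
  ultimately show ?thesis by blast
qed

text \<open>For \<open>m = 1\<close> this is the Heisenberg group of order 27. The shear
  \<open>?s\<close> has order 3, and \<open>m\<close> lengthens the cyclic factor; the commutator is
  the vector \<open>(0, 2)\<close>, which the shear fixes.\<close>

lemma heisenberg_two_gen:
  assumes m: "m > 0"
  shows "\<exists>(G :: ((int \<times> int) \<times> nat) monoid) x y. two_gen G x y
    \<and> card (generate G {comtr G x y}) = 3 \<and> card (carrier G) = 27 * m"
proof -
  let ?Z = "integer_mod_group 3"
  let ?H = "?Z \<times>\<times> ?Z"
  let ?s = "\<lambda>(b, c). (b, (c + b) mod 3) :: int \<times> int"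
  have car: "carrier ?H = {0..<3} \<times> {0..<3}" by (simp add: carrier_integer_mod_group)
  interpret Z: group ?Z by simp
  interpret H: group ?H by (rule DirProd_group) simp_all
  interpret H: finite_group ?H by unfold_locales (simp add: carrier_integer_mod_group)
  have sp: "(?s ^^ i) (b, c) = (b, (c + int i * b) mod 3)" if "0 \<le> c" "c < 3" for i b c
    using that by (induction i) (simp_all add: mod_simps algebra_simps)
  interpret cyclic_extension ?H ?s "3 * m"
  proof
    fix a assume a: "a \<in> carrier ?H"
    then obtain b c where bc: "a = (b, c)" "0 \<le> c" "c < 3" "0 \<le> b" "b < 3" unfolding car by auto
    show "?s a \<in> carrier ?H" using bc by (simp add: carrier_integer_mod_group)
    show "?s (a \<otimes>\<^bsub>?H\<^esub> d) = ?s a \<otimes>\<^bsub>?H\<^esub> ?s d" for d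
      by (cases d) (simp add: bc(1) mod_add_eq ac_simps)
    show "(?s ^^ (3 * m)) a = a" using sp[OF bc(2,3)] bc by (simp add: mult.assoc)
  qed (use m in simp)
  have h: "(1, 0) \<in> carrier ?H" by (simp add: carrier_integer_mod_group)
  have gen: "D = carrier ?H" if D: "subgroup D ?H" "(1, 0) \<in> D" "\<And>a. a \<in> D \<Longrightarrow> ?s a \<in> D" for D
  proof -
    have i: "inv\<^bsub>?H\<^esub> (1, 0) = (2, 0)"
      by (rule H.inv_equality) (auto simp: carrier_integer_mod_group)
    have d1: "(1, 1) \<in> D" using D(3)[OF D(2)] by simp
    have d2: "(2, 0) \<in> D" using subgroup.m_inv_closed[OF D(1,2)] i by simp
    have d3: "(0, 1) \<in> D" using subgroup.m_closed[OF D(1) d1 d2] by simp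
    have d4: "(0, 2) \<in> D" using subgroup.m_closed[OF D(1) d3 d3] by simp
    have d5: "(0, 0) \<in> D" using subgroup.one_closed[OF D(1)] by simp
    have "(b, c) \<in> D" if "b \<in> {0, 1, 2}" "c \<in> {0, 1, 2}" for b c
    proof -
      have "(b, 0) \<in> D" "(0, c) \<in> D" using that d2 d3 d4 d5 D(2) by auto
      from subgroup.m_closed[OF D(1) this] show ?thesis using that by auto
    qed
    moreover have "{0..<3} = {0, 1, 2::int}" by auto
    ultimately have "carrier ?H \<subseteq> D" unfolding car by auto
    then show ?thesis using subgroup.subset[OF D(1)] by blast
  qed
  have hs: "(1, 0) \<otimes>\<^bsub>?H\<^esub> inv\<^bsub>?H\<^esub> (?s (1, 0)) = (0, 2)"
  proof -
    have "inv\<^bsub>?H\<^esub> (1, 1) = (2, 2)" by (rule H.inv_equality) (auto simp: carrier_integer_mod_group)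
    then show ?thesis by simp
  qed
  have pow: "(0, 2) [^]\<^bsub>?H\<^esub> i = (0, (int i * 2) mod 3)" for i :: nat
    by (induction i) (simp_all add: mod_simps algebra_simps)
  have "H.ord (0, 2) = 3"
    by (subst H.ord_unique) (auto simp: carrier_integer_mod_group pow, presburger+)
  moreover have L: "3 * m > 1" using m by simp
  ultimately have "card (generate ext {comtr ext ((1, 0), 0) (\<one>\<^bsub>?H\<^esub>, 1)}) = 3"
    using ext_card_commutator[OF L h] hs by simp
  moreover have "two_gen ext ((1, 0), 0) (\<one>\<^bsub>?H\<^esub>, 1)" by (rule ext_two_gen[OF L h]) (rule gen)
  moreover have "card (carrier ?H) = 9" unfolding car by (simp add: card_cartesian_product)
  then have "card (carrier ext) = 27 * m" using card_ext by simp
  ultimately show ?thesis by blast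
qed

text \<open>Generation follows from the obstructions proved above. The generated subgroup has order
  \<open>n * d\<close> with \<open>d\<close> dividing 6. For \<open>d = 1\<close> it would be
  abelian with trivial commutator, and for prime \<open>d\<close> the prime factor 2 of
  \<open>n\<close> would have to be 1 modulo \<open>d\<close>. Only \<open>d = 6\<close>
  remains.\<close>

lemma (in finite_group) two_gen_by_order:
  assumes xy: "x \<in> carrier G" "y \<in> carrier G" and n: "card (generate G {comtr G x y}) = n" "even n"
    and cG: "card (carrier G) = 6 * n"
  shows "two_gen G x y"
proof -
  let ?S = "generate G {x, y}" and ?c = "comtr G x y"
  have sS: "subgroup ?S G" by (rule generate_is_subgroup) (use xy in simp)
  interpret S: group "G\<lparr>carrier := ?S\<rparr>" by (rule subgroup_imp_group[OF sS])
  have xS: "x \<in> ?S" "y \<in> ?S" by (auto intro: generate.incl)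
  interpret S: two_gen "G\<lparr>carrier := ?S\<rparr>" x y
    by unfold_locales (use xS subgroup_fin[OF sS] generate_consistent[OF _ sS, of "{x, y}"] in auto)
  have com: "S.c = ?c" using xS by (simp add: comtr_def m_inv_consistent[OF sS])
  have cS: "?c \<in> ?S" using S.c_closed com by simp
  have SC: "S.C = generate G {?c}" using generate_consistent[OF _ sS, of "{?c}"] cS com by simp
  have n0: "n > 0" using n subgroup_card_pos[of "generate G {?c}"] xy by auto
  obtain d where d: "card ?S = n * d"
    using card_subgroup_dvd[OF _ sS generate_subset[OF sS cS]] xy n by auto
  have "n * d dvd 6 * n" using card_subgroup_dvd_order[OF sS] d cG by simp
  then have d6: "d dvd 6" using n0 by (simp add: mult.commute)
  have not_prime: "\<not> prime d"
  proof
    assume pd: "prime d"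
    have cd: "card (carrier (G\<lparr>carrier := ?S\<rparr>)) = d * card S.C" using d n SC by simp
    have "[2 = 1] (mod d)"
      using S.normal_prime_index_factor[OF S.prime_index_normal[OF pd cd] pd cd two_is_prime_nat] n SC by simp
    then have "d dvd 1" using pd by (simp add: cong_altdef_nat)
    then show False using pd not_prime_unit by blast
  qed
  have "d \<noteq> 1"
  proof
    assume "d = 1"
    then have "generate G {?c} = ?S"
      using subgroup_eq_if_card[OF _ sS generate_subset[OF sS cS]] d n xy by simp
    then have "x \<otimes> y = y \<otimes> x" using generate_comm[of ?c x y] xS xy by simp
    then have "?c = \<one>" using xy by (simp add: comtr_def m_assoc cancel1)
    then have "n = 1" using n by (simp add: generate_one)
    then show False using n by simp
  qed
  moreover have "d \<le> 6" using d6 by (rule dvd_imp_le) simp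
  then have "d \<in> {0,1,2,3,4,5,6}" by auto
  ultimately have "d = 6" using d6 not_prime by auto
  then have "?S = carrier G"
    using subgroup_eq_if_card[OF sS subgroup_self subgroup.subset[OF sS]] d cG by simp
  then show ?thesis using xy by unfold_locales auto
qed

text \<open>For \<open>e = True\<close> this is the quaternion group, as the central extension of the Klein four-group
  by the cocycle \<open>aa' + bb' + ab'\<close> over the field with two elements; for \<open>e = False\<close> it is the Klein
  four-group. In both cases, \<open>quat_rot\<close> is an automorphism of order 3.\<close>

definition quat :: "bool \<Rightarrow> (bool \<times> bool \<times> bool) monoid" where
  "quat e = \<lparr>carrier = {(s, a, b). s \<longrightarrow> e},
     mult = (\<lambda>(s, a, b) (s', a', b').
       ((s \<noteq> s') \<noteq> (e \<and> ((a \<and> a') \<noteq> ((b \<and> b') \<noteq> (a \<and> b')))), a \<noteq> a', b \<noteq> b')),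
     one = (False, False, False)\<rparr>"

definition quat_rot :: "bool \<Rightarrow> bool \<times> bool \<times> bool \<Rightarrow> bool \<times> bool \<times> bool" where
  "quat_rot e = (\<lambda>(s, a, b). (s \<noteq> (e \<and> b), b, a \<noteq> b))"

lemma quat_mult: "(s, a, b) \<otimes>\<^bsub>quat e\<^esub> (s', a', b') =
    ((s \<noteq> s') \<noteq> (e \<and> ((a \<and> a') \<noteq> ((b \<and> b') \<noteq> (a \<and> b')))), a \<noteq> a', b \<noteq> b')"
  by (simp add: quat_def)

lemma quat_rot: "quat_rot e (s, a, b) = (s \<noteq> (e \<and> b), b, a \<noteq> b)"
  by (simp add: quat_rot_def)

lemma quat_rot_mult: "quat_rot e (u \<otimes>\<^bsub>quat e\<^esub> v) = quat_rot e u \<otimes>\<^bsub>quat e\<^esub> quat_rot e v"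
proof -
  obtain s a b where u: "u = (s, a, b)" by (cases u)
  obtain s' a' b' where v: "v = (s', a', b')" by (cases v)
  show ?thesis unfolding u v quat_mult quat_rot prod.inject by argo
qed

lemma quat_group: "group (quat e)"
proof (rule groupI)
  fix u v w :: "bool \<times> bool \<times> bool"
  obtain s a b where u: "u = (s, a, b)" by (cases u)
  obtain s' a' b' where v: "v = (s', a', b')" by (cases v)
  obtain s'' a'' b'' where w: "w = (s'', a'', b'')" by (cases w)
  show "u \<otimes>\<^bsub>quat e\<^esub> v \<otimes>\<^bsub>quat e\<^esub> w = u \<otimes>\<^bsub>quat e\<^esub> (v \<otimes>\<^bsub>quat e\<^esub> w)"
    unfolding u v w quat_mult prod.inject by argo
next
  fix u assume "u \<in> carrier (quat e)"
  then obtain s a b where u: "u = (s, a, b)" "s \<longrightarrow> e" by (auto simp: quat_def)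
  then show "\<exists>v\<in>carrier (quat e). v \<otimes>\<^bsub>quat e\<^esub> u = \<one>\<^bsub>quat e\<^esub>"
    by (intro bexI[of _ "(s \<noteq> (e \<and> (a \<or> b)), a, b)"]) (auto simp: quat_def)
qed (auto simp: quat_def)

lemma card_quat: "card (carrier (quat e)) = (if e then 8 else 4)"
proof (cases e)
  case True
  then have "carrier (quat e) = UNIV" by (auto simp: quat_def)
  then show ?thesis using True
    by (simp add: card_cartesian_product card_UNIV_bool del: UNIV_Times_UNIV flip: UNIV_Times_UNIV)
next
  case False
  then have "carrier (quat e) = {False} \<times> UNIV" by (auto simp: quat_def)
  then show ?thesis using False
    by (simp add: card_cartesian_product card_UNIV_bool del: UNIV_Times_UNIV flip: UNIV_Times_UNIV)
qed

text \<open>The base is \<open>quat e\<close> times the integers modulo \<open>m\<close>, extended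
  by an automorphism of order 3 on both factors. The commutator has order \<open>n0\<close> in the
  first component and order \<open>m\<close> in the second, as \<open>1 - u\<close> is a unit modulo
  \<open>m\<close>; since \<open>m\<close> is odd, these orders multiply.\<close>

lemma quat_extension_two_gen:
  fixes m u :: nat and e :: bool
  assumes m: "odd m" and u: "[int u ^ 3 = 1] (mod int m)" "coprime (int u - 1) (int m)"
  defines "n0 \<equiv> (if e then 4 else 2)"
  shows "\<exists>(G :: (((bool \<times> bool \<times> bool) \<times> int) \<times> nat) monoid) x y. two_gen G x y
    \<and> card (generate G {comtr G x y}) = n0 * m \<and> card (carrier G) = 6 * (n0 * m)"
proof -
  let ?Z = "integer_mod_group m"
  let ?H = "quat e \<times>\<times> ?Z"
  let ?f = "\<lambda>a. (int u * a) mod int m"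
  let ?s = "\<lambda>(w, a). (quat_rot e w, ?f a)"
  have m0: "m > 0" using m by (cases m) auto
  have carZ: "carrier ?Z = {0..<int m}" using m0 by (simp add: carrier_integer_mod_group)
  interpret W: group "quat e" by (rule quat_group)
  interpret Z: finite_group ?Z by (rule integer_mod_finite_group[OF m0])
  interpret H: group ?H by (rule DirProd_group[OF quat_group]) simp
  interpret H: finite_group ?H by unfold_locales (simp add: carZ)
  interpret cyclic_extension ?H ?s 3
  proof
    fix a assume a: "a \<in> carrier ?H"
    then obtain w z where wz: "a = (w, z)" "w \<in> carrier (quat e)" "0 \<le> z" "z < int m"
      by (cases a) (auto simp: carZ)
    show "?s a \<in> carrier ?H" using wz m0 by (auto simp: carZ quat_def quat_rot_def)
    show "?s (a \<otimes>\<^bsub>?H\<^esub> d) = ?s a \<otimes>\<^bsub>?H\<^esub> ?s d" if "d \<in> carrier ?H" for d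
    proof -
      obtain v y where d: "d = (v, y)" by (cases d)
      show ?thesis using wz d quat_rot_mult[of e w v] by (simp add: mod_simps distrib_left)
    qed
    have "quat_rot e (quat_rot e (quat_rot e w)) = w" by (cases w) (auto simp: quat_rot_def)
    moreover have "?f (?f (?f z)) = z"
    proof -
      have "?f (?f (?f z)) = (int u ^ 3 * z) mod int m" by (simp add: mod_simps power3_eq_cube mult.assoc)
      also have "\<dots> = z" using cong_mult[OF u(1) cong_refl, of z] wz by (simp add: cong_def)
      finally show ?thesis .
    qed
    ultimately show "(?s ^^ 3) a = a" using wz by (simp add: numeral_3_eq_3)
  qed simp
  interpret E: finite_group ext by (rule ext_group)
  let ?w = "(False, True, False)"
  let ?h = "(?w, 1 mod int m)"
  have h: "?h \<in> carrier ?H" using m0 by (simp add: carZ quat_def)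
  have x: "(?h, 0) \<in> carrier ext" using h by simp
  have y: "(\<one>\<^bsub>?H\<^esub>, 1) \<in> carrier ext" unfolding ext_simps by (rule SigmaI[OF H.one_closed]) simp
  let ?k = "(False, True, True)"
  have inv_j: "inv\<^bsub>quat e\<^esub> (False, False, True) = (e, False, True)"
    by (rule W.inv_equality) (auto simp: quat_def)
  have hs: "?h \<otimes>\<^bsub>?H\<^esub> inv\<^bsub>?H\<^esub> (?s ?h) = (?k, (1 - int u) mod int m)"
  proof -
    have "?s ?h = ((False, False, True), int u mod int m)" by (simp add: quat_rot_def mod_simps)
    moreover have "(False, False, True) \<in> carrier (quat e)" "int u mod int m \<in> carrier ?Z"
      using m0 by (simp_all add: quat_def carZ)
    ultimately have "inv\<^bsub>?H\<^esub> (?s ?h) = ((e, False, True), (- (int u mod int m)) mod int m)"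
      using inv_DirProd[OF W.is_group Z.is_group] inv_j by simp
    moreover have "?w \<otimes>\<^bsub>quat e\<^esub> (e, False, True) = ?k" by (simp add: quat_def)
    ultimately show ?thesis by (simp add: mod_simps)
  qed
  \<comment> \<open>In the quaternion group the powers run through 1, k, -1, -k, so the sign bit is
    set for residues 2 and 3.\<close>
  have kpow: "?k [^]\<^bsub>quat e\<^esub> i = (e \<and> i mod 4 \<ge> 2, odd i, odd i)" for i :: nat
  proof (induction i)
    case 0 then show ?case by (simp add: quat_def)
  next
    case (Suc i)
    have "odd i \<longleftrightarrow> i mod 4 = 1 \<or> i mod 4 = 3" by presburger
    moreover have "Suc i mod 4 = (if i mod 4 = 3 then 0 else Suc (i mod 4))" by (simp add: mod_Suc)
    moreover have "i mod 4 = 0 \<or> i mod 4 = 1 \<or> i mod 4 = 2 \<or> i mod 4 = 3" by auto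
    ultimately show ?case using Suc by (elim disjE) (simp_all add: quat_mult)
  qed
  have pow: "(?k, v) [^]\<^bsub>?H\<^esub> i = (?k [^]\<^bsub>quat e\<^esub> i, v [^]\<^bsub>?Z\<^esub> i)" for v and i :: nat
    by (induction i) simp_all
  have ord: "H.ord (?k, (1 - int u) mod int m) = n0 * m"
  proof (subst H.ord_unique, (simp add: carZ m0 quat_def; fail), intro allI)
    fix i :: nat
    have "(?k, (1 - int u) mod int m) [^]\<^bsub>?H\<^esub> i = \<one>\<^bsub>?H\<^esub> \<longleftrightarrow>
        \<not> (e \<and> i mod 4 \<ge> 2) \<and> even i \<and> (int i * (1 - int u)) mod int m = 0"
      unfolding pow kpow by (simp add: quat_def mod_simps)
    also have "\<not> (e \<and> i mod 4 \<ge> 2) \<and> even i \<longleftrightarrow> n0 dvd i" unfolding n0_def by (cases e) (simp, presburger, simp)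
    then have "(\<not> (e \<and> i mod 4 \<ge> 2) \<and> even i \<and> (int i * (1 - int u)) mod int m = 0) \<longleftrightarrow>
        n0 dvd i \<and> (int i * (1 - int u)) mod int m = 0" by blast
    also have "(int i * (1 - int u)) mod int m = 0 \<longleftrightarrow> m dvd i"
    proof -
      have "coprime (int m) (1 - int u)" using u(2) by (metis coprime_commute coprime_minus_right_iff minus_diff_eq)
      then show ?thesis by (simp add: dvd_eq_mod_eq_0[symmetric] coprime_dvd_mult_left_iff)
    qed
    also have "n0 dvd i \<and> m dvd i \<longleftrightarrow> n0 * m dvd i"
    proof -
      have "coprime 2 m" using m by simp
      then have "coprime (2 ^ 2) m" by (simp only: coprime_power_left_iff) simp
      then have "coprime n0 m" using \<open>coprime 2 m\<close> by (simp add: n0_def)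
      then show ?thesis using divides_mult[of n0 i m] by (auto dest: dvd_mult_left dvd_mult_right)
    qed
    finally show "((?k, (1 - int u) mod int m) [^]\<^bsub>?H\<^esub> i = \<one>\<^bsub>?H\<^esub>) = (n0 * m dvd i)" .
  qed
  have cc: "card (generate ext {comtr ext (?h, 0) (\<one>\<^bsub>?H\<^esub>, 1)}) = n0 * m"
    using ext_card_commutator[OF _ h] hs ord by simp
  have "card (carrier ?H) = 2 * n0 * m"
    using card_quat[of e] by (simp add: card_cartesian_product carZ n0_def)
  then have ce: "card (carrier ext) = 6 * (n0 * m)" using card_ext by simp
  have "two_gen ext (?h, 0) (\<one>\<^bsub>?H\<^esub>, 1)"
    by (rule E.two_gen_by_order[OF x y cc _ ce]) (simp add: n0_def)
  then show ?thesis using cc ce by blast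
qed

subsection \<open>Vertices of an origami\<close>

locale origami_geometry =
  fixes Or :: "'a origami"
  assumes origami: "is_origami Or"
begin

abbreviation "S \<equiv> squares Or"
abbreviation "R \<equiv> right Or"
abbreviation "U \<equiv> up Or"

definition "Ri = inv_into S R"
definition "Ui = inv_into S U"

lemma S_fin: "finite S" and S_nonempty: "S \<noteq> {}" and R_bij: "bij_betw R S S" and U_bij: "bij_betw U S S"
  using origami by (auto simp: is_origami_def)

lemma RU_simps [simp]:
  assumes "a \<in> S"
  shows "R a \<in> S" "U a \<in> S" "Ri a \<in> S" "Ui a \<in> S"
    "R (Ri a) = a" "Ri (R a) = a" "U (Ui a) = a" "Ui (U a) = a"
  using assms R_bij U_bij
  by (auto simp: Ri_def Ui_def bij_betw_def inv_into_into f_inv_into_f)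

text \<open>Going once around the lower left corner of the square \<open>b\<close>, through an angle of \<open>2\<pi>\<close>, leads
  to the lower left corner of \<open>kap b\<close>.\<close>

definition "kap b = U (R (Ui (Ri b)))"

lemma kap_S [simp]: "b \<in> S \<Longrightarrow> kap b \<in> S"
  by (simp add: kap_def)

lemma kap_pow_S [simp]: "b \<in> S \<Longrightarrow> (kap ^^ i) b \<in> S"
  by (induction i) simp_all

lemma kap_inj: "a \<in> S \<Longrightarrow> b \<in> S \<Longrightarrow> kap a = kap b \<Longrightarrow> a = b"
proof -
  assume *: "a \<in> S" "b \<in> S" "kap a = kap b"
  have "R (U (Ri (Ui (kap c)))) = c" if "c \<in> S" for c using that by (simp add: kap_def)
  then show "a = b" using * by metis
qed

text \<open>Orbits of \<open>kap\<close> correspond to the vertices of the surface.\<close>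

definition "orb b = range (\<lambda>i. (kap ^^ i) b)"

lemma orb_self: "b \<in> orb b"
  unfolding orb_def by (rule range_eqI[of _ _ 0]) simp

lemma orb_S: "b \<in> S \<Longrightarrow> orb b \<subseteq> S"
  by (auto simp: orb_def)

lemma kap_pow_inj: "a \<in> S \<Longrightarrow> b \<in> S \<Longrightarrow> (kap ^^ i) a = (kap ^^ i) b \<Longrightarrow> a = b"
  by (induction i) (auto dest!: kap_inj[rotated 2])

lemma kap_period: assumes "b \<in> S" obtains n where "n > 0" "(kap ^^ n) b = b"
proof -
  have "\<not> inj (\<lambda>i. (kap ^^ i) b)"
    using finite_subset[OF orb_S[OF assms] S_fin] finite_imageD[of "\<lambda>i. (kap ^^ i) b" UNIV]
    by (auto simp: orb_def)
  then obtain i j where ij: "i < j" "(kap ^^ i) b = (kap ^^ j) b"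
    unfolding inj_def by (metis linorder_neqE_nat)
  have "(kap ^^ i) ((kap ^^ (j - i)) b) = (kap ^^ i) b"
    using ij by (metis add_diff_inverse_nat comp_apply funpow_add less_asym)
  then have "(kap ^^ (j - i)) b = b" using kap_pow_inj assms by (metis kap_pow_S)
  then show ?thesis using that[of "j - i"] ij by simp
qed

lemma orb_trans: "a \<in> orb b \<Longrightarrow> orb a \<subseteq> orb b"
  unfolding orb_def by (auto simp flip: funpow_add comp_apply[of "kap ^^ _" "kap ^^ _"]) 

lemma orb_sym: assumes b: "b \<in> S" and a: "a \<in> orb b" shows "b \<in> orb a"
proof -
  obtain i where i: "a = (kap ^^ i) b" using a by (auto simp: orb_def)
  obtain n where n: "n > 0" "(kap ^^ n) b = b" using kap_period[OF b] .
  have per: "(kap ^^ (n * k)) b = b" for k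
    by (induction k) (simp_all add: funpow_add n)
  have "(kap ^^ (n * i - i)) a = (kap ^^ (n * i)) b"
    unfolding i using n by (simp flip: funpow_add comp_apply[of "kap ^^ _" "kap ^^ _"])
  then show ?thesis unfolding orb_def using per by (metis rangeI)
qed

lemma orb_eq: "b \<in> S \<Longrightarrow> a \<in> orb b \<Longrightarrow> orb a = orb b"
  using orb_trans orb_sym by blast

lemma orb_kap: "b \<in> S \<Longrightarrow> orb (kap b) = orb b"
proof (rule orb_eq)
  show "kap b \<in> orb b" unfolding orb_def by (rule range_eqI[of _ _ 1]) simp
qed

text \<open>Each \<open>b\<close> contributes the four corners passed during one turn from
  \<open>b\<close> to \<open>kap b\<close>, one corner of every type.\<close>

definition corner_set :: "'a set \<Rightarrow> ('a \<times> real \<times> real) set" where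
  "corner_set B = (\<Union>b\<in>B. {(b, 0, 0), (Ri b, 1, 0), (Ui (Ri b), 1, 1), (R (Ui (Ri b)), 0, 1)})"

text \<open>Inverts \<open>corner_set\<close>: for \<open>s\<close> and \<open>t\<close> in
  \<open>{0, 1}\<close> this is the square whose turn passes the corner \<open>(s, t)\<close> of
  \<open>a\<close>.\<close>

definition base :: "'a \<Rightarrow> real \<Rightarrow> real \<Rightarrow> 'a" where
  "base a s t = (if t = 0 then (if s = 0 then a else R a) else (if s = 0 then R (U (Ri a)) else R (U a)))"

text \<open>An explicit description of the gluing class of a point, by its position as corner, side
  point or interior point; \<open>surface_eq\<close> confirms it.\<close>

definition pclass :: "'a \<times> real \<times> real \<Rightarrow> ('a \<times> real \<times> real) set" where
  "pclass p = (case p of (a, s, t) \<Rightarrow>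
     if s \<in> {0, 1} \<and> t \<in> {0, 1} then corner_set (orb (base a s t))
     else if t = 1 then {(a, s, 1), (U a, s, 0)}
     else if t = 0 then {(a, s, 0), (Ui a, s, 1)}
     else if s = 1 then {(a, 1, t), (R a, 0, t)}
     else if s = 0 then {(a, 0, t), (Ri a, 1, t)}
     else {(a, s, t)})"

lemma base_S: "a \<in> S \<Longrightarrow> base a s t \<in> S"
  by (simp add: base_def)

lemma self_pclass: "p \<in> tile_points Or \<Longrightarrow> p \<in> pclass p"
proof (cases p)
  fix a s t assume p: "p = (a, s, t)" "p \<in> tile_points Or"
  then have a: "a \<in> S" by (simp add: tile_points_def)
  show "p \<in> pclass p"
  proof (cases "s \<in> {0, 1} \<and> t \<in> {0, 1}")
    case True
    have "(a, s, t) \<in> corner_set {base a s t}"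
      using True a by (auto simp: corner_set_def base_def)
    also have "\<dots> \<subseteq> corner_set (orb (base a s t))"
      unfolding corner_set_def using orb_self by (intro UN_mono) auto
    finally show ?thesis using True by (simp add: p pclass_def)
  qed (auto simp: p pclass_def)
qed

lemma pclass_side_gluing:
  assumes "(p, q) \<in> side_gluing Or" shows "pclass p = pclass q"
  using assms unfolding side_gluing_def
proof (elim UnE)
  assume "(p, q) \<in> {((a, 1, t), (right Or a, 0, t)) |a t. a \<in> S \<and> t \<in> {0..1}}"
  then obtain a t where a: "p = (a, 1, t)" "q = (R a, 0, t)" "a \<in> S" "t \<in> {0..1}" by blast
  then show ?thesis by (auto simp: pclass_def base_def)
next
  assume "(p, q) \<in> {((a, s, 1), (up Or a, s, 0)) |a s. a \<in> S \<and> s \<in> {0..1}}"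
  then obtain a s where a: "p = (a, s, 1)" "q = (U a, s, 0)" "a \<in> S" "s \<in> {0..1}" by blast
  \<comment> \<open>The upper left corner of \<open>a\<close> has base \<open>R (U (Ri a))\<close>
    seen from \<open>a\<close>, but \<open>U a\<close> seen from the square above; the two differ by
    one application of \<open>kap\<close>.\<close>
  have "orb (kap (R (U (Ri a)))) = orb (R (U (Ri a)))" using a by (intro orb_kap) simp
  then have "orb (U a) = orb (R (U (Ri a)))" using a by (simp add: kap_def)
  then show ?thesis using a by (auto simp: pclass_def base_def)
qed

abbreviation "E \<equiv> (side_gluing Or \<union> (side_gluing Or)\<inverse>)\<^sup>*"

lemma E_sym: "(p, q) \<in> E \<Longrightarrow> (q, p) \<in> E"
  using sym_rtrancl[OF sym_Un_converse] by (rule symD)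

lemma E_right: "a \<in> S \<Longrightarrow> t \<in> {0..1} \<Longrightarrow> ((a, 1, t), (R a, 0, t)) \<in> E"
  by (rule r_into_rtrancl) (auto simp: side_gluing_def)

lemma E_up: "a \<in> S \<Longrightarrow> s \<in> {0..1} \<Longrightarrow> ((a, s, 1), (U a, s, 0)) \<in> E"
  by (rule r_into_rtrancl) (auto simp: side_gluing_def)

lemma pclass_E: "(p, q) \<in> E \<Longrightarrow> pclass p = pclass q"
  by (induction rule: rtrancl_induct) (auto dest: pclass_side_gluing)

lemma corner_E:
  assumes b: "b \<in> S"
  shows "((b, 0, 0), (Ri b, 1, 0)) \<in> E" "((b, 0, 0), (Ui (Ri b), 1, 1)) \<in> E"
    "((b, 0, 0), (R (Ui (Ri b)), 0, 1)) \<in> E" "((b, 0, 0), (kap b, 0, 0)) \<in> E"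
proof -
  show 1: "((b, 0, 0), (Ri b, 1, 0)) \<in> E" using E_right[of "Ri b" 0] b by (auto intro: E_sym)
  have "((Ri b, 1, 0), (Ui (Ri b), 1, 1)) \<in> E" using E_up[of "Ui (Ri b)" 1] b by (auto intro: E_sym)
  with 1 show 2: "((b, 0, 0), (Ui (Ri b), 1, 1)) \<in> E" by (rule rtrancl_trans)
  have "((Ui (Ri b), 1, 1), (R (Ui (Ri b)), 0, 1)) \<in> E" using E_right[of "Ui (Ri b)" 1] b by auto
  with 2 show 3: "((b, 0, 0), (R (Ui (Ri b)), 0, 1)) \<in> E" by (rule rtrancl_trans)
  have "((R (Ui (Ri b)), 0, 1), (kap b, 0, 0)) \<in> E" using E_up[of "R (Ui (Ri b))" 0] b by (auto simp: kap_def)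
  with 3 show "((b, 0, 0), (kap b, 0, 0)) \<in> E" by (rule rtrancl_trans)
qed

lemma orb_E: "b \<in> S \<Longrightarrow> ((b, 0, 0), ((kap ^^ i) b, 0, 0)) \<in> E"
proof (induction i)
  case (Suc i)
  then show ?case using corner_E(4)[of "(kap ^^ i) b"] by (auto intro: rtrancl_trans)
qed simp

lemma corner_set_E:
  assumes "b \<in> S" "q \<in> corner_set (orb b)" shows "((b, 0, 0), q) \<in> E"
proof -
  obtain i where "q \<in> (let a = (kap ^^ i) b in {(a, 0, 0), (Ri a, 1, 0), (Ui (Ri a), 1, 1), (R (Ui (Ri a)), 0, 1)})"
    using assms(2) by (auto simp: corner_set_def orb_def Let_def)
  then have "(((kap ^^ i) b, 0, 0), q) \<in> E" using corner_E(1-3)[OF kap_pow_S[OF assms(1), of i]] by (auto simp: Let_def)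
  with orb_E[OF assms(1)] show ?thesis by (rule rtrancl_trans)
qed

lemma pclass_imp_E:
  assumes p: "p \<in> tile_points Or" and q: "q \<in> pclass p" shows "(p, q) \<in> E"
proof -
  obtain a s t where pa: "p = (a, s, t)" by (cases p)
  have a: "a \<in> S" "s \<in> {0..1}" "t \<in> {0..1}" using p by (auto simp: pa tile_points_def)
  show ?thesis
  proof (cases "s \<in> {0, 1} \<and> t \<in> {0, 1}")
    case True
    let ?b = "base a s t"
    have "pclass p = corner_set (orb ?b)" using True by (simp add: pa pclass_def)
    then have "((?b, 0, 0), p) \<in> E" "((?b, 0, 0), q) \<in> E"
      using corner_set_E[OF base_S[OF a(1)]] self_pclass[OF p] q by auto
    then show ?thesis using E_sym rtrancl_trans by metis
  next
    case False
    have "((a, 0, t), (Ri a, 1, t)) \<in> E" using E_sym[OF E_right[of "Ri a" t]] a by simp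
    moreover have "((a, s, 0), (Ui a, s, 1)) \<in> E" using E_sym[OF E_up[of "Ui a" s]] a by simp
    ultimately show ?thesis
      using False q a E_right[of a t] E_up[of a s] by (auto simp: pa pclass_def split: if_splits)
  qed
qed

lemma pclass_tile: "p \<in> tile_points Or \<Longrightarrow> pclass p \<subseteq> tile_points Or"
proof -
  assume p: "p \<in> tile_points Or"
  obtain a s t where pa: "p = (a, s, t)" by (cases p)
  have a: "a \<in> S" "s \<in> {0..1}" "t \<in> {0..1}" using p by (auto simp: pa tile_points_def)
  have "corner_set (orb (base a s t)) \<subseteq> tile_points Or"
    using orb_S[OF base_S[OF a(1)]] by (auto simp: corner_set_def tile_points_def subset_iff)
  then show ?thesis using a by (auto simp: pa pclass_def tile_points_def)
qed

text \<open>\<open>pclass\<close> is unchanged by every gluing, so it contains the gluing class, and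
  all its members are joined to the point by gluings.\<close>

lemma surface_eq: "surface Or = pclass ` tile_points Or"
proof -
  have "glued Or `` {p} = pclass p" if p: "p \<in> tile_points Or" for p
  proof
    show "pclass p \<subseteq> glued Or `` {p}"
      using pclass_imp_E[OF p] pclass_tile[OF p] p by (auto simp: glued_def)
    show "glued Or `` {p} \<subseteq> pclass p"
      using pclass_E self_pclass by (auto simp: glued_def)
  qed
  then show ?thesis unfolding surface_def quotient_def by blast
qed

text \<open>Four corners of angle \<open>pi / 2\<close> belong to each \<open>b\<close>, and the
  corners belonging to different \<open>b\<close> are distinct.\<close>

lemma vanishing_order_corner_set:
  assumes B: "B \<subseteq> S" "B \<noteq> {}"
  shows "vanishing_order (corner_set B) = real (card B) - 1"
proof -
  have fB: "finite B" using B S_fin finite_subset by blast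
  let ?K = "\<lambda>b. {(b, 0, 0), (Ri b, 1, 0), (Ui (Ri b), 1, 1), (R (Ui (Ri b)), 0, 1)} :: ('a \<times> real \<times> real) set"
  have disj: "?K b \<inter> ?K b' = {}" if "b \<in> B" "b' \<in> B" "b \<noteq> b'" for b b'
  proof -
    have bS: "b \<in> S" "b' \<in> S" using that B by auto
    have "Ri b \<noteq> Ri b'" using that bS by (metis RU_simps(5))
    moreover from this have "Ui (Ri b) \<noteq> Ui (Ri b')" using bS by (metis RU_simps(3,7))
    moreover from this have "R (Ui (Ri b)) \<noteq> R (Ui (Ri b'))" using bS by (metis RU_simps(3,4,6))
    ultimately show ?thesis using that by auto
  qed
  have "cone_angle (corner_set B) = (\<Sum>b\<in>B. \<Sum>(a, s, t)\<in>?K b. tile_angle s t)"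
    unfolding cone_angle_def corner_set_def using fB disj by (intro sum.UNION_disjoint) auto
  also have "\<dots> = (\<Sum>b\<in>B. 2 * pi)" by (intro sum.cong) (auto simp: tile_angle_def)
  finally have "cone_angle (corner_set B) = 2 * pi * card B" by simp
  then show ?thesis by (simp add: vanishing_order_def)
qed

lemma vanishing_order_noncorner:
  assumes "(a, s, t) \<in> tile_points Or" "\<not> (s \<in> {0, 1} \<and> t \<in> {0, 1})"
  shows "vanishing_order (pclass (a, s, t)) = 0"
  using assms by (auto simp: pclass_def vanishing_order_def cone_angle_def tile_angle_def tile_points_def)

lemma zeros_eq: "zeros Or = corner_set ` {B \<in> orb ` S. card B > 1}"
proof (intro equalityI subsetI)
  fix P assume "P \<in> zeros Or"
  then obtain a s t where P: "(a, s, t) \<in> tile_points Or" "P = pclass (a, s, t)" "vanishing_order P > 0"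
    by (auto simp: zeros_def surface_eq)
  then have co: "s \<in> {0, 1} \<and> t \<in> {0, 1}" using vanishing_order_noncorner[OF P(1)] by auto
  have b: "base a s t \<in> S" using P(1) by (intro base_S) (simp add: tile_points_def)
  have Po: "P = corner_set (orb (base a s t))" using co P(2) by (simp add: pclass_def)
  then have "card (orb (base a s t)) > 1"
    using P(3) vanishing_order_corner_set[OF orb_S[OF b]] orb_self by fastforce
  then show "P \<in> corner_set ` {B \<in> orb ` S. card B > 1}" using b Po by blast
next
  fix P assume "P \<in> corner_set ` {B \<in> orb ` S. card B > 1}"
  then obtain b where b: "b \<in> S" "card (orb b) > 1" "P = corner_set (orb b)" by blast
  have "(b, 0, 0) \<in> tile_points Or" using b by (simp add: tile_points_def)
  moreover have "pclass (b, 0, 0) = P" using b by (simp add: pclass_def base_def)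
  moreover have "orb b \<noteq> {}" using orb_self by blast
  then have "vanishing_order P > 0"
    using b vanishing_order_corner_set[OF orb_S[OF b(1)]] by simp
  ultimately show "P \<in> zeros Or" unfolding zeros_def surface_eq by blast
qed

lemma corner_set_inj: "inj_on corner_set (orb ` S)"
proof (rule inj_onI)
  fix A B assume "corner_set A = corner_set B"
  moreover have "b \<in> C \<longleftrightarrow> (b, 0, 0) \<in> corner_set C" for b C by (auto simp: corner_set_def)
  ultimately show "A = B" by blast
qed

text \<open>The orbits partition the squares into classes of size \<open>m\<close>, so either every
  vertex is a zero of order \<open>m - 1\<close> or there are no zeros; positive \<open>l\<close>
  excludes the latter.\<close>

lemma stratum_iff:
  assumes m: "\<And>b. b \<in> S \<Longrightarrow> card (orb b) = m" and kl: "k \<ge> 1" "l \<ge> 1"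
  shows "Or \<in> stratum k l \<longleftrightarrow> m = k + 1 \<and> card S = l * (k + 1)"
proof -
  have vo: "vanishing_order (corner_set B) = real m - 1" if B: "B \<in> orb ` S" for B
  proof -
    obtain b where b: "b \<in> S" "B = orb b" using B by blast
    then show ?thesis using vanishing_order_corner_set[OF orb_S[OF b(1)]] orb_self[of b] m[OF b(1)] by auto
  qed
  have zeros: "zeros Or = (if m > 1 then corner_set ` orb ` S else {})"
  proof -
    have "card B = m" if "B \<in> orb ` S" for B using m that by blast
    then have "{B \<in> orb ` S. card B > 1} = (if m > 1 then orb ` S else {})" by auto
    then show ?thesis by (simp add: zeros_eq)
  qed
  have card_orbs: "m * card (orb ` S) = card S"
  proof -
    have "S = \<Union> (orb ` S)" using orb_self orb_S by blast
    moreover have "m * card (orb ` S) = card (\<Union> (orb ` S))"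
    proof (rule card_partition)
      show "finite (orb ` S)" "finite (\<Union> (orb ` S))" using S_fin calculation by auto
      show "A \<inter> B = {}" if "A \<in> orb ` S" "B \<in> orb ` S" "A \<noteq> B" for A B
        using that orb_eq by blast
    qed (use m in auto)
    ultimately show ?thesis by simp
  qed
  have cz: "card (corner_set ` orb ` S) = card (orb ` S)" by (rule card_image[OF corner_set_inj])
  show ?thesis
  proof
    assume st: "Or \<in> stratum k l"
    then have ne: "zeros Or \<noteq> {}" "card (zeros Or) = l" using kl by (auto simp: stratum_def)
    then have m1: "m > 1" using zeros by (auto split: if_splits)
    obtain b where b: "b \<in> S" using S_nonempty by blast
    then have "corner_set (orb b) \<in> zeros Or" using zeros m1 by simp
    then have "real m - 1 = real k" using st vo b by (auto simp: stratum_def)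
    then have "m = k + 1" by linarith
    then show "m = k + 1 \<and> card S = l * (k + 1)" using ne zeros m1 cz card_orbs by (simp add: mult.commute)
  next
    assume a: "m = k + 1 \<and> card S = l * (k + 1)"
    then have z: "zeros Or = corner_set ` orb ` S" using zeros kl by simp
    have "(k + 1) * card (orb ` S) = (k + 1) * l" using a card_orbs by (simp add: mult.commute)
    then have "card (orb ` S) = l" by (simp only: mult_cancel1) simp
    then show "Or \<in> stratum k l" using z cz vo a S_fin origami by (auto simp: stratum_def)
  qed
qed

subsection \<open>Monodromy groups\<close>

text \<open>Invariance under \<open>Ri\<close> and \<open>Ui\<close> takes care of the steps that a
  connecting path makes against the gluing direction.\<close>

lemma connected_square_invariant:
  assumes B: "B \<subseteq> S" "B \<noteq> {}" and inv: "\<And>a. a \<in> B \<Longrightarrow> R a \<in> B \<and> U a \<in> B \<and> Ri a \<in> B \<and> Ui a \<in> B"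
  shows "B = S"
proof -
  obtain b0 where b0: "b0 \<in> B" using B by blast
  have "b \<in> B" if b: "b \<in> S" for b
  proof -
    have "(b0, b) \<in> (adjacent Or \<union> (adjacent Or)\<inverse>)\<^sup>*" using origami b b0 B by (auto simp: is_origami_def)
    then show ?thesis
    proof (induction rule: rtrancl_induct)
      case (step c d)
      have c: "c \<in> S" using step B by blast
      from step(2) show ?case
      proof
        assume "(c, d) \<in> adjacent Or"
        then show ?thesis using inv[OF step(3)] by (auto simp: adjacent_def)
      next
        assume "(c, d) \<in> (adjacent Or)\<inverse>"
        then have "d \<in> S" "c = R d \<or> c = U d" by (auto simp: adjacent_def)
        then have "d = Ri c \<or> d = Ui c" by auto
        then show ?thesis using inv[OF step(3)] by auto
      qed
    qed (rule b0)
  qed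
  then show ?thesis using B by blast
qed

abbreviation "B \<equiv> BijGroup S"
text \<open>The members of \<open>BijGroup\<close> are extensional functions, hence the restriction
  to the squares.\<close>

definition "uperm = restrict U S"
definition "rperm = restrict R S"

lemma perm_app [simp]: "b \<in> S \<Longrightarrow> uperm b = U b" "b \<in> S \<Longrightarrow> rperm b = R b"
  by (simp_all add: uperm_def rperm_def)

lemma Bij_finite_group: "finite_group B"
proof -
  interpret group B by (rule group_BijGroup)
  have "carrier B \<subseteq> S \<rightarrow>\<^sub>E S" by (auto simp: BijGroup_def Bij_def PiE_def bij_betw_def)
  then show ?thesis using finite_subset[OF _ finite_PiE[OF S_fin S_fin]] by unfold_locales blast
qed

lemma u_Bij: "uperm \<in> carrier B" and r_Bij: "rperm \<in> carrier B"
  using U_bij R_bij by (simp_all add: BijGroup_def Bij_def uperm_def rperm_def)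

lemma Bij_app: "f \<in> carrier B \<Longrightarrow> g \<in> carrier B \<Longrightarrow> b \<in> S \<Longrightarrow> (f \<otimes>\<^bsub>B\<^esub> g) b = f (g b)"
  by (simp add: BijGroup_def compose_def)

lemma Bij_app_S: "f \<in> carrier B \<Longrightarrow> b \<in> S \<Longrightarrow> f b \<in> S"
  by (auto simp: BijGroup_def Bij_def bij_betw_def)

lemma Bij_one_app: "b \<in> S \<Longrightarrow> \<one>\<^bsub>B\<^esub> b = b"
  by (simp add: BijGroup_def)

lemma inv_u_app: "b \<in> S \<Longrightarrow> (inv\<^bsub>B\<^esub> uperm) b = Ui b"
  and inv_r_app: "b \<in> S \<Longrightarrow> (inv\<^bsub>B\<^esub> rperm) b = Ri b"
proof -
  interpret finite_group B by (rule Bij_finite_group)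
  have app: "f ((inv\<^bsub>B\<^esub> f) b) = b" "(inv\<^bsub>B\<^esub> f) b \<in> S" if "f \<in> carrier B" "b \<in> S" for f b
    using that Bij_app[of f "inv\<^bsub>B\<^esub> f" b] Bij_one_app[of b] Bij_app_S[of "inv\<^bsub>B\<^esub> f" b] by simp_all
  show "(inv\<^bsub>B\<^esub> uperm) b = Ui b" if "b \<in> S"
    using app[OF u_Bij that] RU_simps(8)[of "(inv\<^bsub>B\<^esub> uperm) b"] by simp
  show "(inv\<^bsub>B\<^esub> rperm) b = Ri b" if "b \<in> S"
    using app[OF r_Bij that] RU_simps(6)[of "(inv\<^bsub>B\<^esub> rperm) b"] by simp
qed

lemma commutator_app: "b \<in> S \<Longrightarrow> comtr B uperm rperm b = kap b"
proof -
  interpret finite_group B by (rule Bij_finite_group)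
  show "b \<in> S \<Longrightarrow> ?thesis"
    using u_Bij r_Bij by (simp add: comtr_def Bij_app inv_u_app inv_r_app kap_def Bij_app_S)
qed

lemma commutator_pow_app: "b \<in> S \<Longrightarrow> (comtr B uperm rperm [^]\<^bsub>B\<^esub> i) b = (kap ^^ i) b" for i :: nat
proof (induction i arbitrary: b)
  case 0 then show ?case by (simp add: Bij_one_app)
next
  case (Suc i)
  interpret finite_group B by (rule Bij_finite_group)
  have "comtr B uperm rperm \<in> carrier B" using u_Bij r_Bij by simp
  then show ?case using Suc by (simp add: Bij_app commutator_app funpow_swap1)
qed

lemma deck_commutes:
  assumes d: "deck_transformation Or d" and f: "f \<in> generate B {uperm, rperm}" and b: "b \<in> S"
  shows "d (f b) = f (d b)"
  using f b
proof (induction f arbitrary: b rule: generate.induct)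
  have dS: "d a \<in> S" if "a \<in> S" for a
    using d that by (auto simp: deck_transformation_def bij_betw_def)
  have dR: "d (R a) = R (d a)" "d (U a) = U (d a)" if "a \<in> S" for a
    using d that by (auto simp: deck_transformation_def)
  {
    case one then show ?case using dS by (simp add: Bij_one_app)
  next
    case (incl h) then show ?case using dS dR by auto
  next
    case (inv h)
    have "d (Ri b) = Ri (d b)" "d (Ui b) = Ui (d b)"
      using dR(1)[of "Ri b"] dR(2)[of "Ui b"] RU_simps(6)[of "d (Ri b)"] RU_simps(8)[of "d (Ui b)"] inv(2) dS by auto
    moreover have "h = uperm \<or> h = rperm" using inv(1) by simp
    ultimately show ?case using inv(2) dS by (elim disjE) (simp_all add: inv_u_app inv_r_app)
  next
    case (eng h1 h2)
    interpret finite_group B by (rule Bij_finite_group)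
    have "h1 \<in> carrier B" "h2 \<in> carrier B"
      using eng(1,2) generate_in_carrier[of "{uperm, rperm}"] u_Bij r_Bij by auto
    then show ?case using eng dS by (simp add: Bij_app Bij_app_S)
  }
qed

text \<open>The monodromy group is transitive by connectedness and acts freely because it commutes
  with the transitive deck transformations, so it has as many elements as there are squares. With
  the generators in the order \<open>uperm\<close>, \<open>rperm\<close> the commutator acts as
  \<open>kap\<close>, and freeness gives all its orbits the size of the group it generates.\<close>

theorem regular_imp_two_gen:
  assumes reg: "regular_origami Or" and st: "Or \<in> stratum k l" and kl: "k \<ge> 1" "l \<ge> 1"
  shows "\<exists>(G :: ('a \<Rightarrow> 'a) monoid) x y. two_gen G x y
    \<and> card (generate G {comtr G x y}) = k + 1 \<and> card (carrier G) = l * (k + 1)"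
proof -
  interpret B: finite_group B by (rule Bij_finite_group)
  let ?X = "generate B {uperm, rperm}" and ?c = "comtr B uperm rperm"
  have sX: "subgroup ?X B" by (rule B.generate_is_subgroup) (use u_Bij r_Bij in simp)
  have XB: "f \<in> carrier B" if "f \<in> ?X" for f using subgroup.mem_carrier[OF sX that] .
  interpret M: group "B\<lparr>carrier := ?X\<rparr>" by (rule B.subgroup_imp_group[OF sX])
  have xX: "uperm \<in> ?X" "rperm \<in> ?X" by (auto intro: generate.incl)
  interpret M: two_gen "B\<lparr>carrier := ?X\<rparr>" uperm rperm
    by unfold_locales (use xX B.subgroup_fin[OF sX] B.generate_consistent[OF _ sX, of "{uperm, rperm}"] in auto)
  have com: "M.c = ?c" using xX by (simp add: comtr_def B.m_inv_consistent[OF sX])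
  have cX: "?c \<in> ?X" using M.c_closed com by simp
  have MC: "M.C = generate B {?c}" using B.generate_consistent[OF _ sX, of "{?c}"] cX com by simp
  have cB: "?c \<in> carrier B" using XB cX .
  have free: "f = g" if fg: "f \<in> ?X" "g \<in> ?X" and b: "b \<in> S" "f b = g b" for f g b
  proof (rule extensionalityI[of f S])
    show "f \<in> extensional S" "g \<in> extensional S" using XB[OF fg(1)] XB[OF fg(2)] by (auto simp: BijGroup_def Bij_def)
    fix b' assume "b' \<in> S"
    then obtain d where d: "deck_transformation Or d" "d b = b'" using reg b by (auto simp: regular_origami_def)
    then show "f b' = g b'" using deck_commutes[OF d(1) fg(1) b(1)] deck_commutes[OF d(1) fg(2) b(1)] b(2) by simp
  qed
  obtain b0 where b0: "b0 \<in> S" using S_nonempty by blast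
  have "(\<lambda>f. f b0) ` ?X = S"
  proof (rule connected_square_invariant)
    show "(\<lambda>f. f b0) ` ?X \<subseteq> S" using Bij_app_S[OF XB b0] by blast
    show "(\<lambda>f. f b0) ` ?X \<noteq> {}" using xX by blast
    fix a assume "a \<in> (\<lambda>f. f b0) ` ?X"
    then obtain f where f: "f \<in> ?X" "a = f b0" by blast
    have aS: "a \<in> S" using f Bij_app_S[OF XB b0] by simp
    have app: "h a \<in> (\<lambda>f. f b0) ` ?X" if h: "h \<in> ?X" for h
    proof -
      have "h a = (h \<otimes>\<^bsub>B\<^esub> f) b0" using Bij_app[OF XB[OF h] XB[OF f(1)] b0] f by simp
      then show ?thesis using subgroup.m_closed[OF sX h f(1)] by blast
    qed
    show "R a \<in> (\<lambda>f. f b0) ` ?X \<and> U a \<in> (\<lambda>f. f b0) ` ?X \<and> Ri a \<in> (\<lambda>f. f b0) ` ?X \<and> Ui a \<in> (\<lambda>f. f b0) ` ?X"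
      using app[OF xX(1)] app[OF xX(2)] app[OF subgroup.m_inv_closed[OF sX xX(1)]]
        app[OF subgroup.m_inv_closed[OF sX xX(2)]] aS by (simp add: inv_u_app inv_r_app)
  qed
  moreover have "inj_on (\<lambda>f. f b0) ?X" using free[OF _ _ b0] by (auto intro: inj_onI)
  ultimately have cardX: "card ?X = card S" by (metis card_image)
  have "card (orb b) = card (generate B {?c})" if b: "b \<in> S" for b
  proof -
    have "orb b = (\<lambda>f. f b) ` generate B {?c}"
    proof -
      have "generate B {?c} = range (\<lambda>i::nat. ?c [^]\<^bsub>B\<^esub> i)" using B.generate_eq_powers[OF cB] by auto
      then show ?thesis by (simp add: orb_def image_image commutator_pow_app[OF b])
    qed
    moreover have "inj_on (\<lambda>f. f b) (generate B {?c})"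
      using free[OF _ _ b] B.generate_subset[OF sX cX] by (auto intro!: inj_onI)
    ultimately show ?thesis by (simp add: card_image)
  qed
  from stratum_iff[OF this kl] have "card (generate B {?c}) = k + 1" "card S = l * (k + 1)" using st by auto
  then have "card M.C = k + 1" "card (carrier (B\<lparr>carrier := ?X\<rparr>)) = l * (k + 1)" using MC cardX by auto
  then show ?thesis using M.two_gen_axioms by blast
qed

end

text \<open>The gluings multiply on the right by the inverses of \<open>x\<close> and
  \<open>y\<close>, so that \<open>kap\<close> becomes right multiplication by \<open>c\<close>
  itself; deck transformations are left multiplications. The bijection \<open>e\<close> numbers the
  group elements, since squares are labelled by natural numbers.\<close>

lemma (in two_gen) contains_regular_origamis:
  assumes card_C: "card C = k + 1" and card_G: "card (carrier G) = l * (k + 1)" and kl: "k \<ge> 1" "l \<ge> 1"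
  shows "contains_regular_origamis k l"
proof -
  obtain e where e: "bij_betw e (carrier G) {0..<card (carrier G)}" using ex_bij_betw_finite_nat[OF fin] by blast
  let ?S = "{0..<card (carrier G)}"
  define d where "d = inv_into (carrier G) e"
  have ed: "d (e g) = g" "e g \<in> ?S" if "g \<in> carrier G" for g
    using e that by (auto simp: d_def bij_betw_def)
  have de: "e (d a) = a" "d a \<in> carrier G" if "a \<in> ?S" for a
    using e that by (auto simp: d_def bij_betw_def f_inv_into_f inv_into_into)
  define Or where "Or = \<lparr>squares = ?S, right = (\<lambda>a. e (d a \<otimes> inv x)), up = (\<lambda>a. e (d a \<otimes> inv y))\<rparr>"
  have Or: "squares Or = ?S" "right Or = (\<lambda>a. e (d a \<otimes> inv x))" "up Or = (\<lambda>a. e (d a \<otimes> inv y))"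
    by (simp_all add: Or_def)
  have bij: "bij_betw (\<lambda>a. e (d a \<otimes> inv z)) ?S ?S" if z: "z \<in> carrier G" for z
    by (rule bij_betwI[where g = "\<lambda>a. e (d a \<otimes> z)"]) (use z in \<open>auto simp del: atLeastLessThan_iff simp: ed de m_assoc\<close>)
  let ?A = "(adjacent Or \<union> (adjacent Or)\<inverse>)\<^sup>*"
  have step: "(e g, e (g \<otimes> inv z)) \<in> adjacent Or" if "g \<in> carrier G" "z \<in> {x, y}" for g z
    using that ed[OF that(1)] unfolding adjacent_def Or by auto
  have path: "(e g, e (g \<otimes> h)) \<in> ?A" if "h \<in> generate G {x, y}" "g \<in> carrier G" for g h
    using that
  proof (induction arbitrary: g rule: generate.induct)
    case one then show ?case by simp
  next
    case (incl h)
    then have "h \<in> carrier G" by auto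
    then show ?case using step[of "g \<otimes> h" h] incl by (intro r_into_rtrancl) (simp add: m_assoc)
  next
    case (inv h) then show ?case using step[of g h] by (intro r_into_rtrancl) simp
  next
    case (eng h1 h2)
    have h: "h1 \<in> carrier G" "h2 \<in> carrier G" using eng(1,2) gen by auto
    have "(e g, e (g \<otimes> h1)) \<in> ?A" "(e (g \<otimes> h1), e (g \<otimes> h1 \<otimes> h2)) \<in> ?A" using eng h by auto
    then show ?case using h eng(5) by (simp add: m_assoc)
  qed
  have ori: "is_origami Or"
  proof -
    have "(a, b) \<in> ?A" if ab: "a \<in> ?S" "b \<in> ?S" for a b
    proof -
      have "inv (d a) \<otimes> d b \<in> generate G {x, y}" using de ab gen by simp
      from path[OF this de(2)[OF ab(1)]] show ?thesis using de[OF ab(1)] de[OF ab(2)] by (simp add: cancel1)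
    qed
    moreover have "?S \<noteq> {}" using subgroup_card_pos[OF subgroup_self] by simp
    ultimately show ?thesis using bij[OF x] bij[OF y] unfolding is_origami_def Or by auto
  qed
  have reg: "regular_origami Or"
    unfolding regular_origami_def
  proof (intro conjI ori ballI)
    fix a b assume "a \<in> squares Or" "b \<in> squares Or"
    then have ab: "a \<in> ?S" "b \<in> ?S" by (simp_all add: Or)
    let ?g = "d b \<otimes> inv (d a)"
    let ?f = "\<lambda>z. e (?g \<otimes> d z)"
    have g: "?g \<in> carrier G" using de ab by simp
    have "bij_betw ?f ?S ?S"
      by (rule bij_betwI[where g = "\<lambda>z. e (inv ?g \<otimes> d z)"])
        (use g in \<open>auto simp del: atLeastLessThan_iff inv_mult_group simp: ed de cancel1 cancel2\<close>)
    then have "deck_transformation Or ?f"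
      unfolding deck_transformation_def Or using g
      by (simp add: ed de m_assoc del: atLeastLessThan_iff inv_mult_group)
    moreover have "?f a = b" using de ab by (simp add: m_assoc)
    ultimately show "\<exists>f. deck_transformation Or f \<and> f a = b" by blast
  qed
  interpret O: origami_geometry Or by unfold_locales (rule ori)
  have inv_step: "O.Ri (e g) = e (g \<otimes> x)" "O.Ui (e g) = e (g \<otimes> y)" if g: "g \<in> carrier G" for g
    using O.RU_simps(6)[of "e (g \<otimes> x)"] O.RU_simps(8)[of "e (g \<otimes> y)"] g ed[of "g \<otimes> x"] ed[of "g \<otimes> y"]
    unfolding Or by (simp_all add: m_assoc)
  have kap: "O.kap (e g) = e (g \<otimes> c)" if g: "g \<in> carrier G" for g
    using g by (simp add: O.kap_def inv_step Or ed comtr_def m_assoc)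
  have kap_pow: "(O.kap ^^ i) (e g) = e (g \<otimes> c [^] i)" if g: "g \<in> carrier G" for g i
    using g by (induction i) (simp_all add: kap m_assoc)
  have "card (O.orb a) = card C" if "a \<in> squares Or" for a
  proof -
    have a: "a = e (d a)" "d a \<in> carrier G" using that de by (simp_all add: Or)
    have "O.orb a = range (\<lambda>i::nat. e (d a \<otimes> c [^] i))"
      unfolding O.orb_def kap_pow[OF a(2), folded a(1)] ..
    also have "\<dots> = (\<lambda>h. e (d a \<otimes> h)) ` C" unfolding generate_eq_powers[OF c_closed] by auto
    finally have orb: "O.orb a = (\<lambda>h. e (d a \<otimes> h)) ` C" .
    have "inj_on (\<lambda>h. e (d a \<otimes> h)) C"
    proof (rule inj_on_inverseI[of _ "\<lambda>z. inv (d a) \<otimes> d z"])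
      fix h assume "h \<in> C"
      then have "h \<in> carrier G" using C_carrier by blast
      then show "inv (d a) \<otimes> d (e (d a \<otimes> h)) = h" using a(2) by (simp add: ed cancel2)
    qed
    then show ?thesis unfolding orb by (rule card_image)
  qed
  from O.stratum_iff[OF this kl] have "Or \<in> stratum k l" using card_C card_G by (simp add: Or)
  then show ?thesis using reg unfolding contains_regular_origamis_def by blast
qed

section \<open>Strata with and without regular origamis\<close>

lemma contains_regular_origamisE:
  assumes "contains_regular_origamis k l" "k \<ge> 1" "l \<ge> 1"
  obtains G :: "(nat \<Rightarrow> nat) monoid" and x y where "two_gen G x y"
    "card (generate G {comtr G x y}) = k + 1" "card (carrier G) = l * (k + 1)"
proof -
  obtain Or :: "nat origami" where Or: "regular_origami Or" "Or \<in> stratum k l"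
    using assms(1) by (auto simp: contains_regular_origamis_def)
  interpret origami_geometry Or by unfold_locales (use Or in \<open>simp add: regular_origami_def\<close>)
  show ?thesis using regular_imp_two_gen[OF Or assms(2,3)] that by blast
qed

lemma contains_if_metacyclic:
  fixes u :: int
  assumes "N > 0" "L > 1" "[u ^ L = 1] (mod int N)"
    and "\<And>i::nat. int N dvd int i * (1 - u) \<longleftrightarrow> k + 1 dvd i"
    and "N * L = l * (k + 1)" "k \<ge> 1" "l \<ge> 1"
  shows "contains_regular_origamis k l"
proof -
  obtain G :: "(int \<times> nat) monoid" and x y where
    G: "two_gen G x y" "card (generate G {comtr G x y}) = k + 1" "card (carrier G) = N * L"
    using metacyclic_two_gen[OF assms(1-4)] by blast
  then show ?thesis using two_gen.contains_regular_origamis[OF G(1,2)] assms by simp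
qed

text \<open>The generator of the cyclic group of order \<open>l\<close> acts by negation on the
  integers modulo \<open>k + 1\<close>. The commutator is 2, a unit because \<open>k + 1\<close> is
  odd.\<close>

lemma contains_even_even:
  assumes "even k" "even l" "k \<ge> 1" "l \<ge> 1" shows "contains_regular_origamis k l"
proof (rule contains_if_metacyclic[of "k + 1" l "-1"])
  show "l > 1" using assms by (cases "l = 1") auto
  show "[(- 1) ^ l = 1] (mod int (k + 1))" using assms by simp
  fix i :: nat
  have "coprime (k + 1) 2" using assms by simp
  then have "k + 1 dvd i * 2 \<longleftrightarrow> k + 1 dvd i" by (rule coprime_dvd_mult_left_iff)
  moreover have "int (k + 1) dvd int i * (1 - (- 1)) \<longleftrightarrow> k + 1 dvd i * 2"
    unfolding int_dvd_int_iff[symmetric] by simp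
  ultimately show "int (k + 1) dvd int i * (1 - (- 1)) \<longleftrightarrow> k + 1 dvd i" by simp
qed (use assms in \<open>auto simp: mult.commute\<close>)

text \<open>In the dihedral group of order \<open>4 * (k + 1)\<close>, the commutator of a
  generating rotation with a reflection is the square of the rotation, of order
  \<open>k + 1\<close>.\<close>

lemma contains_4:
  assumes "k \<ge> 1" shows "contains_regular_origamis k 4"
proof (rule contains_if_metacyclic[of "2 * (k + 1)" 2 "-1"])
  fix i :: nat
  have "2 * (k + 1) dvd 2 * i \<longleftrightarrow> k + 1 dvd i" by (rule nat_mult_dvd_cancel1) simp
  moreover have "int (2 * (k + 1)) dvd int i * (1 - (- 1)) \<longleftrightarrow> 2 * (k + 1) dvd 2 * i"
    unfolding int_dvd_int_iff[symmetric] by (simp add: mult.commute[of 2])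
  ultimately show "int (2 * (k + 1)) dvd int i * (1 - (- 1)) \<longleftrightarrow> k + 1 dvd i" by simp
qed (use assms in auto)

text \<open>The group has order \<open>3 * l\<close>, which is odd, so the factor 27 forced on it
  amounts to a factor 9 of \<open>l\<close>.\<close>

lemma contains_2_odd_iff:
  assumes "odd l" shows "contains_regular_origamis 2 l \<longleftrightarrow> 9 dvd l"
proof
  have l1: "l \<ge> 1" using assms by (cases l) auto
  assume "contains_regular_origamis 2 l"
  then obtain G :: "(nat \<Rightarrow> nat) monoid" and x y where G: "two_gen G x y"
    "card (generate G {comtr G x y}) = 2 + 1" "card (carrier G) = l * (2 + 1)"
    using contains_regular_origamisE[of 2 l] l1 by auto
  then have "27 dvd l * 3" using two_gen.order_3_commutator_odd[OF G(1)] assms by simp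
  then show "9 dvd l" by presburger
next
  assume "9 dvd l"
  then obtain m where m: "l = 9 * m" by blast
  then have m0: "m > 0" using assms by (cases m) auto
  obtain G :: "((int \<times> int) \<times> nat) monoid" and x y where
    G: "two_gen G x y" "card (generate G {comtr G x y}) = 3" "card (carrier G) = 27 * m"
    using heisenberg_two_gen[OF m0] by blast
  show "contains_regular_origamis 2 l"
    using two_gen.contains_regular_origamis[OF G(1), of 2 l] G m m0 by simp
qed

lemma contains_prime_factor_cong:
  assumes "contains_regular_origamis k q" "k \<ge> 1" and q: "prime q" and p: "prime p" "p dvd k + 1"
  shows "[p = 1] (mod q)"
proof -
  obtain G :: "(nat \<Rightarrow> nat) monoid" and x y where G: "two_gen G x y"
    "card (generate G {comtr G x y}) = k + 1" "card (carrier G) = q * (k + 1)"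
    using contains_regular_origamisE[OF assms(1,2)] q prime_ge_1_nat by blast
  interpret two_gen G x y by (rule G(1))
  have cG: "card (carrier G) = q * card C" using G by simp
  show ?thesis using normal_prime_index_factor[OF prime_index_normal[OF q cG] q cG p(1)] G p by simp
qed

lemma contains_twice_prime:
  assumes "contains_regular_origamis k (2 * q)" "odd k" "k \<ge> 1" and q: "prime q" "odd q"
  shows "q = 3" "\<not> 8 dvd k + 1" "\<And>p. prime p \<Longrightarrow> odd p \<Longrightarrow> p dvd k + 1 \<Longrightarrow> [p = 1] (mod 3)"
proof -
  have q1: "2 * q \<ge> 1" using q(1) prime_ge_1_nat[of q] by simp
  obtain G :: "(nat \<Rightarrow> nat) monoid" and x y where G: "two_gen G x y"
    "card (generate G {comtr G x y}) = k + 1" "card (carrier G) = 2 * q * (k + 1)"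
    using contains_regular_origamisE[OF assms(1,3) q1] by blast
  have "card (carrier G) = 2 * q * card (generate G {comtr G x y})"
    "even (card (generate G {comtr G x y}))" using G assms(2) by simp_all
  note * = two_gen.index_twice_prime_even[OF G(1) q this]
  show "q = 3" by (rule *(1))
  show "\<not> 8 dvd k + 1" using *(2) G(2) by simp
  show "[p = 1] (mod 3)" if "prime p" "odd p" "p dvd k + 1" for p using *(3)[of p] that G(2) by simp
qed

text \<open>\<open>e\<close> selects the quaternion group or the Klein four-group as source of the
  2-part 4 or 2 of \<open>k + 1\<close>. The cofactor \<open>m\<close> is odd because 2 is not
  congruent to 1 modulo 3.\<close>

lemma contains_6:
  assumes m: "m > 0" "\<And>p. p \<in> prime_factors m \<Longrightarrow> [p = 1] (mod 3)" and k: "k + 1 = (if e then 4 else 2) * m"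
  shows "contains_regular_origamis k 6"
proof -
  have f: "[p = 1] (mod 3)" if "prime p" "p dvd m" for p :: nat
    using m that by (simp add: prime_factors_dvd)
  have "odd m" using f[of 2] by (auto simp: cong_def)
  obtain u :: nat where u: "[int u ^ 3 = 1] (mod int m)" "coprime (int u - 1) (int m)"
    using exists_unit_of_prime_order[of 3 m] m f by auto
  obtain G :: "(((bool \<times> bool \<times> bool) \<times> int) \<times> nat) monoid" and x y where G: "two_gen G x y"
    "card (generate G {comtr G x y}) = k + 1" "card (carrier G) = 6 * (k + 1)"
    using quat_extension_two_gen[OF \<open>odd m\<close> u, of e] unfolding k by blast
  have "k \<ge> 1" using k m(1) by (cases m) (auto split: if_splits)
  then show ?thesis using two_gen.contains_regular_origamis[OF G(1), of k 6] G by simp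
qed

text \<open>Existence comes from the integers modulo \<open>2 * k + 1\<close> extended by a cyclic
  group of order \<open>q\<close> acting through a multiplier \<open>u\<close> with
  \<open>u - 1\<close> a unit.\<close>

lemma contains_prime_iff:
  assumes k: "k \<ge> 1" and q: "prime q" "odd q"
  shows "contains_regular_origamis (2 * k) q \<longleftrightarrow> (\<forall>p\<in>prime_factors (2 * k + 1). [p = 1] (mod q))"
proof
  assume "contains_regular_origamis (2 * k) q"
  then show "\<forall>p\<in>prime_factors (2 * k + 1). [p = 1] (mod q)"
    using contains_prime_factor_cong[of "2 * k" q] k q by (auto simp: prime_factors_dvd)
next
  assume a: "\<forall>p\<in>prime_factors (2 * k + 1). [p = 1] (mod q)"
  obtain u :: nat where u: "[int u ^ q = 1] (mod int (2 * k + 1))" "coprime (int u - 1) (int (2 * k + 1))"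
    using exists_unit_of_prime_order[OF q(1), of "2 * k + 1"] a by (auto simp: prime_factors_dvd)
  show "contains_regular_origamis (2 * k) q"
  proof (rule contains_if_metacyclic[OF _ _ u(1)])
    fix i :: nat
    have "coprime (int (2 * k + 1)) (1 - int u)"
      using u(2) by (metis coprime_commute coprime_minus_right_iff minus_diff_eq)
    then show "int (2 * k + 1) dvd int i * (1 - int u) \<longleftrightarrow> 2 * k + 1 dvd i"
      by (simp only: coprime_dvd_mult_left_iff int_dvd_int_iff)
  qed (use k q prime_gt_1_nat[of q] in auto)
qed

text \<open>\<open>d\<close> is the full 2-part of \<open>k + 1\<close> whenever the stratum
  contains a regular origami: for \<open>k\<close> congruent to 1 modulo 4 by arithmetic, otherwise
  because 8 is excluded. The quotient by \<open>d\<close> is then odd, so only the congruence for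
  odd primes matters.\<close>

lemma contains_6_mod_4:
  assumes k: "odd k" "k \<ge> 1" and d: "d = (if [k = 1] (mod 4) then 2 else 4)"
  shows "contains_regular_origamis k 6 \<longleftrightarrow> (\<forall>p\<in>prime_factors ((k + 1) div d). [p = 1] (mod 3))"
proof
  have k4: "k mod 4 = 1 \<or> k mod 4 = 3" using k(1) by presburger
  have "d dvd k + 1"
  proof (cases "[k = 1] (mod 4)")
    case True then show ?thesis using d k(1) by simp
  next
    case False
    then have "k mod 4 = 3" using k4 by (simp add: cong_def)
    then have "4 dvd k + 1" by presburger
    then show ?thesis using d False by simp
  qed
  then have kd1: "k + 1 = d * ((k + 1) div d)" by (rule dvd_mult_div_cancel[symmetric])
  then have "(k + 1) div d > 0" by (cases "(k + 1) div d") auto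
  note kd = kd1 this
  {
    assume c: "contains_regular_origamis k 6"
    then have c6: "contains_regular_origamis k (2 * 3)" by simp
    have "odd ((k + 1) div d)"
    proof
      assume "even ((k + 1) div d)"
      then obtain j where "(k + 1) div d = 2 * j" by blast
      then have kj: "k + 1 = d * (2 * j)" using kd(1) by simp
      show False
      proof (cases "[k = 1] (mod 4)")
        case True
        then have "k mod 4 = 1" by (simp add: cong_def)
        moreover have "k + 1 = 4 * j" using kj d True by simp
        ultimately show False by presburger
      next
        case False
        then have "k + 1 = 8 * j" using kj d by simp
        then show False using contains_twice_prime(2)[OF c6 k] by simp
      qed
    qed
    then show "\<forall>p\<in>prime_factors ((k + 1) div d). [p = 1] (mod 3)"
    proof (intro ballI)
      fix p assume "p \<in> prime_factors ((k + 1) div d)"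
      then have p: "prime p" "p dvd (k + 1) div d" using kd(2) by (auto simp: prime_factors_dvd)
      then have "odd p" using \<open>odd ((k + 1) div d)\<close> dvd_trans by blast
      moreover have "p dvd k + 1" using kd(1) p(2) by (metis dvd_mult)
      ultimately show "[p = 1] (mod 3)" using contains_twice_prime(3)[OF c6 k _ _ p(1)] by simp
    qed
  next
    assume a: "\<forall>p\<in>prime_factors ((k + 1) div d). [p = 1] (mod 3)"
    show "contains_regular_origamis k 6"
      using contains_6[OF kd(2), of k "d = 4"] a kd(1) d by (auto split: if_splits)
  }
qed

theorem theorem6:
  fixes k l :: nat
  assumes "k \<ge> 1" and "l \<ge> 1"
  shows
    "(even k \<and> even l \<longrightarrow> contains_regular_origamis k l) \<and>
     (odd l \<longrightarrow> (contains_regular_origamis 2 l \<longleftrightarrow> 9 dvd l)) \<and>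
     (odd k \<longrightarrow> \<not> contains_regular_origamis k 2) \<and>
     contains_regular_origamis k 4 \<and>
     ([k = 1] (mod 4) \<longrightarrow>
        (contains_regular_origamis k 6 \<longleftrightarrow> (\<forall>p\<in>prime_factors ((k + 1) div 2). [p = 1] (mod 3)))) \<and>
     ([k = 3] (mod 4) \<longrightarrow>
        (contains_regular_origamis k 6 \<longleftrightarrow> (\<forall>p\<in>prime_factors ((k + 1) div 4). [p = 1] (mod 3)))) \<and>
     (\<forall>q :: nat. prime q \<and> odd q \<longrightarrow>
        (odd k \<and> q > 3 \<longrightarrow> \<not> contains_regular_origamis k (2 * q)) \<and>
        (contains_regular_origamis (2 * k) q \<longleftrightarrow>
           (\<forall>p\<in>prime_factors (2 * k + 1). [p = 1] (mod q))))"
proof -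
  \<comment> \<open>The index 2 is itself prime and 2 divides \<open>k + 1\<close>, but 2 is not
    congruent to 1 modulo 2.\<close>
  have "\<not> contains_regular_origamis k 2" if "odd k"
  proof
    assume "contains_regular_origamis k 2"
    from contains_prime_factor_cong[OF this assms(1) two_is_prime_nat two_is_prime_nat] that
    show False by (simp add: cong_def)
  qed
  moreover have "contains_regular_origamis k 6 \<longleftrightarrow> (\<forall>p\<in>prime_factors ((k + 1) div 2). [p = 1] (mod 3))"
    if "[k = 1] (mod 4)"
  proof -
    have "odd k" using that by (simp add: cong_def) presburger
    then show ?thesis using contains_6_mod_4[OF _ assms(1), of 2] that by simp
  qed
  moreover have "contains_regular_origamis k 6 \<longleftrightarrow> (\<forall>p\<in>prime_factors ((k + 1) div 4). [p = 1] (mod 3))"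
    if "[k = 3] (mod 4)"
  proof -
    have "odd k" "\<not> [k = 1] (mod 4)" using that by (simp_all add: cong_def) presburger
    then show ?thesis using contains_6_mod_4[OF _ assms(1), of 4] by simp
  qed
  moreover have "\<not> contains_regular_origamis k (2 * q)" if "prime q" "odd q" "odd k" "q > 3" for q
    using contains_twice_prime(1)[OF _ that(3) assms(1) that(1,2)] that(4) by auto
  ultimately show ?thesis
    using assms contains_even_even contains_2_odd_iff contains_4 contains_prime_iff by simp
qed

end
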